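(* Let $p=1$ and $q\ge2$. A cut point $(x,0,t)\in\operatorname{Cut}(\mathbb{G}_{q1})$ is conjugate if and only if $$|x|\,\big(|P_{\operatorname{Im}x}^\perp t|-\pi|x^\dagger t|^2\big)=0.$$
   Context: Group. For positive integers $q,p$ let $V_1=\mathbb{R}^{q\times p}\times\mathbb{R}^{p\times 1}$, $V_2=\mathbb{R}^{q\times 1}$ and let $\mathbb{G}_{qp}=V_1\times V_2$ be the step-2 Carnot group (Reiter-Heisenberg group) with product $(x,y,t)\cdot(\xi,\eta,\tau)=\big(x+\xi,\,y+\eta,\,t+\tau+Q((x,y),(\xi,\eta))\big)$, where $Q((x,y),(\xi,\eta))=\tfrac12(x\eta-\xi y)$; here $p=1$. On $V_1$ use the inner product $\langle(x,y),(\xi,\eta)\rangle=\operatorname{trace}(x^T\xi)+y^T\eta$; all matrix norms are Hilbert-Schmidt norms. Horizontal curves and length. A horizontal curve is a Lipschitz curve $\gamma=(x,y,t):[0,T]\to V_1\times V_2$ with $(\dot x,\dot y)=(u,v)$ and $\dot t=Q((x,y),(u,v))$ a.e., for some $L^\infty$ control $(u,v):[0,T]\to V_1$. Its length is $\int_0^T\sqrt{|u|^2+|v|^2}\,ds$. The sub-Riemannian distance is the infimum of lengths of horizontal curves joining two points; a horizontal curve minimizes length on $[0,\bar s]$ if its length on $[0,\bar s]$ equals the distance between its endpoints. Extremals. For $\tau\in\mathbb{R}^q$ let $A_\tau:V_1\to V_1$, $A_\tau(\xi,\eta)=(\tau\eta^T,-\xi^T\tau)$. For $(\xi,\eta,\tau)\in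 V_1\times V_2\simeq T^*_{(0,0,0)}\mathbb{G}_{qp}$, the length-extremal $\gamma(\cdot,\xi,\eta,\tau):\mathbb{R}\to V_1\times V_2$ is the horizontal curve with $\gamma(0,\xi,\eta,\tau)=(0,0,0)$ and control $(u(s),v(s))=e^{-sA_\tau}(\xi,\eta)$ (equivalently, the projection of the solution of the sub-Riemannian normal Hamiltonian system with initial point the origin and initial covector $(\xi,\eta,\tau)$). Cut time and cut locus. For $(\xi,\eta)\neq0$, $t_{\rm cut}(\xi,\eta,\tau)=\sup\{\bar s>0:\gamma(\cdot,\xi,\eta,\tau)\text{ minimizes length on }[0,\bar s]\}\in\,]0,+\infty]$. The cut locus $\operatorname{Cut}(\mathbb{G}_{qp})$ of the origin is the set of cut points, i.e. points $\gamma(t_{\rm cut}(\xi,\eta,\tau),\xi,\eta,\tau)$ with $(\xi,\eta)\neq0$ and $t_{\rm cut}(\xi,\eta,\tau)<+\infty$; every cut point has the form $(x,0,t)$. Conjugate times and points. Given an extremal $\gamma(\cdot,\bar\xi,\bar\eta,\bar\tau)$ with $(\bar\xi,\bar\eta)\ne0$, a time $\bar s>0$ is a conjugate time for it if the differential of the map $(\xi,\eta,\tau)\in\mathbb{G}_{qp}\mapsto\gamma(\bar s,\xi,\eta,\tau)\in\mathbb{G}_{qp}$ is singular at $(\bar\xi,\bar\eta,\bar\tau)$. A cut point $\gamma(t_{\rm cut}(\xi,\eta,\tau),\xi,\eta,\tau)$ is conjugate if $t_{\rm cut}(\xi,\eta,\tau)$ is a conjugate time for $\gamma(\cdot,\xi,\eta,\tau)$.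 Linear algebra. For $x\in\mathbb{R}^{q\times p}$, $\operatorname{Im}x=\{xy:y\in\mathbb{R}^p\}\subset\mathbb{R}^q$; $P_{\operatorname{Im}x}$ and $P_{\operatorname{Im}x}^\perp$ are the orthogonal projections of $\mathbb{R}^q$ onto $\operatorname{Im}x$ and onto its orthogonal complement; $x^\dagger\in\mathbb{R}^{p\times q}$ is the Moore-Penrose inverse of $x$: for $t\in\mathbb{R}^q$, $x^\dagger t$ is uniquely determined by $xx^\dagger t=P_{\operatorname{Im}x}t$ and $x^\dagger t\perp\ker x$. For $p=1$ and $x\ne0$, $x^\dagger t=\langle x,t\rangle/|x|^2$; for $x=0$, $x^\dagger=0$. *)

theory Defs
  imports "HOL-Analysis.Analysis"
begin

text \<open>
  A \<open>q\<close> by \<open>p\<close> matrix is an element of \<open>real ^ 'p ^ 'q\<close> and the column vectors in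
  \<open>V\<^sub>1 \<times> V\<^sub>2\<close> are elements of \<open>real ^ 'p\<close> and \<open>real ^ 'q\<close>. The library inner product and norm
  on these types and on their products are the trace inner product
  \<open>trace (x\<^sup>T \<xi>) + y\<^sup>T \<eta>\<close> and the Hilbert-Schmidt norm.
\<close>

type_synonym ('q, 'p) V1 = "(real ^ 'p ^ 'q) \<times> (real ^ 'p)"
type_synonym ('q, 'p) RH = "('q, 'p) V1 \<times> (real ^ 'q)"

definition Qform :: "('q::finite, 'p::finite) V1 \<Rightarrow> ('q, 'p) V1 \<Rightarrow> real ^ 'q" where
  "Qform z w = (1 / 2) *\<^sub>R (fst z *v snd w - fst w *v snd z)"

definition horizontal_curve ::
    "real \<Rightarrow> real \<Rightarrow> (real \<Rightarrow> ('q::finite, 'p::finite) RH) \<Rightarrow> (real \<Rightarrow> ('q, 'p) V1) \<Rightarrow> bool" where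
  "horizontal_curve a b \<gamma> w \<longleftrightarrow>
     a \<le> b \<and>
     (\<exists>L. L-lipschitz_on {a..b} \<gamma>) \<and>
     w \<in> borel_measurable (lebesgue_on {a..b}) \<and>
     (\<exists>C. AE s in lebesgue_on {a..b}. norm (w s) \<le> C) \<and>
     (AE s in lebesgue_on {a..b}.
        ((\<lambda>r. fst (\<gamma> r)) has_vector_derivative w s) (at s within {a..b}) \<and>
        ((\<lambda>r. snd (\<gamma> r)) has_vector_derivative Qform (fst (\<gamma> s)) (w s)) (at s within {a..b}))"

definition control_length :: "real \<Rightarrow> real \<Rightarrow> (real \<Rightarrow> ('q::finite, 'p::finite) V1) \<Rightarrow> real" where
  "control_length a b w = integral {a..b} (\<lambda>s. norm (w s))"

definition sr_dist :: "('q::finite, 'p::finite) RH \<Rightarrow> ('q, 'p) RH \<Rightarrow> real" where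
  "sr_dist P P' =
     Inf {control_length 0 T w | T w.
            \<exists>\<gamma>. horizontal_curve 0 T \<gamma> w \<and> \<gamma> 0 = P \<and> \<gamma> T = P'}"

text \<open>The control of a horizontal curve is unique up to null sets, so the choice of \<open>w\<close> is irrelevant.\<close>

definition minimizes_length :: "(real \<Rightarrow> ('q::finite, 'p::finite) RH) \<Rightarrow> real \<Rightarrow> bool" where
  "minimizes_length \<gamma> s \<longleftrightarrow>
     (\<exists>w. horizontal_curve 0 s \<gamma> w \<and> control_length 0 s w = sr_dist (\<gamma> 0) (\<gamma> s))"

definition Aop :: "real ^ 'q \<Rightarrow> ('q::finite, 'p::finite) V1 \<Rightarrow> ('q, 'p) V1" where
  "Aop \<tau> z = ((\<chi> i j. \<tau> $ i * snd z $ j), - (transpose (fst z) *v \<tau>))"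

text \<open>The exponential \<open>e\<^sup>A\<close> of a linear operator, applied to a vector.\<close>

definition op_exp :: "('v::real_normed_vector \<Rightarrow> 'v) \<Rightarrow> 'v \<Rightarrow> 'v" where
  "op_exp A v = (\<Sum>n. (1 / fact n) *\<^sub>R (A ^^ n) v)"

definition extremal_control :: "('q::finite, 'p::finite) RH \<Rightarrow> real \<Rightarrow> ('q, 'p) V1" where
  "extremal_control c s = op_exp (\<lambda>z. (- s) *\<^sub>R Aop (snd c) z) (fst c)"

text \<open>The extremal with initial covector \<open>c = ((\<xi>, \<eta>), \<tau>)\<close>.\<close>

definition extremal :: "('q::finite, 'p::finite) RH \<Rightarrow> real \<Rightarrow> ('q, 'p) RH" where
  "extremal c =
     (THE \<gamma>. \<gamma> 0 = 0 \<and> (\<forall>a b. a \<le> b \<longrightarrow> horizontal_curve a b \<gamma> (extremal_control c)))"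

definition cut_time :: "('q::finite, 'p::finite) RH \<Rightarrow> ereal" where
  "cut_time c = Sup (ereal ` {s. s > 0 \<and> minimizes_length (extremal c) s})"

definition cut_point_along :: "('q::finite, 'p::finite) RH \<Rightarrow> ('q, 'p) RH \<Rightarrow> bool" where
  "cut_point_along c P \<longleftrightarrow>
     fst c \<noteq> 0 \<and> cut_time c < \<infinity> \<and> P = extremal c (real_of_ereal (cut_time c))"

definition cut_locus :: "('q::finite, 'p::finite) RH set" where
  "cut_locus = {P. \<exists>c. cut_point_along c P}"

definition conjugate_time :: "('q::finite, 'p::finite) RH \<Rightarrow> real \<Rightarrow> bool" where
  "conjugate_time c s \<longleftrightarrow>
     s > 0 \<and> (\<exists>D. ((\<lambda>c'. extremal c' s) has_derivative D) (at c) \<and> \<not> bij D)"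

definition mat_image :: "real ^ 'p ^ 'q \<Rightarrow> (real ^ 'q::finite) set" where
  "mat_image x = range (\<lambda>y::real ^ 'p::finite. x *v y)"

definition orth_proj :: "'v::real_inner set \<Rightarrow> 'v \<Rightarrow> 'v" where
  "orth_proj S t = (THE v. v \<in> S \<and> t - v \<in> S\<^sup>\<bottom>)"

definition pinv :: "real ^ 'p ^ 'q \<Rightarrow> real ^ 'q::finite ^ 'p::finite" where
  "pinv x =
     (THE z. \<forall>t. x *v (z *v t) = orth_proj (mat_image x) t \<and> z *v t \<in> {y. x *v y = 0}\<^sup>\<bottom>)"

end

theory Submission
  imports Defs
begin

text \<open>
For \<open>p = 1\<close> and \<open>\<tau> \<noteq> 0\<close> put \<open>\<theta> = norm \<tau>\<close>, \<open>e = \<tau> / \<theta>\<close> and \<open>a = e \<bullet> \<xi>\<close>. The extremal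
control rotates the vector \<open>(a, \<eta>)\<close> of the plane spanned by \<open>e\<close> and the \<open>y\<close>-axis with angular speed
\<open>\<theta>\<close> and leaves the component \<open>w\<close> of \<open>\<xi>\<close> orthogonal to \<open>\<tau>\<close> unchanged. So the extremal is a
Heisenberg-type helix carried along a straight line, and everything happens after exactly one turn,
at \<open>s = 2 \<pi> / \<theta>\<close>.

The cut time is \<open>2 \<pi> / \<theta>\<close>, unless the extremal is a straight line (\<open>\<tau> = 0\<close> or \<open>a = \<eta> = 0\<close>), in
which case it is infinite. Before a full turn the extremal is optimal by a calibration: the function
\<^item> \<open>\<theta> (e \<bullet> t) + (\<bar>x\<bar>\<^sup>2 - (e \<bullet> x)\<^sup>2) / (2 s) + (\<theta> / 4) cot (\<theta> s / 2) ((e \<bullet> x)\<^sup>2 + y\<^sup>2)\<close>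

solves the Hamilton-Jacobi equation, so that along every horizontal curve its increase is at most
half the energy, with equality for the extremal (\<open>calibration_pointwise\<close>,
\<open>calibration_inequality\<close>, \<open>length_lower_bound\<close>, \<open>extremal_calibration\<close>). After a full turn,
adding to the curve one full circle of the slightly smaller angular speed \<open>2 \<pi> / L\<close>, of a radius chosen so
that the end point at time \<open>L\<close> does not move, strictly decreases the energy. Such a radius is nonzero as
soon as \<open>y(L) \<noteq> 0\<close>, which happens at times \<open>L\<close> arbitrarily close to the full turn
(\<open>shorter_competitor\<close>, \<open>extremal_y_nonzero_soon\<close>).

At the full turn the differential of the end-point map can be computed in closed form, because there
\<open>1 - cos (\<theta> s)\<close> vanishes to second order and \<open>sin (\<theta> s)\<close> to first order. It is singular if and only if
\<open>\<eta> = 0\<close> or \<open>w = 0\<close> (\<open>end_map_deriv_bij_iff\<close>). In the first case the kernel contains the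
\<open>\<eta>\<close>-direction; in the second case it contains the infinitesimal rotation of \<open>(a, \<eta>)\<close>. Finally the
cut point is \<open>x = s w\<close> and \<open>t = (\<pi> (\<eta>\<^sup>2 + a\<^sup>2) / \<theta>\<^sup>2) e - (s a / \<theta>) w\<close> (\<open>extremal_full_turn\<close>),
whence, for \<open>w \<noteq> 0\<close>, the quantity in parentheses in the theorem equals \<open>\<pi> \<eta>\<^sup>2 / \<theta>\<^sup>2\<close>, while
\<open>\<bar>x\<bar> = 0\<close> means \<open>w = 0\<close>.
\<close>

section \<open>Absolute continuity of Lipschitz curves\<close>

text \<open>
Horizontal curves are differentiable only almost everywhere, so the fundamental theorem is needed with
a negligible exceptional set. Tagged intervals with tag outside \<open>N\<close> are controlled by the derivative
as usual. Those with tag in \<open>N\<close> have, for a fine gauge, a total length as small as desired, and the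
Lipschitz constant turns this into smallness of the corresponding increments.
\<close>

lemma fundamental_theorem_of_calculus_lipschitz:
  fixes f :: "real \<Rightarrow> 'a::banach"
  assumes "a \<le> b" and lip: "L-lipschitz_on {a..b} f" and N: "negligible N"
    and vecd: "\<And>x. x \<in> {a..b} - N \<Longrightarrow> (f has_vector_derivative f' x) (at x within {a..b})"
  shows "(f' has_integral (f b - f a)) {a..b}"
proof -
  \<comment> \<open>With the value zero on \<open>N\<close>, tags in \<open>N\<close> contribute only increments of \<open>f\<close>.\<close>
  define F where "F = (\<lambda>x. if x \<in> N then 0 else f' x)"
  have L0: "L \<ge> 0" using lip lipschitz_on_nonneg by blast
  have "(F has_integral (f b - f a)) {a..b}"
  proof (cases "a = b")
    case True then show ?thesis by auto
  next
    case False
    then have ab: "a < b" using assms(1) by simp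
    show ?thesis
      unfolding has_integral box_real[symmetric]
    proof clarify
      fix e :: real assume "e > 0"
      define e1 where "e1 = e / (2 * (b - a))"
      define e2 where "e2 = e / (2 * (L + 1))"
      have e1: "e1 > 0" using \<open>e > 0\<close> ab by (simp add: e1_def)
      have e2: "e2 > 0" using \<open>e > 0\<close> L0 by (simp add: e2_def)
      have "\<forall>x. \<exists>d>0. x \<in> {a..b} - N \<longrightarrow>
         (\<forall>y\<in>{a..b}. norm (y-x) < d \<longrightarrow> norm (f y - f x - (y-x) *\<^sub>R f' x) \<le> e1 * norm (y-x))"
      proof
        fix x
        show "\<exists>d>0. x \<in> {a..b} - N \<longrightarrow>
           (\<forall>y\<in>{a..b}. norm (y-x) < d \<longrightarrow> norm (f y - f x - (y-x) *\<^sub>R f' x) \<le> e1 * norm (y-x))"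
        proof (cases "x \<in> {a..b} - N")
          case True
          with vecd[OF True, unfolded has_vector_derivative_def has_derivative_within_alt] e1
          show ?thesis by blast
        qed (use zero_less_one in blast)
      qed
      then obtain d where d: "\<And>x. 0 < d x"
         "\<And>x y. \<lbrakk>x \<in> {a..b} - N; y \<in> {a..b}; norm (y-x) < d x\<rbrakk>
             \<Longrightarrow> norm (f y - f x - (y-x) *\<^sub>R f' x) \<le> e1 * norm (y-x)"
        by metis
      have "(indicat_real N has_integral 0) (cbox a b)"
        using N negligible_def by blast
      then obtain g where g: "gauge g"
        "\<And>p. p tagged_division_of cbox a b \<Longrightarrow> g fine p \<Longrightarrow>
            norm (\<Sum>(x,K)\<in>p. measure lborel K *\<^sub>R indicat_real N x) < e2"
        unfolding has_integral using e2 by force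
      show "\<exists>\<gamma>. gauge \<gamma> \<and> (\<forall>p. p tagged_division_of cbox a b \<and> \<gamma> fine p \<longrightarrow>
              norm ((\<Sum>(x, K)\<in>p. measure lborel K *\<^sub>R F x) - (f b - f a)) < e)"
      proof (rule exI, safe)
        show "gauge (\<lambda>x. ball x (d x) \<inter> g x)"
          by (intro gauge_Int gauge_ball_dependent) (use d(1) g(1) in auto)
      next
        fix p
        assume p: "p tagged_division_of cbox a b" and fine: "(\<lambda>x. ball x (d x) \<inter> g x) fine p"
        have fine1: "(\<lambda>x. ball x (d x)) fine p" and fine2: "g fine p"
          using fine by (auto simp: fine_Int)
        have ba: "b - a = (\<Sum>(x,K)\<in>p. Sup K - Inf K)" "f b - f a = (\<Sum>(x,K)\<in>p. f(Sup K) - f(Inf K))"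
          using additive_tagged_division_1[where f= "\<lambda>x. x"] additive_tagged_division_1[where f= f]
            \<open>a \<le> b\<close> p by auto
        have "norm (\<Sum>(x, K) \<in> p. (measure lborel K *\<^sub>R F x) - (f (Sup K) - f (Inf K)))
          \<le> (\<Sum>(x,K)\<in>p. e1 * (Sup K - Inf K) + L * (measure lborel K *\<^sub>R indicat_real N x))"
        proof (rule sum_norm_le, safe)
          fix x K
          assume xK: "(x, K) \<in> p"
          then have "x \<in> K" and kab: "K \<subseteq> cbox a b" using p by blast+
          obtain u v where k: "K = cbox u v" using tagged_division_ofD(4)[OF p xK] by blast
          have uv: "u \<le> v" using \<open>x \<in> K\<close> unfolding k by auto
          have uK: "u \<in> K" "v \<in> K" by (simp_all add: uv k)
          then have uab: "u \<in> {a..b}" "v \<in> {a..b}" "x \<in> {a..b}" using kab \<open>x \<in> K\<close> by auto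
          have ball: "\<forall>y\<in>K. y \<in> ball x (d x)"
            using fine1 xK by blast
          show "norm (measure lborel K *\<^sub>R F x - (f (Sup K) - f (Inf K)))
             \<le> e1 * (Sup K - Inf K) + L * (measure lborel K *\<^sub>R indicat_real N x)"
          proof (cases "x \<in> N")
            case True
            have "norm (f u - f v) \<le> L * (v - u)"
              using lipschitz_onD[OF lip uab(1,2)] uv by (simp add: dist_norm)
            moreover have "0 \<le> e1 * (v - u)" using e1 uv by simp
            ultimately show ?thesis using True uv by (simp add: F_def k)
          next
            case False
            have "norm ((v - u) *\<^sub>R f' x - (f v - f u)) = norm (f u - f x - (u - x) *\<^sub>R f' x - (f v - f x - (v - x) *\<^sub>R f' x))"
              by (auto simp: algebra_simps)
            also have "\<dots> \<le> norm (f u - f x - (u - x) *\<^sub>R f' x) + norm (f v - f x - (v - x) *\<^sub>R f' x)"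
              by (rule norm_triangle_ineq4)
            also have "\<dots> \<le> e1 * norm (u - x) + e1 * norm (v - x)"
            proof (rule add_mono)
              show "norm (f u - f x - (u - x) *\<^sub>R f' x) \<le> e1 * norm (u - x)"
                using d(2)[of x u] ball[rule_format, OF uK(1)] uab False by (simp add: dist_norm norm_minus_commute)
              show "norm (f v - f x - (v - x) *\<^sub>R f' x) \<le> e1 * norm (v - x)"
                using d(2)[of x v] ball[rule_format, OF uK(2)] uab False by (simp add: dist_norm norm_minus_commute)
            qed
            also have "\<dots> = e1 * (v - u)" using \<open>x \<in> K\<close> by (auto simp: k algebra_simps)
            finally show ?thesis using False uv by (simp add: F_def k)
          qed
        qed
        also have "\<dots> = e1 * (b - a) + L * (\<Sum>(x,K)\<in>p. measure lborel K *\<^sub>R indicat_real N x)"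
          unfolding ba(1) by (simp add: sum.distrib sum_distrib_left split_def)
        also have "\<dots> \<le> e1 * (b - a) + L * e2"
          using g(2)[OF p fine2] L0 by (intro add_left_mono mult_left_mono) auto
        also have "\<dots> < e"
        proof -
          have "L * e2 < (L + 1) * e2" using e2 by simp
          also have "\<dots> = e / 2" using L0 by (simp add: e2_def field_simps)
          finally have "L * e2 < e / 2" .
          moreover have "e1 * (b - a) = e / 2" using ab by (simp add: e1_def field_simps)
          ultimately show ?thesis by linarith
        qed
        finally show "norm ((\<Sum>(x, K)\<in>p. measure lborel K *\<^sub>R F x) - (f b - f a)) < e"
          unfolding ba(2) by (simp add: sum_subtractf split_def)
      qed
    qed
  qed
  then show ?thesis
    by (rule has_integral_spike[OF N, rotated]) (auto simp: F_def)
qed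

text \<open>
On compact sets the Lipschitz functions form an algebra; this makes the calibration, evaluated along a
Lipschitz curve, a Lipschitz function to which the preceding theorem applies.
\<close>

lemma lipschitz_on_bilinear:
  assumes bl: "bounded_bilinear pr" and "compact S"
    and f: "\<exists>L. L-lipschitz_on S f" and g: "\<exists>L. L-lipschitz_on S g"
  shows "\<exists>L. L-lipschitz_on S (\<lambda>s. pr (f s) (g s))"
proof -
  obtain K where K: "K \<ge> 0" "\<And>a b. norm (pr a b) \<le> norm a * norm b * K"
    using bounded_bilinear.nonneg_bounded[OF bl] by blast
  obtain L M where L: "L-lipschitz_on S f" and M: "M-lipschitz_on S g" using f g by blast
  have "bounded (f ` S)" "bounded (g ` S)"
    using L M \<open>compact S\<close> by (auto intro!: compact_imp_bounded compact_continuous_image lipschitz_on_continuous_on)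
  then obtain A B where A: "\<And>s. s \<in> S \<Longrightarrow> norm (f s) \<le> A" "A > 0" and B: "\<And>s. s \<in> S \<Longrightarrow> norm (g s) \<le> B" "B > 0"
    unfolding bounded_pos by auto
  have "((L * B + A * M) * K)-lipschitz_on S (\<lambda>s. pr (f s) (g s))"
  proof (rule lipschitz_onI)
    show "0 \<le> (L * B + A * M) * K"
      using A B K(1) lipschitz_on_nonneg[OF L] lipschitz_on_nonneg[OF M] by simp
    fix s r assume sr: "s \<in> S" "r \<in> S"
    have fs: "norm (f s - f r) \<le> L * dist s r" and gs: "norm (g s - g r) \<le> M * dist s r"
      using lipschitz_onD[OF L sr] lipschitz_onD[OF M sr] by (auto simp: dist_norm)
    have "pr (f s) (g s) - pr (f r) (g r) = pr (f s - f r) (g s) + pr (f r) (g s - g r)"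
      using bounded_bilinear.diff_left[OF bl] bounded_bilinear.diff_right[OF bl] by simp
    then have "norm (pr (f s) (g s) - pr (f r) (g r))
        \<le> norm (f s - f r) * norm (g s) * K + norm (f r) * norm (g s - g r) * K"
      using K(2)[of "f s - f r" "g s"] K(2)[of "f r" "g s - g r"] norm_triangle_ineq
      by (smt (verit))
    also have "\<dots> \<le> (L * dist s r) * B * K + A * (M * dist s r) * K"
      using fs gs A B sr K(1) lipschitz_on_nonneg[OF L]
      by (intro add_mono mult_right_mono mult_mono) auto
    finally show "dist (pr (f s) (g s)) (pr (f r) (g r)) \<le> (L * B + A * M) * K * dist s r"
      by (simp add: dist_norm algebra_simps)
  qed
  then show ?thesis by blast
qed

lemma lipschitz_on_C1:
  fixes f :: "real \<Rightarrow> 'a::real_normed_vector"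
  assumes der: "\<And>s. s \<in> {a..b} \<Longrightarrow> (f has_vector_derivative f' s) (at s within {a..b})"
    and cont: "continuous_on {a..b} f'"
  shows "\<exists>L. L-lipschitz_on {a..b} f"
proof -
  have "bounded (f' ` {a..b})"
    using cont by (intro compact_imp_bounded compact_continuous_image) auto
  then obtain C where C: "C > 0" "\<And>s. s \<in> {a..b} \<Longrightarrow> norm (f' s) \<le> C"
    unfolding bounded_pos by auto
  have "C-lipschitz_on {a..b} f"
  proof (rule bounded_derivative_imp_lipschitz)
    fix s assume s: "s \<in> {a..b}"
    show "(f has_derivative (\<lambda>r. r *\<^sub>R f' s)) (at s within {a..b})"
      using der[OF s] by (simp add: has_vector_derivative_def)
    show "onorm (\<lambda>r. r *\<^sub>R f' s) \<le> C"
    proof (rule onorm_bound)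
      show "norm (r *\<^sub>R f' s) \<le> C * norm r" for r
        using mult_right_mono[OF C(2)[OF s], of "norm r"] by (simp add: mult.commute)
    qed (use C in simp)
  qed (use C in auto)
  then show ?thesis by blast
qed

section \<open>The calibration inequality\<close>

text \<open>
The Hamilton-Jacobi inequality for the calibration. The left-hand side is the derivative of the
calibration along a curve at the point \<open>(x, y)\<close> with velocity \<open>(u, v)\<close>, when the time parameter \<open>s\<close>
of the calibration runs with speed \<open>g\<close> and its coefficient \<open>k\<close> satisfies \<open>k' = - (k\<^sup>2 + \<theta>\<^sup>2 / 4)\<close>.
The right-hand side minus the left-hand side is \<open>1 / (2 g)\<close> times a sum of squares, namely the
squared distance between \<open>(u, v)\<close> and \<open>g\<close> times the velocity of the optimal flow at \<open>(x, y)\<close>.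
\<close>

lemma calibration_pointwise:
  fixes x u e :: "'a::real_inner" and y v s g k \<theta> :: real
  assumes e: "norm e = 1" and s: "s > 0" and g: "g > 0"
  shows "\<theta> / 2 * (v * (e \<bullet> x) - y * (e \<bullet> u)) + (x \<bullet> u - (e \<bullet> x) * (e \<bullet> u)) / s
       - (x \<bullet> x - (e \<bullet> x)\<^sup>2) * g / (2 * s\<^sup>2)
       + k * ((e \<bullet> x) * (e \<bullet> u) + y * v) - (k\<^sup>2 + \<theta>\<^sup>2 / 4) * g / 2 * ((e \<bullet> x)\<^sup>2 + y\<^sup>2)
     \<le> ((norm u)\<^sup>2 + v\<^sup>2) / (2 * g)" (is "?L \<le> ?R")
proof -
  define w where "w = (u - (e \<bullet> u) *\<^sub>R e) - (g / s) *\<^sub>R (x - (e \<bullet> x) *\<^sub>R e)"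
  define X U where "X = e \<bullet> x" and "U = e \<bullet> u"
  have ee: "e \<bullet> e = 1" using e by (simp add: norm_eq_1)
  have ww: "w \<bullet> w = (u \<bullet> u - U\<^sup>2) - 2 * (g / s) * (x \<bullet> u - X * U) + (g / s)\<^sup>2 * (x \<bullet> x - X\<^sup>2)"
    unfolding w_def X_def U_def
    by (simp add: inner_diff_left inner_diff_right inner_commute ee algebra_simps power2_eq_square)
  have "(?R - ?L) * (2 * g) = w \<bullet> w + (U - g * (k * X - \<theta> / 2 * y))\<^sup>2 + (v - g * (k * y + \<theta> / 2 * X))\<^sup>2"
    unfolding ww X_def[symmetric] U_def[symmetric] dot_square_norm[symmetric]
    using s g by (simp add: field_simps) (simp add: power2_eq_square algebra_simps)
  also have "\<dots> \<ge> 0" by simp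
  finally show ?thesis using g by (simp add: zero_le_mult_iff)
qed

text \<open>
The time change \<open>\<sigma>\<close> replaces a reparametrization of the curve: its speed \<open>g\<close> will be almost
proportional to the speed of the curve, and then the weighted energy on the right is almost the square of
the length. The calibration is singular at time \<open>0\<close>, but it vanishes at the origin for every positive
time; this is why \<open>\<sigma>\<close> is required to start at a positive value.
\<close>

lemma calibration_inequality:
  fixes x u t :: "real \<Rightarrow> 'a::euclidean_space" and y v \<sigma> g k :: "real \<Rightarrow> real" and e :: 'a and \<theta> T :: real
  assumes T: "0 \<le> T" and e: "norm e = 1"
    and lip: "\<exists>L. L-lipschitz_on {0..T} x" "\<exists>L. L-lipschitz_on {0..T} y" "\<exists>L. L-lipschitz_on {0..T} t"
    and init: "x 0 = 0" "y 0 = 0" "t 0 = 0"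
    and N: "negligible N"
    and dx: "\<And>r. r \<in> {0..T} - N \<Longrightarrow> (x has_vector_derivative u r) (at r within {0..T})"
    and dy: "\<And>r. r \<in> {0..T} - N \<Longrightarrow> (y has_vector_derivative v r) (at r within {0..T})"
    and dt: "\<And>r. r \<in> {0..T} - N \<Longrightarrow>
        (t has_vector_derivative (1/2) *\<^sub>R (v r *\<^sub>R x r - y r *\<^sub>R u r)) (at r within {0..T})"
    and d\<sigma>: "\<And>r. r \<in> {0..T} \<Longrightarrow> (\<sigma> has_real_derivative g r) (at r within {0..T})"
    and contg: "continuous_on {0..T} g"
    and gpos: "\<And>r. r \<in> {0..T} \<Longrightarrow> g r > 0" and spos: "\<And>r. r \<in> {0..T} \<Longrightarrow> \<sigma> r > 0"
    and dk: "\<And>r. r \<in> {0..T} \<Longrightarrow> (k has_real_derivative - ((k (\<sigma> r))\<^sup>2 + \<theta>\<^sup>2 / 4)) (at (\<sigma> r))"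
    and int: "(\<lambda>r. ((norm (u r))\<^sup>2 + (v r)\<^sup>2) / g r) integrable_on {0..T}"
  shows "\<theta> * (e \<bullet> t T) + (x T \<bullet> x T - (e \<bullet> x T)\<^sup>2) / (2 * \<sigma> T) + k (\<sigma> T) / 2 * ((e \<bullet> x T)\<^sup>2 + (y T)\<^sup>2)
      \<le> integral {0..T} (\<lambda>r. ((norm (u r))\<^sup>2 + (v r)\<^sup>2) / g r) / 2"
proof -
  define G where "G = (\<lambda>r. \<theta> * (e \<bullet> t r) + (x r \<bullet> x r - (e \<bullet> x r) * (e \<bullet> x r)) * (1 / (2 * \<sigma> r))
      + (k (\<sigma> r) / 2) * ((e \<bullet> x r) * (e \<bullet> x r) + y r * y r))"
  define F where "F = (\<lambda>r. ((norm (u r))\<^sup>2 + (v r)\<^sup>2) / g r / 2)"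
  \<comment> \<open>On \<open>N\<close> the integrand is set to the bound \<open>F\<close>, so that the pointwise inequality holds everywhere.\<close>
  define G' where "G' = (\<lambda>r. if r \<in> N then F r else
      \<theta> / 2 * (v r * (e \<bullet> x r) - y r * (e \<bullet> u r)) + (x r \<bullet> u r - (e \<bullet> x r) * (e \<bullet> u r)) / \<sigma> r
       - (x r \<bullet> x r - (e \<bullet> x r)\<^sup>2) * g r / (2 * (\<sigma> r)\<^sup>2)
       + k (\<sigma> r) * ((e \<bullet> x r) * (e \<bullet> u r) + y r * v r)
       - ((k (\<sigma> r))\<^sup>2 + \<theta>\<^sup>2 / 4) * g r / 2 * ((e \<bullet> x r)\<^sup>2 + (y r)\<^sup>2))"
  have comp: "compact {0..T}" by simp
  have cs: "continuous_on {0..T} \<sigma>"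
    using d\<sigma> by (meson DERIV_continuous_on)
  have dks: "((\<lambda>r. k (\<sigma> r) / 2) has_real_derivative - ((k (\<sigma> r))\<^sup>2 + \<theta>\<^sup>2 / 4) * g r / 2) (at r within {0..T})"
    if "r \<in> {0..T}" for r
    using DERIV_chain2[OF dk[OF that] d\<sigma>[OF that]] by (rule DERIV_cdivide)
  have dinv: "((\<lambda>r. 1 / (2 * \<sigma> r)) has_real_derivative - g r / (2 * (\<sigma> r)\<^sup>2)) (at r within {0..T})"
    if "r \<in> {0..T}" for r
    using spos[OF that]
    by (auto intro!: derivative_eq_intros d\<sigma>[OF that] simp: field_simps power2_eq_square)
  have cks: "continuous_on {0..T} (\<lambda>r. k (\<sigma> r))"
  proof (rule DERIV_continuous_on)
    fix r assume "r \<in> {0..T}"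
    then show "((\<lambda>r. k (\<sigma> r)) has_real_derivative - ((k (\<sigma> r))\<^sup>2 + \<theta>\<^sup>2 / 4) * g r) (at r within {0..T})"
      using DERIV_chain2[OF dk d\<sigma>] by blast
  qed
  have l1: "\<exists>L. L-lipschitz_on {0..T} (\<lambda>r. k (\<sigma> r) / 2)"
    by (rule lipschitz_on_C1[OF dks[unfolded has_real_derivative_iff_has_vector_derivative]]) (auto intro!: continuous_intros cks contg)
  have l2: "\<exists>L. L-lipschitz_on {0..T} (\<lambda>r. 1 / (2 * \<sigma> r))"
    by (rule lipschitz_on_C1[OF dinv[unfolded has_real_derivative_iff_has_vector_derivative]]) (use spos in \<open>auto intro!: continuous_intros cs contg simp: less_imp_neq[symmetric]\<close>)
  have const: "\<exists>L. L-lipschitz_on {0..T} (\<lambda>r. c)" for c :: "'b::metric_space"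
    using lipschitz_on_constant by blast
  note mult = lipschitz_on_bilinear[OF bounded_bilinear_mult comp]
  note inn = lipschitz_on_bilinear[OF bounded_bilinear_inner comp]
  have add: "\<exists>L. L-lipschitz_on {0..T} (\<lambda>r. f r + h r)"
    and diff: "\<exists>L. L-lipschitz_on {0..T} (\<lambda>r. f r - h r)"
    if "\<exists>L. L-lipschitz_on {0..T} f" "\<exists>L. L-lipschitz_on {0..T} h" for f h :: "real \<Rightarrow> real"
    using that lipschitz_on_add lipschitz_on_diff by blast+
  have "\<exists>L. L-lipschitz_on {0..T} G"
    unfolding G_def
    by (intro add diff mult inn lip const l1 l2)
  then obtain L where LG: "L-lipschitz_on {0..T} G" by blast
  have dG: "(G has_vector_derivative G' r) (at r within {0..T})" if r: "r \<in> {0..T} - N" for r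
  proof -
    have r': "r \<in> {0..T}" using r by simp
    note D = dx[OF r, unfolded has_vector_derivative_def] dy[OF r, unfolded has_vector_derivative_def]
      dt[OF r, unfolded has_vector_derivative_def]
      dinv[OF r', unfolded has_field_derivative_def] dks[OF r', unfolded has_field_derivative_def]
    show ?thesis
      unfolding has_vector_derivative_def G_def
      apply (rule has_derivative_eq_rhs)
       apply (rule D derivative_intros)+
      using r spos[OF r']
      apply (intro ext)
      apply (simp add: G'_def inner_commute inner_diff_right field_simps)
      apply (simp add: power2_eq_square algebra_simps)
      done
  qed
  have "(G' has_integral (G T - G 0)) {0..T}"
    by (rule fundamental_theorem_of_calculus_lipschitz[OF T LG N dG])
  moreover have "(F has_integral integral {0..T} F) {0..T}"
    unfolding F_def by (intro integrable_integral integrable_on_divide int)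
  moreover have "G' r \<le> F r" if "r \<in> {0..T}" for r
    using calibration_pointwise[OF e spos[OF that] gpos[OF that],
      where \<theta> = \<theta> and v = "v r" and x = "x r" and y = "y r" and u = "u r" and k = "k (\<sigma> r)"]
    by (simp add: G'_def F_def mult.commute[of "g r" 2])
  ultimately have "G T - G 0 \<le> integral {0..T} F"
    using has_integral_le by blast
  moreover have "G 0 = 0" using init by (simp add: G_def)
  moreover have "integral {0..T} F = integral {0..T} (\<lambda>r. ((norm (u r))\<^sup>2 + (v r)\<^sup>2) / g r) / 2"
    unfolding F_def by (rule integral_unique[OF has_integral_divide[OF integrable_integral[OF int]]])
  moreover have "G T = \<theta> * (e \<bullet> t T) + (x T \<bullet> x T - (e \<bullet> x T)\<^sup>2) / (2 * \<sigma> T) + k (\<sigma> T) / 2 * ((e \<bullet> x T)\<^sup>2 + (y T)\<^sup>2)"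
    by (simp add: G_def power2_eq_square)
  ultimately show ?thesis by linarith
qed

section \<open>From energy to length\<close>

text \<open>
The speed of a horizontal curve is bounded only off a negligible set; the next two facts are the
corresponding versions of integrability and of bounded convergence.
\<close>

lemma bounded_measurable_integrable:
  fixes f :: "real \<Rightarrow> real"
  assumes meas: "f \<in> borel_measurable (lebesgue_on {a..b})" and N: "negligible N"
    and bound: "\<And>r. r \<in> {a..b} - N \<Longrightarrow> \<bar>f r\<bar> \<le> C"
  shows "f integrable_on {a..b}"
proof -
  have "(\<lambda>r. max (- \<bar>C\<bar>) (min \<bar>C\<bar> (f r))) integrable_on {a..b}"
  proof (rule measurable_bounded_by_integrable_imp_integrable_real)
    show "(\<lambda>r. max (- \<bar>C\<bar>) (min \<bar>C\<bar> (f r))) \<in> borel_measurable (lebesgue_on {a..b})"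
      using meas by measurable
    show "(\<lambda>r. \<bar>C\<bar>) integrable_on {a..b}" by (rule integrable_const_ivl)
  qed auto
  then show ?thesis
    by (rule integrable_spike[OF _ N]) (use bound in \<open>force simp: max_def min_def\<close>)
qed

lemma dominated_convergence_off_negligible:
  fixes f :: "nat \<Rightarrow> real \<Rightarrow> real"
  assumes N: "negligible N" and f: "\<And>j. f j integrable_on {a..b}"
    and bound: "\<And>j r. r \<in> {a..b} - N \<Longrightarrow> \<bar>f j r\<bar> \<le> C"
    and conv: "\<And>r. r \<in> {a..b} - N \<Longrightarrow> (\<lambda>j. f j r) \<longlonglongrightarrow> h r"
  shows "h integrable_on {a..b}" "(\<lambda>j. integral {a..b} (f j)) \<longlonglongrightarrow> integral {a..b} h"
proof -
  define z where "z = (\<lambda>f r. if r \<in> N then 0 else (f r :: real))"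
  have int: "integral {a..b} f = integral {a..b} (z f)" for f
    by (rule integral_spike[OF N]) (auto simp: z_def)
  have zi: "z (f j) integrable_on {a..b}" for j
    by (rule integrable_spike[OF f N]) (auto simp: z_def)
  have ci: "(\<lambda>r. \<bar>C\<bar>) integrable_on {a..b}" by (rule integrable_const_ivl)
  have bd: "norm (z (f j) r) \<le> \<bar>C\<bar>" if "r \<in> {a..b}" for j r
    using bound[of r j] that by (auto simp: z_def)
  have cv: "(\<lambda>j. z (f j) r) \<longlonglongrightarrow> z h r" if "r \<in> {a..b}" for r
    using conv[of r] that by (auto simp: z_def)
  show "(\<lambda>j. integral {a..b} (f j)) \<longlonglongrightarrow> integral {a..b} h"
    using dominated_convergence(2)[OF zi ci bd cv] unfolding int[symmetric] by simp
  have "z h integrable_on {a..b}"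
    using dominated_convergence(1)[OF zi ci bd cv] by simp
  then show "h integrable_on {a..b}"
    by (rule integrable_spike[OF _ N]) (auto simp: z_def)
qed

text \<open>
The speed of a curve is only measurable, and the time change in the calibration has to be continuously
differentiable. So the speed is replaced by continuous functions with the same bounds.
\<close>

lemma continuous_approximation:
  fixes n :: "real \<Rightarrow> real"
  assumes meas: "n \<in> borel_measurable (lebesgue_on {a..b})" and N: "negligible N"
    and bound: "\<And>r. r \<in> {a..b} - N \<Longrightarrow> 0 \<le> n r \<and> n r \<le> C" and "C \<ge> 0"
  obtains M G where "negligible M" "\<And>j. continuous_on UNIV (G j)"
    "\<And>j r. 0 \<le> G j r \<and> G j r \<le> C" "\<And>r. r \<in> {a..b} - M \<Longrightarrow> (\<lambda>j. G j r) \<longlonglongrightarrow> n r"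
proof -
  have "n measurable_on {a..b}"
    using meas by (simp add: measurable_on_iff_borel_measurable)
  then obtain M g where M: "negligible M" and g: "\<And>j. continuous_on UNIV (g j)"
    and conv: "\<And>r. r \<notin> M \<Longrightarrow> (\<lambda>j. g j r) \<longlonglongrightarrow> (if r \<in> {a..b} then n r else 0)"
    unfolding measurable_on_def by blast
  define G where "G = (\<lambda>j r. max 0 (min C (g j r)))"
  show ?thesis
  proof
    show "negligible (M \<union> N)" using M N by (rule negligible_Un)
    show "continuous_on UNIV (G j)" for j
      unfolding G_def by (intro continuous_intros g)
    show "0 \<le> G j r \<and> G j r \<le> C" for j r using \<open>C \<ge> 0\<close> by (auto simp: G_def)
    show "(\<lambda>j. G j r) \<longlonglongrightarrow> n r" if "r \<in> {a..b} - (M \<union> N)" for r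
    proof -
      have "(\<lambda>j. g j r) \<longlonglongrightarrow> n r" using conv[of r] that by auto
      then have "(\<lambda>j. G j r) \<longlonglongrightarrow> max 0 (min C (n r))"
        unfolding G_def by (intro tendsto_intros)
      moreover have "max 0 (min C (n r)) = n r" using bound[of r] that by auto
      ultimately show ?thesis by simp
    qed
  qed
qed

text \<open>
Let \<open>A\<close> be the value of the calibration at the end point and at time \<open>s\<close>. By the calibration
inequality, \<open>2 A\<close> is at most the energy \<open>\<integral> n\<^sup>2 / g\<close> for every continuous \<open>g > 0\<close> with integral
\<open>s\<close>. The ideal choice \<open>g = s n / len\<close>, where \<open>len\<close> is the length, would give \<open>len\<^sup>2 / s\<close>. It is reached
in two limits: continuous approximations of \<open>n + \<epsilon>\<close>, and then \<open>\<epsilon>\<close> to zero.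
\<close>

lemma length_lower_bound:
  fixes x u t :: "real \<Rightarrow> 'a::euclidean_space" and y v n k :: "real \<Rightarrow> real" and e :: 'a and \<theta> T C S s :: real
  assumes T: "0 \<le> T" and e: "norm e = 1"
    and lip: "\<exists>L. L-lipschitz_on {0..T} x" "\<exists>L. L-lipschitz_on {0..T} y" "\<exists>L. L-lipschitz_on {0..T} t"
    and init: "x 0 = 0" "y 0 = 0" "t 0 = 0"
    and N: "negligible N"
    and dx: "\<And>r. r \<in> {0..T} - N \<Longrightarrow> (x has_vector_derivative u r) (at r within {0..T})"
    and dy: "\<And>r. r \<in> {0..T} - N \<Longrightarrow> (y has_vector_derivative v r) (at r within {0..T})"
    and dt: "\<And>r. r \<in> {0..T} - N \<Longrightarrow>
        (t has_vector_derivative (1/2) *\<^sub>R (v r *\<^sub>R x r - y r *\<^sub>R u r)) (at r within {0..T})"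
    and meas: "n \<in> borel_measurable (lebesgue_on {0..T})"
    and nbound: "\<And>r. r \<in> {0..T} - N \<Longrightarrow> 0 \<le> n r \<and> n r \<le> C"
    and nsq: "\<And>r. (n r)\<^sup>2 = (norm (u r))\<^sup>2 + (v r)\<^sup>2"
    and s: "0 < s" "s < S"
    and dk: "\<And>r. 0 < r \<Longrightarrow> r < S \<Longrightarrow> (k has_real_derivative - ((k r)\<^sup>2 + \<theta>\<^sup>2 / 4)) (at r)"
  shows "2 * (\<theta> * (e \<bullet> t T) + (x T \<bullet> x T - (e \<bullet> x T)\<^sup>2) / (2 * s) + k s / 2 * ((e \<bullet> x T)\<^sup>2 + (y T)\<^sup>2)) * s
      \<le> (integral {0..T} n)\<^sup>2"
proof (cases "T = 0")
  case True
  then show ?thesis using init by simp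
next
  case False
  then have Tpos: "T > 0" using T by simp
  define A where "A = (\<lambda>s. \<theta> * (e \<bullet> t T) + (x T \<bullet> x T - (e \<bullet> x T)\<^sup>2) / (2 * s) + k s / 2 * ((e \<bullet> x T)\<^sup>2 + (y T)\<^sup>2))"
  have "\<exists>C. (\<forall>r\<in>{0..T} - N. 0 \<le> n r \<and> n r \<le> C) \<and> C \<ge> 0"
    using nbound by (intro exI[of _ "max 0 C"]) force
  then obtain C where C: "\<And>r. r \<in> {0..T} - N \<Longrightarrow> 0 \<le> n r \<and> n r \<le> C" "C \<ge> 0" by blast
  have energy: "2 * A s \<le> integral {0..T} (\<lambda>r. (n r)\<^sup>2 / g r)"
    if g: "continuous_on {0..T} g" and gpos: "\<And>r. r \<in> {0..T} \<Longrightarrow> g r > 0"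
      and gint: "integral {0..T} g = s" and int: "(\<lambda>r. (n r)\<^sup>2 / g r) integrable_on {0..T}" for g
  proof -
    \<comment> \<open>The clock of the calibration starts at \<open>\<eta>\<close> and ends at \<open>s + \<eta>\<close>; then \<open>\<eta>\<close> tends to zero.\<close>
    have "A (s + \<eta>) \<le> integral {0..T} (\<lambda>r. (n r)\<^sup>2 / g r) / 2" if \<eta>: "0 < \<eta>" "\<eta> < S - s" for \<eta>
    proof -
      define \<sigma> where "\<sigma> = (\<lambda>r. integral {0..r} g + \<eta>)"
      have gi: "g integrable_on {0..T}" using g integrable_continuous_real by blast
      have \<sigma>T: "\<sigma> T = s + \<eta>" by (simp add: \<sigma>_def gint)
      have sub: "0 \<le> integral {0..r} g" "integral {0..r} g \<le> s" if "r \<in> {0..T}" for r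
      proof -
        have gr: "g integrable_on {0..r}" by (rule integrable_on_subinterval[OF gi]) (use that in auto)
        show "0 \<le> integral {0..r} g"
          by (rule integral_nonneg[OF gr]) (use gpos that in \<open>force simp: less_imp_le\<close>)
        show "integral {0..r} g \<le> s"
          unfolding gint[symmetric]
          by (rule integral_subset_le[OF _ gr gi]) (use gpos that in \<open>force simp: less_imp_le\<close>)+
      qed
      have d\<sigma>: "(\<sigma> has_real_derivative g r) (at r within {0..T})" if "r \<in> {0..T}" for r
        unfolding \<sigma>_def using integral_has_real_derivative[OF g that]
        by (auto intro!: derivative_eq_intros)
      have range: "0 < \<sigma> r \<and> \<sigma> r < S" if "r \<in> {0..T}" for r
        using sub[OF that] \<eta> by (auto simp: \<sigma>_def)
      have int': "(\<lambda>r. ((norm (u r))\<^sup>2 + (v r)\<^sup>2) / g r) integrable_on {0..T}"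
        using int by (simp add: nsq)
      show ?thesis
        using calibration_inequality[OF T e lip init N dx dy dt d\<sigma> g gpos _ dk int'] range
        unfolding A_def \<sigma>T by (simp add: nsq)
    qed
    then have ev: "\<forall>\<^sub>F \<eta> in at_right 0. A (s + \<eta>) \<le> integral {0..T} (\<lambda>r. (n r)\<^sup>2 / g r) / 2"
      using s by (intro eventually_at_rightI[of 0 "S - s"]) auto
    have "isCont k s" using dk s DERIV_isCont by blast
    then have "isCont A s" unfolding A_def using s by (intro continuous_intros) auto
    then have "(A \<longlongrightarrow> A s) (at s)" by (simp add: isCont_def)
    then have "((\<lambda>\<eta>. A (s + \<eta>)) \<longlongrightarrow> A s) (at 0)" using LIM_offset_zero by blast
    then have "((\<lambda>\<eta>. A (s + \<eta>)) \<longlongrightarrow> A s) (at_right 0)"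
      using filterlim_at_split by blast
    then have "A s \<le> integral {0..T} (\<lambda>r. (n r)\<^sup>2 / g r) / 2"
      by (rule tendsto_upperbound[OF _ ev]) simp
    then show ?thesis by simp
  qed
  have nint: "n integrable_on {0..T}"
    by (rule bounded_measurable_integrable[OF meas N, of C]) (use C in force)
  obtain M G where M: "negligible M" and G: "\<And>j. continuous_on UNIV (G j)"
    "\<And>j r. 0 \<le> G j r \<and> G j r \<le> C" "\<And>r. r \<in> {0..T} - M \<Longrightarrow> (\<lambda>j. G j r) \<longlonglongrightarrow> n r"
    using continuous_approximation[OF meas N C(1) C(2)] by metis
  define len where "len = integral {0..T} n"
  have l0: "len \<ge> 0" 
  proof -
    have "len = integral {0..T} (\<lambda>r. if r \<in> N then 0 else n r)"
      unfolding len_def by (rule integral_spike[OF N]) auto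
    also have "\<dots> \<ge> 0"
      by (rule integral_nonneg) (use C(1) integrable_spike[OF nint N, of "\<lambda>r. if r \<in> N then 0 else n r"] in auto)
    finally show ?thesis .
  qed
  have MN: "negligible (M \<union> N)" using M N by (rule negligible_Un)
  have eps: "2 * A s * s \<le> (len + \<epsilon> * T) * len" if \<epsilon>: "\<epsilon> > 0" for \<epsilon>
  proof -
    have Gc: "continuous_on {0..T} (\<lambda>r. G j r + \<epsilon>)" for j
      by (intro continuous_intros continuous_on_subset[OF G(1)]) auto
    have Gi: "(\<lambda>r. G j r + \<epsilon>) integrable_on {0..T}" for j
      using Gc integrable_continuous_real by blast
    have Gpos: "G j r + \<epsilon> > 0" for j r using G(2)[of j r] \<epsilon> by linarith
    have l1: "(\<lambda>j. integral {0..T} (\<lambda>r. G j r + \<epsilon>)) \<longlonglongrightarrow> integral {0..T} (\<lambda>r. n r + \<epsilon>)"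
    proof (rule dominated_convergence_off_negligible(2)[OF MN Gi])
      show "\<bar>G j r + \<epsilon>\<bar> \<le> C + \<epsilon>" for j r using G(2)[of j r] \<epsilon> by linarith
      show "(\<lambda>j. G j r + \<epsilon>) \<longlonglongrightarrow> n r + \<epsilon>" if "r \<in> {0..T} - (M \<union> N)" for r
        by (intro tendsto_intros G(3)) (use that in auto)
    qed
    have qb: "\<bar>(n r)\<^sup>2 / (G j r + \<epsilon>)\<bar> \<le> C\<^sup>2 / \<epsilon>" if "r \<in> {0..T} - N" for j r
    proof -
      have "(n r)\<^sup>2 \<le> C\<^sup>2" using C(1)[OF that] by (intro power_mono) auto
      then have "(n r)\<^sup>2 / (G j r + \<epsilon>) \<le> C\<^sup>2 / \<epsilon>"
        using G(2)[of j r] \<epsilon> by (intro frac_le) auto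
      then show ?thesis using Gpos[of j r] by simp
    qed
    have qi: "(\<lambda>r. (n r)\<^sup>2 / (G j r + \<epsilon>)) integrable_on {0..T}" for j
    proof (rule bounded_measurable_integrable[OF _ N qb])
      have "(\<lambda>r. G j r + \<epsilon>) \<in> borel_measurable (lebesgue_on {0..T})"
        by (rule continuous_imp_measurable_on_sets_lebesgue[OF Gc]) auto
      then show "(\<lambda>r. (n r)\<^sup>2 / (G j r + \<epsilon>)) \<in> borel_measurable (lebesgue_on {0..T})"
        using meas by measurable
    qed
    have conv2: "(\<lambda>j. (n r)\<^sup>2 / (G j r + \<epsilon>)) \<longlonglongrightarrow> (n r)\<^sup>2 / (n r + \<epsilon>)" if "r \<in> {0..T} - (M \<union> N)" for r
      using C(1)[of r] \<epsilon> that by (intro tendsto_intros G(3)) auto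
    have b2: "\<bar>(n r)\<^sup>2 / (G j r + \<epsilon>)\<bar> \<le> C\<^sup>2 / \<epsilon>" if "r \<in> {0..T} - (M \<union> N)" for j r
      using qb that by blast
    note dc = dominated_convergence_off_negligible[OF MN qi b2 conv2]
    have "2 * A s * s \<le> integral {0..T} (\<lambda>r. G j r + \<epsilon>) * integral {0..T} (\<lambda>r. (n r)\<^sup>2 / (G j r + \<epsilon>))" for j
    proof -
      define I where "I = integral {0..T} (\<lambda>r. G j r + \<epsilon>)"
      have "integral {0..T} (\<lambda>r. \<epsilon>) \<le> I" unfolding I_def
        by (rule integral_le[OF _ Gi]) (use G(2) in auto)
      moreover have "T * \<epsilon> > 0" using \<epsilon> Tpos by simp
      ultimately have I: "I > 0" using T by simp
      have eq: "(\<lambda>r. (n r)\<^sup>2 / (s / I * (G j r + \<epsilon>))) = (\<lambda>r. (I / s) * ((n r)\<^sup>2 / (G j r + \<epsilon>)))"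
        using I s Gpos by (auto simp: field_simps)
      have "2 * A s \<le> integral {0..T} (\<lambda>r. (n r)\<^sup>2 / (s / I * (G j r + \<epsilon>)))"
      proof (rule energy)
        show "continuous_on {0..T} (\<lambda>r. s / I * (G j r + \<epsilon>))"
          by (intro continuous_intros Gc[unfolded atLeastAtMost_def] Gc continuous_on_subset[OF G(1)]) auto
        show "integral {0..T} (\<lambda>r. s / I * (G j r + \<epsilon>)) = s"
          using I by (simp add: I_def[symmetric])
        show "(\<lambda>r. (n r)\<^sup>2 / (s / I * (G j r + \<epsilon>))) integrable_on {0..T}"
          unfolding eq by (intro integrable_on_mult_right qi)
      qed (use I s Gpos in auto)
      also have "\<dots> = (I / s) * integral {0..T} (\<lambda>r. (n r)\<^sup>2 / (G j r + \<epsilon>))"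
        unfolding eq by (rule integral_mult_right)
      finally show ?thesis using s by (simp add: I_def field_simps)
    qed
    then have "2 * A s * s \<le> integral {0..T} (\<lambda>r. n r + \<epsilon>) * integral {0..T} (\<lambda>r. (n r)\<^sup>2 / (n r + \<epsilon>))"
      by (intro LIMSEQ_le_const[OF tendsto_mult[OF l1 dc(2)]]) auto
    also have "integral {0..T} (\<lambda>r. n r + \<epsilon>) = len + \<epsilon> * T"
      using T by (subst integral_add[OF nint integrable_const_ivl]) (simp add: len_def)
    also have "(len + \<epsilon> * T) * integral {0..T} (\<lambda>r. (n r)\<^sup>2 / (n r + \<epsilon>)) \<le> (len + \<epsilon> * T) * len"
    proof (rule mult_left_mono)
      have "((\<lambda>r. if r \<in> N then n r else (n r)\<^sup>2 / (n r + \<epsilon>)) has_integral integral {0..T} (\<lambda>r. (n r)\<^sup>2 / (n r + \<epsilon>))) {0..T}"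
        by (rule has_integral_spike[OF N _ integrable_integral[OF dc(1)]]) auto
      then show "integral {0..T} (\<lambda>r. (n r)\<^sup>2 / (n r + \<epsilon>)) \<le> len"
      proof (rule has_integral_le)
        show "(n has_integral len) {0..T}" unfolding len_def using nint by (rule integrable_integral)
        fix r assume r: "r \<in> {0..T}"
        show "(if r \<in> N then n r else (n r)\<^sup>2 / (n r + \<epsilon>)) \<le> n r"
        proof (cases "r \<in> N")
          case False
          then have "0 \<le> n r" using C(1) r by blast
          then show ?thesis using False \<epsilon> by (simp add: divide_le_eq power2_eq_square algebra_simps)
        qed simp
      qed
      show "0 \<le> len + \<epsilon> * T" using l0 \<epsilon> T by simp
    qed
    finally show ?thesis .
  qed
  have "((\<lambda>\<epsilon>. (len + \<epsilon> * T) * len) \<longlongrightarrow> (len + 0 * T) * len) (at_right 0)"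
    by (intro tendsto_intros)
  then have "2 * A s * s \<le> (len + 0 * T) * len"
    by (rule tendsto_lowerbound) (use eps in \<open>auto intro: eventually_at_rightI[of 0 1]\<close>)
  then show ?thesis by (simp add: A_def len_def power2_eq_square)
qed

section \<open>Horizontal curves\<close>

text \<open>
The definition of horizontal curves uses the Lebesgue measure restricted to the interval, whereas the
integration lemmas above use exceptional negligible sets.
\<close>

lemma AE_lebesgue_on_iff_negligible:
  fixes a b :: real
  shows "(AE s in lebesgue_on {a..b}. P s) \<longleftrightarrow> (\<exists>N. negligible N \<and> (\<forall>s\<in>{a..b} - N. P s))"
proof
  assume "AE s in lebesgue_on {a..b}. P s"
  then obtain N where "\<And>s. s \<in> space (lebesgue_on {a..b}) - N \<Longrightarrow> P s" "N \<in> null_sets (lebesgue_on {a..b})"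
    using AE_E3 by blast
  then show "\<exists>N. negligible N \<and> (\<forall>s\<in>{a..b} - N. P s)"
    by (auto simp: null_sets_restrict_space negligible_iff_null_sets)
next
  assume "\<exists>N. negligible N \<and> (\<forall>s\<in>{a..b} - N. P s)"
  then obtain N where N: "negligible N" "\<forall>s\<in>{a..b} - N. P s" by blast
  have "negligible (N \<inter> {a..b})" using N(1) by (rule negligible_subset) auto
  then have "N \<inter> {a..b} \<in> null_sets (lebesgue_on {a..b})"
    by (auto simp: null_sets_restrict_space negligible_iff_null_sets)
  then show "AE s in lebesgue_on {a..b}. P s"
    by (rule AE_I') (use N(2) in auto)
qed

lemma horizontal_curve_ae:
  assumes "horizontal_curve a b \<gamma> w"
  obtains N C where "negligible N" "\<And>s. s \<in> {a..b} - N \<Longrightarrow> norm (w s) \<le> C"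
    "\<And>s. s \<in> {a..b} - N \<Longrightarrow> ((\<lambda>r. fst (\<gamma> r)) has_vector_derivative w s) (at s within {a..b})"
    "\<And>s. s \<in> {a..b} - N \<Longrightarrow> ((\<lambda>r. snd (\<gamma> r)) has_vector_derivative Qform (fst (\<gamma> s)) (w s)) (at s within {a..b})"
proof -
  obtain C N M where "negligible N" "negligible M" "\<forall>s\<in>{a..b} - N. norm (w s) \<le> C"
    "\<forall>s\<in>{a..b} - M. ((\<lambda>r. fst (\<gamma> r)) has_vector_derivative w s) (at s within {a..b}) \<and>
        ((\<lambda>r. snd (\<gamma> r)) has_vector_derivative Qform (fst (\<gamma> s)) (w s)) (at s within {a..b})"
    using assms unfolding horizontal_curve_def AE_lebesgue_on_iff_negligible by blast
  then show thesis
    by (intro that[of "N \<union> M" C] negligible_Un) auto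
qed

lemma horizontal_curve_C1:
  assumes "a \<le> b" and cont: "continuous_on UNIV w"
    and d1: "\<And>s. ((\<lambda>r. fst (\<gamma> r)) has_vector_derivative w s) (at s within {a..b})"
    and d2: "\<And>s. ((\<lambda>r. snd (\<gamma> r)) has_vector_derivative Qform (fst (\<gamma> s)) (w s)) (at s within {a..b})"
    and cQ: "continuous_on {a..b} (\<lambda>s. Qform (fst (\<gamma> s)) (w s))"
  shows "horizontal_curve a b \<gamma> w"
proof -
  have cw: "continuous_on {a..b} w" using cont continuous_on_subset by blast
  obtain L where L: "L-lipschitz_on {a..b} (\<lambda>r. fst (\<gamma> r))" using lipschitz_on_C1[OF d1 cw] by blast
  obtain M where M: "M-lipschitz_on {a..b} (\<lambda>r. snd (\<gamma> r))" using lipschitz_on_C1[OF d2 cQ] by blast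
  have "\<exists>L. L-lipschitz_on {a..b} \<gamma>"
    using lipschitz_on_Pair[OF L M] by auto
  moreover have "bounded (w ` {a..b})" by (intro compact_imp_bounded compact_continuous_image cw) auto
  then obtain C where "\<And>s. s \<in> {a..b} \<Longrightarrow> norm (w s) \<le> C" unfolding bounded_iff by blast
  then have "\<exists>C. AE s in lebesgue_on {a..b}. norm (w s) \<le> C"
    unfolding AE_lebesgue_on_iff_negligible by (intro exI[of _ C] exI[of _ "{}"]) auto
  moreover have "w \<in> borel_measurable (lebesgue_on {a..b})"
    by (rule continuous_imp_measurable_on_sets_lebesgue[OF cw]) auto
  ultimately show ?thesis
    unfolding horizontal_curve_def AE_lebesgue_on_iff_negligible
    using assms(1) d1 d2 by (auto intro!: exI[of _ "{}"])
qed

lemma integrable_control_norm: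
  assumes "horizontal_curve a b \<gamma> w"
  shows "(\<lambda>s. norm (w s)) integrable_on {a..b}"
proof -
  obtain N C where N: "negligible N" "\<And>s. s \<in> {a..b} - N \<Longrightarrow> norm (w s) \<le> C"
    using horizontal_curve_ae[OF assms] by metis
  have "w \<in> borel_measurable (lebesgue_on {a..b})" using assms by (simp add: horizontal_curve_def)
  then have "(\<lambda>s. norm (w s)) \<in> borel_measurable (lebesgue_on {a..b})" by measurable
  then show ?thesis
    by (rule bounded_measurable_integrable[OF _ N(1)]) (use N(2) in auto)
qed

lemma horizontal_curve_integral:
  assumes h: "horizontal_curve a b \<gamma> w" and pq: "a \<le> p" "p \<le> q" "q \<le> b"
  shows "(w has_integral (fst (\<gamma> q) - fst (\<gamma> p))) {p..q}"
    and "((\<lambda>s. Qform (fst (\<gamma> s)) (w s)) has_integral (snd (\<gamma> q) - snd (\<gamma> p))) {p..q}"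
proof -
  have sub: "{p..q} \<subseteq> {a..b}" using pq by auto
  obtain L where "L-lipschitz_on {a..b} \<gamma>" using h unfolding horizontal_curve_def by blast
  then have L: "L-lipschitz_on {p..q} \<gamma>" using sub lipschitz_on_subset by blast
  have Lf: "L-lipschitz_on {p..q} (\<lambda>s. fst (\<gamma> s))" and Ls: "L-lipschitz_on {p..q} (\<lambda>s. snd (\<gamma> s))"
    using L dist_fst_le dist_snd_le unfolding lipschitz_on_def by (meson order_trans)+
  obtain N where N: "negligible N" 
    "\<And>s. s \<in> {a..b} - N \<Longrightarrow> ((\<lambda>r. fst (\<gamma> r)) has_vector_derivative w s) (at s within {a..b})"
    "\<And>s. s \<in> {a..b} - N \<Longrightarrow> ((\<lambda>r. snd (\<gamma> r)) has_vector_derivative Qform (fst (\<gamma> s)) (w s)) (at s within {a..b})"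
    using horizontal_curve_ae[OF h] by metis
  show "(w has_integral (fst (\<gamma> q) - fst (\<gamma> p))) {p..q}"
    by (rule fundamental_theorem_of_calculus_lipschitz[OF pq(2) Lf N(1)])
       (rule has_vector_derivative_within_subset[OF N(2) sub], use sub in auto)
  show "((\<lambda>s. Qform (fst (\<gamma> s)) (w s)) has_integral (snd (\<gamma> q) - snd (\<gamma> p))) {p..q}"
    by (rule fundamental_theorem_of_calculus_lipschitz[OF pq(2) Ls N(1)])
       (rule has_vector_derivative_within_subset[OF N(3) sub], use sub in auto)
qed

text \<open>
Concatenation at time \<open>b\<close>. The point \<open>b\<close> itself joins the exceptional set, because the control
may jump there.
\<close>

lemma horizontal_curve_join:
  assumes h1: "horizontal_curve a b \<gamma>1 w1" and h2: "horizontal_curve b c \<gamma>2 w2"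
    and eq: "\<gamma>1 b = \<gamma>2 b"
    and m: "w1 \<in> borel_measurable borel" "w2 \<in> borel_measurable borel"
  defines "\<gamma> \<equiv> \<lambda>s. if s \<le> b then \<gamma>1 s else \<gamma>2 s" and "w \<equiv> \<lambda>s. if s \<le> b then w1 s else w2 s"
  shows "horizontal_curve a c \<gamma> w"
proof -
  have abc: "a \<le> b" "b \<le> c" using h1 h2 by (auto simp: horizontal_curve_def)
  obtain L1 where "L1-lipschitz_on {a..b} \<gamma>1" using h1 unfolding horizontal_curve_def by blast
  moreover obtain L2 where "L2-lipschitz_on {b..c} \<gamma>2" using h2 unfolding horizontal_curve_def by blast
  ultimately have lip: "\<exists>L. L-lipschitz_on {a..c} \<gamma>"
    unfolding \<gamma>_def using lipschitz_on_concat_max eq by blast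
  have "w \<in> borel_measurable borel" unfolding w_def using m by measurable
  then have meas: "w \<in> borel_measurable (lebesgue_on {a..c})"
    by (intro measurable_restrict_space1 measurable_completion) simp
  obtain N1 C1 where N1: "negligible N1" "\<And>s. s \<in> {a..b} - N1 \<Longrightarrow> norm (w1 s) \<le> C1"
    "\<And>s. s \<in> {a..b} - N1 \<Longrightarrow> ((\<lambda>r. fst (\<gamma>1 r)) has_vector_derivative w1 s) (at s within {a..b})"
    "\<And>s. s \<in> {a..b} - N1 \<Longrightarrow> ((\<lambda>r. snd (\<gamma>1 r)) has_vector_derivative Qform (fst (\<gamma>1 s)) (w1 s)) (at s within {a..b})"
    using horizontal_curve_ae[OF h1] by metis
  obtain N2 C2 where N2: "negligible N2" "\<And>s. s \<in> {b..c} - N2 \<Longrightarrow> norm (w2 s) \<le> C2"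
    "\<And>s. s \<in> {b..c} - N2 \<Longrightarrow> ((\<lambda>r. fst (\<gamma>2 r)) has_vector_derivative w2 s) (at s within {b..c})"
    "\<And>s. s \<in> {b..c} - N2 \<Longrightarrow> ((\<lambda>r. snd (\<gamma>2 r)) has_vector_derivative Qform (fst (\<gamma>2 s)) (w2 s)) (at s within {b..c})"
    using horizontal_curve_ae[OF h2] by metis
  have left: "((\<lambda>r. f (\<gamma> r)) has_vector_derivative d) (at s within {a..c})"
    if s: "a \<le> s" "s < b" and d: "((\<lambda>r. f (\<gamma>1 r)) has_vector_derivative d) (at s within {a..b})"
    for f :: "_ \<Rightarrow> 'z::real_normed_vector" and d s
  proof -
    have "at s within {a..b} = at s within {a..c}"
      by (rule at_within_nhd[of _ "{..<b}"]) (use s abc in auto)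
    with d have "((\<lambda>r. f (\<gamma>1 r)) has_vector_derivative d) (at s within {a..c})" by simp
    then show ?thesis
      by (rule has_vector_derivative_transform_within[of _ _ _ _ "b - s"])
         (use s abc in \<open>auto simp: \<gamma>_def dist_real_def\<close>)
  qed
  have right: "((\<lambda>r. f (\<gamma> r)) has_vector_derivative d) (at s within {a..c})"
    if s: "b < s" "s \<le> c" and d: "((\<lambda>r. f (\<gamma>2 r)) has_vector_derivative d) (at s within {b..c})"
    for f :: "_ \<Rightarrow> 'z::real_normed_vector" and d s
  proof -
    have "at s within {b..c} = at s within {a..c}"
      by (rule at_within_nhd[of _ "{b<..}"]) (use s abc in auto)
    with d have "((\<lambda>r. f (\<gamma>2 r)) has_vector_derivative d) (at s within {a..c})" by simp
    then show ?thesis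
      by (rule has_vector_derivative_transform_within[of _ _ _ _ "s - b"])
         (use s abc in \<open>auto simp: \<gamma>_def dist_real_def\<close>)
  qed
  have neg: "negligible (insert b (N1 \<union> N2))" using N1(1) N2(1) by (simp add: negligible_Un)
  have bd: "norm (w s) \<le> max C1 C2" if "s \<in> {a..c} - insert b (N1 \<union> N2)" for s
    using N1(2)[of s] N2(2)[of s] that by (auto simp: w_def)
  have dr: "((\<lambda>r. fst (\<gamma> r)) has_vector_derivative w s) (at s within {a..c}) \<and>
       ((\<lambda>r. snd (\<gamma> r)) has_vector_derivative Qform (fst (\<gamma> s)) (w s)) (at s within {a..c})"
    if "s \<in> {a..c} - insert b (N1 \<union> N2)" for s
  proof (cases "s < b")
    case True
    then show ?thesis
      using left[of s fst, OF _ _ N1(3)] left[of s snd, OF _ _ N1(4)] that by (auto simp: w_def \<gamma>_def)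
  next
    case False
    then show ?thesis
      using right[of s fst, OF _ _ N2(3)] right[of s snd, OF _ _ N2(4)] that by (auto simp: w_def \<gamma>_def)
  qed
  show ?thesis
    unfolding horizontal_curve_def AE_lebesgue_on_iff_negligible
  proof (intro conjI)
    show "\<exists>C N. negligible N \<and> (\<forall>s\<in>{a..c} - N. norm (w s) \<le> C)"
      using neg bd by blast
    show "\<exists>N. negligible N \<and> (\<forall>s\<in>{a..c} - N.
        ((\<lambda>r. fst (\<gamma> r)) has_vector_derivative w s) (at s within {a..c}) \<and>
        ((\<lambda>r. snd (\<gamma> r)) has_vector_derivative Qform (fst (\<gamma> s)) (w s)) (at s within {a..c}))"
      using neg dr by blast
  qed (use abc lip meas in auto)
qed

lemma control_length_nonneg:
  assumes "horizontal_curve a b \<gamma> w"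
  shows "0 \<le> control_length a b w"
  unfolding control_length_def by (rule integral_nonneg[OF integrable_control_norm[OF assms]]) simp

lemma sr_dist_le:
  assumes "horizontal_curve 0 T \<gamma> w"
  shows "sr_dist (\<gamma> 0) (\<gamma> T) \<le> control_length 0 T w"
  unfolding sr_dist_def
proof (rule cInf_lower)
  show "control_length 0 T w \<in> {control_length 0 T' w' |T' w'. \<exists>\<gamma>'. horizontal_curve 0 T' \<gamma>' w' \<and> \<gamma>' 0 = \<gamma> 0 \<and> \<gamma>' T' = \<gamma> T}"
    using assms by blast
  show "bdd_below {control_length 0 T' w' |T' w'. \<exists>\<gamma>'. horizontal_curve 0 T' \<gamma>' w' \<and> \<gamma>' 0 = \<gamma> 0 \<and> \<gamma>' T' = \<gamma> T}"
    using control_length_nonneg by (intro bdd_belowI[of _ 0]) blast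
qed

text \<open>
Two controls of the same curve are both its derivative almost everywhere.
\<close>

lemma control_length_unique:
  assumes h1: "horizontal_curve a b \<gamma> w1" and h2: "horizontal_curve a b \<gamma> w2" and "a < b"
  shows "control_length a b w1 = control_length a b w2"
proof -
  obtain N1 where N1: "negligible N1" 
    "\<And>s. s \<in> {a..b} - N1 \<Longrightarrow> ((\<lambda>r. fst (\<gamma> r)) has_vector_derivative w1 s) (at s within {a..b})"
    using horizontal_curve_ae[OF h1] by metis
  obtain N2 where N2: "negligible N2" 
    "\<And>s. s \<in> {a..b} - N2 \<Longrightarrow> ((\<lambda>r. fst (\<gamma> r)) has_vector_derivative w2 s) (at s within {a..b})"
    using horizontal_curve_ae[OF h2] by metis
  have "w2 s = w1 s" if "s \<in> {a..b} - (N1 \<union> N2)" for s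
    by (rule vector_derivative_unique_within_closed_interval[of a b s])
       (use that N1(2) N2(2) \<open>a < b\<close> in auto)
  then show ?thesis
    unfolding control_length_def by (intro integral_spike[of "N1 \<union> N2"] negligible_Un N1(1) N2(1)) auto
qed

text \<open>
The first layer is the integral of the control; knowing it, the second layer is the integral of a known
function. This gives uniqueness in the definite description that defines extremals.
\<close>

lemma horizontal_curve_unique:
  assumes h1: "horizontal_curve a b \<gamma>1 w" and h2: "horizontal_curve a b \<gamma>2 w"
    and s: "s \<in> {a..b}" and eq: "\<gamma>1 s = \<gamma>2 s" and r: "r \<in> {a..b}"
  shows "\<gamma>1 r = \<gamma>2 r"
proof -
  have f: "fst (\<gamma>1 r) = fst (\<gamma>2 r)" if r: "r \<in> {a..b}" for r
  proof (cases "s \<le> r")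
    case True
    then show ?thesis
      using has_integral_unique[OF horizontal_curve_integral(1)[OF h1, of s r] horizontal_curve_integral(1)[OF h2, of s r]] s r eq
      by auto
  next
    case False
    then show ?thesis
      using has_integral_unique[OF horizontal_curve_integral(1)[OF h1, of r s] horizontal_curve_integral(1)[OF h2, of r s]] s r eq
      by auto
  qed
  have i: "((\<lambda>s. Qform (fst (\<gamma>1 s)) (w s)) has_integral (snd (\<gamma>2 q) - snd (\<gamma>2 p))) {p..q}"
    if "a \<le> p" "p \<le> q" "q \<le> b" for p q
    using horizontal_curve_integral(2)[OF h2 that]
    by (rule has_integral_eq[rotated]) (use f that in auto)
  have "snd (\<gamma>1 r) = snd (\<gamma>2 r)"
  proof (cases "s \<le> r")
    case True
    then show ?thesis
      using has_integral_unique[OF horizontal_curve_integral(2)[OF h1, of s r] i[of s r]] s r eq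
      by auto
  next
    case False
    then show ?thesis
      using has_integral_unique[OF horizontal_curve_integral(2)[OF h1, of r s] i[of r s]] s r eq
      by auto
  qed
  then show ?thesis using f[OF r] by (simp add: prod_eq_iff)
qed

lemma extremal_eqI:
  assumes "\<gamma> 0 = 0" and "\<And>a b. a \<le> b \<Longrightarrow> horizontal_curve a b \<gamma> (extremal_control c)"
  shows "extremal c = \<gamma>"
  unfolding extremal_def
proof (rule the_equality)
  show "\<gamma> 0 = 0 \<and> (\<forall>a b. a \<le> b \<longrightarrow> horizontal_curve a b \<gamma> (extremal_control c))"
    using assms by blast
next
  fix \<gamma>' assume a: "\<gamma>' 0 = 0 \<and> (\<forall>a b. a \<le> b \<longrightarrow> horizontal_curve a b \<gamma>' (extremal_control c))"
  show "\<gamma>' = \<gamma>"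
  proof
    fix s :: real
    have b: "0 \<in> {- \<bar>s\<bar>..\<bar>s\<bar>}" "s \<in> {- \<bar>s\<bar>..\<bar>s\<bar>}" by auto
    show "\<gamma>' s = \<gamma> s"
      by (rule horizontal_curve_unique[where w = "extremal_control c", OF _ _ b(1) _ b(2)]) (use a assms in auto)
  qed
qed

section \<open>Explicit extremals of the model\<close>

text \<open>
The components \<open>x\<close>, \<open>y\<close>, \<open>t\<close> of the extremal with initial covector \<open>((\<xi>, \<eta>), \<tau>)\<close>, \<open>\<tau> \<noteq> 0\<close>, and
the components \<open>u\<close>, \<open>v\<close> of its control, in a model where column vectors are elements of an arbitrary
inner product space. The formulas use \<open>\<tau>\<close> and its norm instead of the unit vector \<open>e\<close>, which keeps
the differentiation with respect to \<open>\<tau>\<close> simple.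
\<close>

definition extremal_y :: "'a::real_inner \<Rightarrow> real \<Rightarrow> 'a \<Rightarrow> real \<Rightarrow> real" where
  "extremal_y \<xi> \<eta> \<tau> s = \<eta> * (sin (norm \<tau> * s) / norm \<tau>) + (\<xi> \<bullet> \<tau>) * ((1 - cos (norm \<tau> * s)) / norm \<tau> ^ 2)"

text \<open>
The integral of \<open>y\<close> from \<open>0\<close> to \<open>s\<close>. As \<open>u' = - v \<tau>\<close> and \<open>v = y'\<close>, one has \<open>u = \<xi> - y \<tau>\<close>, and
hence \<open>x\<close> is \<open>s \<xi>\<close> minus this integral times \<open>\<tau>\<close>.
\<close>

definition extremal_y_integral :: "'a::real_inner \<Rightarrow> real \<Rightarrow> 'a \<Rightarrow> real \<Rightarrow> real" where
  "extremal_y_integral \<xi> \<eta> \<tau> s = \<eta> * ((1 - cos (norm \<tau> * s)) / norm \<tau> ^ 2)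
     + (\<xi> \<bullet> \<tau>) * ((norm \<tau> * s - sin (norm \<tau> * s)) / norm \<tau> ^ 3)"

definition extremal_x :: "'a::real_inner \<Rightarrow> real \<Rightarrow> 'a \<Rightarrow> real \<Rightarrow> 'a" where
  "extremal_x \<xi> \<eta> \<tau> s = s *\<^sub>R \<xi> - extremal_y_integral \<xi> \<eta> \<tau> s *\<^sub>R \<tau>"

text \<open>
The first term is the area swept in the plane of \<open>\<tau>\<close> and the \<open>y\<close>-axis, which is that of a circular
segment of angle \<open>\<theta> s\<close>. The second comes from the interaction of \<open>y\<close> with the uniform motion along
the component of \<open>\<xi>\<close> orthogonal to \<open>\<tau>\<close>.
\<close>

definition extremal_t :: "'a::real_inner \<Rightarrow> real \<Rightarrow> 'a \<Rightarrow> real \<Rightarrow> 'a" where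
  "extremal_t \<xi> \<eta> \<tau> s = ((\<eta>\<^sup>2 + (\<xi> \<bullet> \<tau>)\<^sup>2 / norm \<tau> ^ 2) * ((norm \<tau> * s - sin (norm \<tau> * s)) / norm \<tau> ^ 3) / 2) *\<^sub>R \<tau>
     + (s * extremal_y \<xi> \<eta> \<tau> s / 2 - extremal_y_integral \<xi> \<eta> \<tau> s) *\<^sub>R (\<xi> - ((\<xi> \<bullet> \<tau>) / norm \<tau> ^ 2) *\<^sub>R \<tau>)"

definition extremal_v :: "'a::real_inner \<Rightarrow> real \<Rightarrow> 'a \<Rightarrow> real \<Rightarrow> real" where
  "extremal_v \<xi> \<eta> \<tau> s = \<eta> * cos (norm \<tau> * s) + (\<xi> \<bullet> \<tau>) * (sin (norm \<tau> * s) / norm \<tau>)"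

definition extremal_u :: "'a::real_inner \<Rightarrow> real \<Rightarrow> 'a \<Rightarrow> real \<Rightarrow> 'a" where
  "extremal_u \<xi> \<eta> \<tau> s = \<xi> - extremal_y \<xi> \<eta> \<tau> s *\<^sub>R \<tau>"

lemma has_vector_derivative_scaleR_const:
  assumes "(f has_real_derivative f') F"
  shows "((\<lambda>s. f s *\<^sub>R c) has_vector_derivative f' *\<^sub>R c) F"
  using bounded_linear.has_vector_derivative[OF bounded_linear_scaleR_left, of f f' F c] assms
  by (simp add: has_real_derivative_iff_has_vector_derivative)

lemma extremal_init: "extremal_x \<xi> \<eta> \<tau> 0 = 0" "extremal_y \<xi> \<eta> \<tau> 0 = 0" "extremal_t \<xi> \<eta> \<tau> 0 = 0"
  by (simp_all add: extremal_x_def extremal_y_def extremal_y_integral_def extremal_t_def)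

lemma extremal_y_deriv:
  assumes "\<tau> \<noteq> 0"
  shows "(extremal_y \<xi> \<eta> \<tau> has_real_derivative extremal_v \<xi> \<eta> \<tau> s) (at s within A)"
proof -
  define \<theta> where "\<theta> = norm \<tau>"
  have "\<theta> > 0" using assms by (simp add: \<theta>_def)
  then show ?thesis
    unfolding extremal_y_def[abs_def] extremal_v_def \<theta>_def[symmetric]
    by (auto intro!: derivative_eq_intros simp: field_simps power2_eq_square)
qed

lemma extremal_y_integral_deriv:
  assumes "\<tau> \<noteq> 0"
  shows "(extremal_y_integral \<xi> \<eta> \<tau> has_real_derivative extremal_y \<xi> \<eta> \<tau> s) (at s within A)"
proof -
  define \<theta> where "\<theta> = norm \<tau>"
  have "\<theta> > 0" using assms by (simp add: \<theta>_def)
  then show ?thesis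
    unfolding extremal_y_integral_def[abs_def] extremal_y_def \<theta>_def[symmetric]
    by (auto intro!: derivative_eq_intros simp: field_simps power2_eq_square power3_eq_cube)
qed

lemma extremal_x_deriv:
  assumes "\<tau> \<noteq> 0"
  shows "(extremal_x \<xi> \<eta> \<tau> has_vector_derivative extremal_u \<xi> \<eta> \<tau> s) (at s within A)"
  unfolding extremal_x_def[abs_def] extremal_u_def
  by (auto intro!: derivative_eq_intros extremal_y_integral_deriv[OF assms] simp: has_real_derivative_iff_has_vector_derivative[symmetric])

lemma extremal_t_deriv:
  assumes "\<tau> \<noteq> 0"
  shows "(extremal_t \<xi> \<eta> \<tau> has_vector_derivative
     (1/2) *\<^sub>R (extremal_v \<xi> \<eta> \<tau> s *\<^sub>R extremal_x \<xi> \<eta> \<tau> s - extremal_y \<xi> \<eta> \<tau> s *\<^sub>R extremal_u \<xi> \<eta> \<tau> s)) (at s within A)"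
proof -
  define \<theta> P where "\<theta> = norm \<tau>" and "P = \<xi> \<bullet> \<tau>"
  define C S where "C = cos (\<theta> * s)" and "S = sin (\<theta> * s)"
  have \<theta>: "\<theta> > 0" using assms by (simp add: \<theta>_def)
  have CS: "C\<^sup>2 = 1 - S\<^sup>2" by (simp add: C_def S_def cos_squared_eq)
  have d: "((\<lambda>s. (\<eta>\<^sup>2 + P\<^sup>2 / \<theta>^2) * ((\<theta> * s - sin (\<theta> * s)) / \<theta>^3) / 2) has_real_derivative
      (\<eta>\<^sup>2 + P\<^sup>2 / \<theta>^2) * ((1 - C) / \<theta>^2) / 2) (at s within A)"
    unfolding C_def using \<theta> 
    by (auto intro!: derivative_eq_intros simp: field_simps power2_eq_square power3_eq_cube)
  have d2: "((\<lambda>s. s * extremal_y \<xi> \<eta> \<tau> s / 2 - extremal_y_integral \<xi> \<eta> \<tau> s) has_real_derivative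
     (s * extremal_v \<xi> \<eta> \<tau> s - extremal_y \<xi> \<eta> \<tau> s) / 2) (at s within A)"
    by (auto intro!: derivative_eq_intros extremal_y_deriv[OF assms] extremal_y_integral_deriv[OF assms] simp: field_simps)
  define y v Y where "y = extremal_y \<xi> \<eta> \<tau> s" and "v = extremal_v \<xi> \<eta> \<tau> s" and "Y = extremal_y_integral \<xi> \<eta> \<tau> s"
  have yvY: "y = \<eta> * (S / \<theta>) + P * ((1 - C) / \<theta>\<^sup>2)" "v = \<eta> * C + P * (S / \<theta>)"
     "Y = \<eta> * ((1 - C) / \<theta>\<^sup>2) + P * ((\<theta> * s - S) / \<theta>^3)"
    by (simp_all add: y_def v_def Y_def extremal_y_def extremal_v_def extremal_y_integral_def \<theta>_def P_def C_def S_def)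
  have key: "(\<eta>\<^sup>2 + P\<^sup>2 / \<theta>^2) * ((1 - C) / \<theta>^2) / 2 - (s * v - y) / 2 * (P / \<theta>\<^sup>2)
      = (y * y - v * Y) / 2"
  proof -
    have "(\<eta>\<^sup>2 * \<theta>^2 + P\<^sup>2) * (1 - C)  - (s * v - y) * (P * \<theta>\<^sup>2) = (y * y - v * Y) * \<theta>^4"
    proof -
      have a: "y * \<theta>^2 = \<eta> * S * \<theta> + P * (1 - C)" "v * \<theta> = \<eta> * C * \<theta> + P * S"
        "Y * \<theta>^3 = \<eta> * (1 - C) * \<theta> + P * (\<theta> * s - S)"
        using \<theta> by (simp_all add: yvY field_simps power2_eq_square power3_eq_cube)
      have "(y * y - v * Y) * \<theta>^4 = (y * \<theta>^2)^2 - (v * \<theta>) * (Y * \<theta>^3)"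
        by (simp add: algebra_simps power2_eq_square power3_eq_cube power4_eq_xxxx)
      also have "\<dots> = (\<eta>\<^sup>2 * \<theta>^2 + P\<^sup>2) * (1 - C)  - (s * (v * \<theta>) * \<theta> - y * \<theta>^2) * P"
        unfolding a using CS by algebra
      finally show ?thesis by (simp add: algebra_simps power2_eq_square)
    qed
    moreover have "(\<eta>\<^sup>2 + P\<^sup>2 / \<theta>^2) * ((1 - C) / \<theta>^2) / 2 - (s * v - y) / 2 * (P / \<theta>\<^sup>2)
      = ((\<eta>\<^sup>2 * \<theta>^2 + P\<^sup>2) * (1 - C)  - (s * v - y) * (P * \<theta>\<^sup>2)) / (2 * \<theta>^4)"
      using \<theta> by (simp add: field_simps power2_eq_square power4_eq_xxxx)
    ultimately show ?thesis using \<theta> by simp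
  qed
  have "((\<lambda>s. ((\<eta>\<^sup>2 + P\<^sup>2 / \<theta>^2) * ((\<theta> * s - sin (\<theta> * s)) / \<theta>^3) / 2) *\<^sub>R \<tau>
     + (s * extremal_y \<xi> \<eta> \<tau> s / 2 - extremal_y_integral \<xi> \<eta> \<tau> s) *\<^sub>R (\<xi> - (P / \<theta>^2) *\<^sub>R \<tau>)) has_vector_derivative
     ((\<eta>\<^sup>2 + P\<^sup>2 / \<theta>^2) * ((1 - C) / \<theta>^2) / 2) *\<^sub>R \<tau> + ((s * v - y) / 2) *\<^sub>R (\<xi> - (P / \<theta>^2) *\<^sub>R \<tau>)) (at s within A)"
    unfolding y_def v_def
    by (intro has_vector_derivative_add has_vector_derivative_scaleR_const d d2)
  also have "((\<eta>\<^sup>2 + P\<^sup>2 / \<theta>^2) * ((1 - C) / \<theta>^2) / 2) *\<^sub>R \<tau> + ((s * v - y) / 2) *\<^sub>R (\<xi> - (P / \<theta>^2) *\<^sub>R \<tau>)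
     = ((\<eta>\<^sup>2 + P\<^sup>2 / \<theta>^2) * ((1 - C) / \<theta>^2) / 2 - (s * v - y) / 2 * (P / \<theta>\<^sup>2)) *\<^sub>R \<tau> + ((s * v - y) / 2) *\<^sub>R \<xi>"
    by (simp add: algebra_simps)
  also have "\<dots> = (1/2) *\<^sub>R (v *\<^sub>R extremal_x \<xi> \<eta> \<tau> s - y *\<^sub>R extremal_u \<xi> \<eta> \<tau> s)"
    unfolding key extremal_x_def extremal_u_def Y_def[symmetric] y_def[symmetric]
    by (simp add: algebra_simps add_divide_distrib diff_divide_distrib)
  finally show ?thesis
    by (simp add: extremal_t_def[abs_def] \<theta>_def P_def y_def v_def)
qed

lemma extremal_speed:
  assumes "\<tau> \<noteq> 0"
  shows "(norm (extremal_u \<xi> \<eta> \<tau> s))\<^sup>2 + (extremal_v \<xi> \<eta> \<tau> s)\<^sup>2 = (norm \<xi>)\<^sup>2 + \<eta>\<^sup>2"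
proof -
  define \<theta> P where "\<theta> = norm \<tau>" and "P = \<xi> \<bullet> \<tau>"
  define C S where "C = cos (\<theta> * s)" and "S = sin (\<theta> * s)"
  have \<theta>: "\<theta> > 0" using assms by (simp add: \<theta>_def)
  have CS: "C\<^sup>2 = 1 - S\<^sup>2" by (simp add: C_def S_def cos_squared_eq)
  define y v where "y = extremal_y \<xi> \<eta> \<tau> s" and "v = extremal_v \<xi> \<eta> \<tau> s"
  have a: "y * \<theta>^2 = \<eta> * S * \<theta> + P * (1 - C)" "v * \<theta> = \<eta> * C * \<theta> + P * S"
    using \<theta> unfolding y_def v_def extremal_y_def extremal_v_def \<theta>_def[symmetric] P_def[symmetric] C_def[symmetric] S_def[symmetric]
    by (simp_all add: field_simps power2_eq_square)
  have "(y * y * \<theta>^2 - 2 * y * P + v^2) * \<theta>^2 = (y * \<theta>^2)^2 - 2 * (y * \<theta>^2) * P + (v * \<theta>)^2"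
    by (simp add: algebra_simps power2_eq_square)
  also have "\<dots> = \<eta>\<^sup>2 * \<theta>^2" unfolding a using CS by algebra
  finally have "y * y * \<theta>^2 - 2 * y * P + v^2 = \<eta>\<^sup>2" using \<theta> by simp
  moreover have "(norm (extremal_u \<xi> \<eta> \<tau> s))\<^sup>2 = (norm \<xi>)\<^sup>2 + (y * y * \<theta>^2 - 2 * y * P)"
    unfolding extremal_u_def y_def[symmetric] power2_norm_eq_inner \<theta>_def P_def
    by (simp add: inner_diff_left inner_diff_right inner_commute algebra_simps)
  ultimately show ?thesis by (simp add: v_def)
qed

text \<open>
Equality in the calibration inequality: the extremal follows the optimal flow, so twice the calibration at
its end point is its energy. The three terms are computed separately, in terms of half the angle \<open>\<theta> s\<close>.
\<close>

lemma extremal_calibration: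
  fixes \<xi> \<tau> :: "'a::real_inner" and \<eta> s :: real
  assumes "\<tau> \<noteq> 0" and s: "0 < s" "norm \<tau> * s < 2 * pi"
  defines "e \<equiv> (1 / norm \<tau>) *\<^sub>R \<tau>" and "x \<equiv> extremal_x \<xi> \<eta> \<tau> s"
  shows "2 * (norm \<tau> * (e \<bullet> extremal_t \<xi> \<eta> \<tau> s) + (x \<bullet> x - (e \<bullet> x)\<^sup>2) / (2 * s)
     + (norm \<tau> / 2 * cot (norm \<tau> * s / 2)) / 2 * ((e \<bullet> x)\<^sup>2 + (extremal_y \<xi> \<eta> \<tau> s)\<^sup>2)) = s * ((norm \<xi>)\<^sup>2 + \<eta>\<^sup>2)"
proof -
  define \<theta> P where "\<theta> = norm \<tau>" and "P = \<xi> \<bullet> \<tau>"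
  define c z where "c = cos (\<theta> * s / 2)" and "z = sin (\<theta> * s / 2)"
  have \<theta>: "\<theta> > 0" using assms by (simp add: \<theta>_def)
  have z: "z > 0" unfolding z_def using s \<theta> by (intro sin_gt_zero) (auto simp: \<theta>_def)
  have cz: "c\<^sup>2 = 1 - z\<^sup>2" by (simp add: c_def z_def cos_squared_eq)
  have C: "cos (\<theta> * s) = 1 - 2 * z\<^sup>2" using cos_double_sin[of "\<theta> * s / 2"] by (simp add: z_def)
  have S: "sin (\<theta> * s) = 2 * z * c" using sin_double[of "\<theta> * s / 2"] by (simp add: z_def c_def)
  have tt: "\<tau> \<bullet> \<tau> = \<theta>\<^sup>2" by (simp add: \<theta>_def power2_norm_eq_inner)
  define y Y where "y = extremal_y \<xi> \<eta> \<tau> s" and "Y = extremal_y_integral \<xi> \<eta> \<tau> s"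
  have y: "y = \<eta> * (2 * z * c / \<theta>) + P * (2 * z\<^sup>2 / \<theta>\<^sup>2)"
    by (simp add: y_def extremal_y_def \<theta>_def[symmetric] P_def[symmetric] C S)
  have Y: "Y = \<eta> * (2 * z\<^sup>2 / \<theta>\<^sup>2) + P * ((\<theta> * s - 2 * z * c) / \<theta>^3)"
    by (simp add: Y_def extremal_y_integral_def \<theta>_def[symmetric] P_def[symmetric] C S)
  have ex: "e \<bullet> x = s * P / \<theta> - Y * \<theta>"
    unfolding x_def extremal_x_def e_def Y_def[symmetric] using \<theta>
    by (simp add: inner_diff_right tt P_def \<theta>_def[symmetric] inner_commute field_simps power2_eq_square)
  have ex': "e \<bullet> x = 2 * z * (P * c - \<eta> * z * \<theta>) / \<theta>\<^sup>2"
    unfolding ex Y using \<theta> by (simp add: field_simps power2_eq_square power3_eq_cube)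
  have xx: "x \<bullet> x = s\<^sup>2 * (\<xi> \<bullet> \<xi>) - 2 * s * Y * P + Y\<^sup>2 * \<theta>\<^sup>2"
    unfolding x_def extremal_x_def Y_def[symmetric]
    by (simp add: inner_diff_right inner_diff_left tt P_def inner_commute power2_eq_square algebra_simps)
  have perp: "x \<bullet> x - (e \<bullet> x)\<^sup>2 = s\<^sup>2 * (\<xi> \<bullet> \<xi> - P\<^sup>2 / \<theta>\<^sup>2)"
    unfolding xx ex using \<theta> by (simp add: field_simps power2_eq_square)
  have et: "e \<bullet> extremal_t \<xi> \<eta> \<tau> s = (\<eta>\<^sup>2 + P\<^sup>2 / \<theta>\<^sup>2) * (\<theta> * s - 2 * z * c) / (2 * \<theta>\<^sup>2)"
    unfolding extremal_t_def e_def P_def[symmetric] \<theta>_def[symmetric] S using \<theta>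
    by (simp add: inner_add_right inner_diff_right tt P_def inner_commute)
       (simp add: field_simps power2_eq_square power3_eq_cube)
  have sq: "(e \<bullet> x)\<^sup>2 + y\<^sup>2 = 4 * z\<^sup>2 * (\<eta>\<^sup>2 + P\<^sup>2 / \<theta>\<^sup>2) / \<theta>\<^sup>2"
  proof -
    have "((e \<bullet> x)\<^sup>2 + y\<^sup>2) * \<theta>^4 = (2 * z * (P * c - \<eta> * z * \<theta>))^2 + (2 * z * (\<eta> * c * \<theta> + P * z))^2"
      unfolding ex' y using \<theta> by (simp add: field_simps power2_eq_square power4_eq_xxxx)
    also have "\<dots> = 4 * z\<^sup>2 * (\<eta>\<^sup>2 * \<theta>\<^sup>2 + P\<^sup>2)" using cz by algebra
    finally show ?thesis using \<theta> by (simp add: field_simps power2_eq_square power4_eq_xxxx)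
  qed
  have kk: "(norm \<tau> / 2 * cot (norm \<tau> * s / 2)) / 2 * ((e \<bullet> x)\<^sup>2 + (extremal_y \<xi> \<eta> \<tau> s)\<^sup>2)
     = z * c * (\<eta>\<^sup>2 + P\<^sup>2 / \<theta>\<^sup>2) / \<theta>"
    unfolding y_def[symmetric] \<theta>_def[symmetric] sq cot_def c_def[symmetric] z_def[symmetric]
    using z \<theta> by (simp add: field_simps power2_eq_square)
  show ?thesis
    unfolding kk perp et unfolding \<theta>_def[symmetric] power2_norm_eq_inner[of \<xi>]
    using \<theta> s by (simp add: field_simps power2_eq_square)
qed

text \<open>
The Riccati equation that the coefficient of the calibration has to satisfy; its solution stays finite
exactly until the full turn, which is why the extremal is optimal up to that time.
\<close>

lemma cot_riccati:
  assumes "0 < r" "\<theta> * r < 2 * pi" "\<theta> > 0"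
  shows "((\<lambda>r. \<theta> / 2 * cot (\<theta> * r / 2)) has_real_derivative - ((\<theta> / 2 * cot (\<theta> * r / 2))\<^sup>2 + \<theta>\<^sup>2 / 4)) (at r)"
proof -
  have z: "sin (\<theta> * r / 2) > 0" using assms by (intro sin_gt_zero) auto
  have "((\<lambda>r. \<theta> * r / 2) has_real_derivative \<theta> / 2) (at r)"
    by (auto intro!: derivative_eq_intros)
  then have "((\<lambda>r. cot (\<theta> * r / 2)) has_real_derivative - inverse ((sin (\<theta> * r / 2))\<^sup>2) * (\<theta> / 2)) (at r)"
    using z DERIV_chain2[OF DERIV_cot] by force
  then have "((\<lambda>r. \<theta> / 2 * cot (\<theta> * r / 2)) has_real_derivative \<theta> / 2 * (- inverse ((sin (\<theta> * r / 2))\<^sup>2) * (\<theta> / 2))) (at r)"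
    by (rule DERIV_cmult)
  moreover have "\<theta> / 2 * (- inverse ((sin (\<theta> * r / 2))\<^sup>2) * (\<theta> / 2)) = - ((\<theta> / 2 * cot (\<theta> * r / 2))\<^sup>2 + \<theta>\<^sup>2 / 4)"
    unfolding cot_def power_mult_distrib power_divide cos_squared_eq
    using z by (simp add: field_simps power2_eq_square)
  ultimately show ?thesis by simp
qed

section \<open>A shorter competitor beyond one full turn\<close>

text \<open>
The same control and \<open>y\<close>-component in the orthonormal frame adapted to \<open>\<tau>\<close>, where the rotation is
visible.
\<close>

lemma extremal_plane:
  fixes \<xi> \<tau> :: "'a::real_inner"
  assumes "\<tau> \<noteq> 0"
  defines "e \<equiv> (1 / norm \<tau>) *\<^sub>R \<tau>"
  shows "extremal_u \<xi> \<eta> \<tau> s = (\<xi> - (e \<bullet> \<xi>) *\<^sub>R e)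
      + ((e \<bullet> \<xi>) * cos (norm \<tau> * s) - \<eta> * sin (norm \<tau> * s)) *\<^sub>R e"
    and "extremal_v \<xi> \<eta> \<tau> s = (e \<bullet> \<xi>) * sin (norm \<tau> * s) + \<eta> * cos (norm \<tau> * s)"
    and "extremal_y \<xi> \<eta> \<tau> s = ((e \<bullet> \<xi>) * (1 - cos (norm \<tau> * s)) + \<eta> * sin (norm \<tau> * s)) / norm \<tau>"
proof -
  define \<theta> where "\<theta> = norm \<tau>"
  have \<theta>: "\<theta> > 0" using assms by (simp add: \<theta>_def)
  have P: "\<xi> \<bullet> \<tau> = \<theta> * (e \<bullet> \<xi>)" using \<theta> by (simp add: e_def \<theta>_def inner_commute)
  have t: "\<tau> = \<theta> *\<^sub>R e" using \<theta> by (simp add: e_def \<theta>_def)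
  show y: "extremal_y \<xi> \<eta> \<tau> s = ((e \<bullet> \<xi>) * (1 - cos (norm \<tau> * s)) + \<eta> * sin (norm \<tau> * s)) / norm \<tau>"
    unfolding extremal_y_def P \<theta>_def[symmetric] using \<theta> by (simp add: field_simps power2_eq_square)
  show "extremal_v \<xi> \<eta> \<tau> s = (e \<bullet> \<xi>) * sin (norm \<tau> * s) + \<eta> * cos (norm \<tau> * s)"
    unfolding extremal_v_def P \<theta>_def[symmetric] using \<theta> by (simp add: field_simps)
  have "extremal_y \<xi> \<eta> \<tau> s *\<^sub>R \<tau> = ((e \<bullet> \<xi>) * (1 - cos (norm \<tau> * s)) + \<eta> * sin (norm \<tau> * s)) *\<^sub>R e"
    unfolding y using assms by (simp add: e_def)
  then show "extremal_u \<xi> \<eta> \<tau> s = (\<xi> - (e \<bullet> \<xi>) *\<^sub>R e)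
      + ((e \<bullet> \<xi>) * cos (norm \<tau> * s) - \<eta> * sin (norm \<tau> * s)) *\<^sub>R e"
    unfolding extremal_u_def by (simp add: algebra_simps)
qed

lemma continuous_extremal: "continuous_on A (extremal_y \<xi> \<eta> \<tau>)" "continuous_on A (extremal_u \<xi> \<eta> \<tau>)" "continuous_on A (extremal_v \<xi> \<eta> \<tau>)"
proof -
  have d: "continuous_on A (\<lambda>s. f s / c)" if "continuous_on A f" for f :: "real \<Rightarrow> real" and c
    using continuous_on_mult_right[OF that, of "inverse c"] by (simp add: divide_inverse)
  show y: "continuous_on A (extremal_y \<xi> \<eta> \<tau>)" unfolding extremal_y_def[abs_def]
    by (intro continuous_on_add continuous_on_mult_left d) (intro continuous_intros)+
  show "continuous_on A (extremal_v \<xi> \<eta> \<tau>)" unfolding extremal_v_def[abs_def]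
    by (intro continuous_on_add continuous_on_mult_left d) (intro continuous_intros)+
  show "continuous_on A (extremal_u \<xi> \<eta> \<tau>)" unfolding extremal_u_def[abs_def]
    by (intro continuous_intros y)
qed

text \<open>
Let \<open>\<omega> = 2 \<pi> / L\<close>, which is less than \<open>\<theta>\<close>. The competitor adds to the projected extremal the closed
circle \<open>\<zeta> (cos (\<omega> s) - 1, sin (\<omega> s))\<close> in the plane of \<open>e\<close> and the \<open>y\<close>-axis. The end point changes only in
its second layer, by \<open>\<zeta> (\<zeta> \<pi> + y(L) \<omega> / (\<theta> - \<omega>)) e\<close>: the first term is the area of the circle, the
second its interaction with the extremal. The direction orthogonal to \<open>\<tau>\<close> does not contribute, since
the sine has mean zero. With the nonzero root \<open>\<zeta>\<close> the end points agree and the energy changes by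
\<open>- 2 \<pi> \<zeta>\<^sup>2 (\<theta> - \<omega>)\<close>. As the extremal has constant speed, less energy means less length.
\<close>

lemma shorter_competitor:
  fixes \<xi> \<tau> :: "'a::real_inner" and \<eta> L :: real
  assumes \<tau>: "\<tau> \<noteq> 0" and L: "2 * pi < norm \<tau> * L" and yL: "extremal_y \<xi> \<eta> \<tau> L \<noteq> 0"
  obtains x u t :: "real \<Rightarrow> 'a" and y v :: "real \<Rightarrow> real"
  where "x 0 = 0" "y 0 = 0" "t 0 = 0"
    "x L = extremal_x \<xi> \<eta> \<tau> L" "y L = extremal_y \<xi> \<eta> \<tau> L" "t L = extremal_t \<xi> \<eta> \<tau> L"
    "\<And>s A. (x has_vector_derivative u s) (at s within A)"
    "\<And>s A. (y has_vector_derivative v s) (at s within A)"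
    "\<And>s A. (t has_vector_derivative (1/2) *\<^sub>R (v s *\<^sub>R x s - y s *\<^sub>R u s)) (at s within A)"
    "continuous_on UNIV u" "continuous_on UNIV v"
    "integral {0..L} (\<lambda>s. sqrt ((norm (u s))\<^sup>2 + (v s)\<^sup>2)) < L * sqrt ((norm \<xi>)\<^sup>2 + \<eta>\<^sup>2)"
proof -
  define \<theta> e a where "\<theta> = norm \<tau>" and "e = (1 / norm \<tau>) *\<^sub>R \<tau>" and "a = e \<bullet> \<xi>"
  define \<omega> where "\<omega> = 2 * pi / L"
  define \<phi> where "\<phi> = \<theta> - \<omega>"
  define yL where "yL = extremal_y \<xi> \<eta> \<tau> L"
  define \<zeta> where "\<zeta> = - (yL * \<omega> / (pi * \<phi>))"
  define \<Lambda> where "\<Lambda> = sqrt ((norm \<xi>)\<^sup>2 + \<eta>\<^sup>2)"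
  define xp where "xp = \<xi> - a *\<^sub>R e"
  have \<theta>: "\<theta> > 0" using \<tau> by (simp add: \<theta>_def)
  have Lpos: "L > 0" using L pi_gt_zero \<theta> unfolding \<theta>_def
    by (smt (verit) mult_nonneg_nonpos norm_ge_zero)
  have \<omega>: "\<omega> > 0" "\<omega> * L = 2 * pi" using Lpos by (auto simp: \<omega>_def)
  have \<phi>: "\<phi> > 0" using L Lpos by (simp add: \<phi>_def \<omega>_def \<theta>_def field_simps)
  have \<phi>L: "\<phi> * L = \<theta> * L - 2 * pi" using \<omega> by (simp add: \<phi>_def algebra_simps)
  have ne: "norm e = 1" using \<tau> by (simp add: e_def)
  then have ee: "e \<bullet> e = 1" by (simp add: norm_eq_1)
  have \<zeta>: "\<zeta> \<noteq> 0" using yL \<omega> \<phi> by (simp add: \<zeta>_def yL_def)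
  note plane = extremal_plane[OF \<tau>, where \<xi> = \<xi> and \<eta> = \<eta>, folded e_def, folded \<theta>_def a_def xp_def]
  have yLe: "\<theta> * yL = a * (1 - cos (\<theta> * L)) + \<eta> * sin (\<theta> * L)"
    unfolding yL_def plane(3) using \<theta> by simp
  have csL: "cos (\<omega> * L) = 1" "sin (\<omega> * L) = 0" "cos (\<phi> * L) = cos (\<theta> * L)" "sin (\<phi> * L) = sin (\<theta> * L)"
    unfolding \<phi>L \<omega>(2) by (simp_all add: cos_diff sin_diff)
  have addth: "cos (\<phi> * s) = cos (\<theta> * s) * cos (\<omega> * s) + sin (\<theta> * s) * sin (\<omega> * s)"
      "sin (\<phi> * s) = sin (\<theta> * s) * cos (\<omega> * s) - cos (\<theta> * s) * sin (\<omega> * s)" for s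
    unfolding \<phi>_def by (simp_all add: cos_diff sin_diff algebra_simps)
  define p r where "p = (\<lambda>s. \<zeta> * (cos (\<omega> * s) - 1))" and "r = (\<lambda>s. \<zeta> * sin (\<omega> * s))"
  define p' r' where "p' = (\<lambda>s. - (\<zeta> * \<omega> * sin (\<omega> * s)))" and "r' = (\<lambda>s. \<zeta> * \<omega> * cos (\<omega> * s))"
  define x where "x = (\<lambda>s. extremal_x \<xi> \<eta> \<tau> s + p s *\<^sub>R e)"
  define y where "y = (\<lambda>s. extremal_y \<xi> \<eta> \<tau> s + r s)"
  define u where "u = (\<lambda>s. extremal_u \<xi> \<eta> \<tau> s + p' s *\<^sub>R e)"
  define v where "v = (\<lambda>s. extremal_v \<xi> \<eta> \<tau> s + r' s)"
  \<comment> \<open>Area of the circle and its interaction with the extremal, integrated in closed form; the angle \<open>\<phi> s\<close>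
    comes from the products of the two rotations.\<close>
  define R where "R = (\<lambda>s. \<zeta>\<^sup>2 * (\<omega> * s - sin (\<omega> * s)) / 2
      + \<zeta> * ((\<eta> * sin (\<phi> * s) - a * cos (\<phi> * s) + a) / \<phi> + (a * cos (\<theta> * s) - \<eta> * sin (\<theta> * s) - a) / \<theta>))"
  define t where "t = (\<lambda>s. extremal_t \<xi> \<eta> \<tau> s + (1/2) *\<^sub>R (r s *\<^sub>R extremal_x \<xi> \<eta> \<tau> s - (extremal_y \<xi> \<eta> \<tau> s * p s) *\<^sub>R e)
      + R s *\<^sub>R e + (p s / \<omega>) *\<^sub>R xp)"
  have dp: "(p has_real_derivative p' s) (at s within A)" and dr: "(r has_real_derivative r' s) (at s within A)" for s A
    unfolding p_def r_def p'_def r'_def by (auto intro!: derivative_eq_intros)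
  note dr' = dr[unfolded has_real_derivative_iff_has_vector_derivative]
    and dy' = extremal_y_deriv[OF \<tau>, unfolded has_real_derivative_iff_has_vector_derivative]
  have dR: "(R has_real_derivative extremal_v \<xi> \<eta> \<tau> s * p s - r s * (a * cos (\<theta> * s) - \<eta> * sin (\<theta> * s))
      + (r' s * p s - r s * p' s) / 2) (at s within A)" for s A
  proof -
    have sc: "sin (\<omega> * s) * sin (\<omega> * s) = 1 - cos (\<omega> * s) * cos (\<omega> * s)"
      using sin_squared_eq[of "\<omega> * s"] by (simp add: power2_eq_square)
    have "(R has_real_derivative \<zeta>\<^sup>2 * (\<omega> - \<omega> * cos (\<omega> * s)) / 2
      + \<zeta> * ((\<eta> * cos (\<phi> * s) + a * sin (\<phi> * s)) + (- a * sin (\<theta> * s) - \<eta> * cos (\<theta> * s)))) (at s within A)"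
      unfolding R_def using \<phi> \<theta> by (auto intro!: derivative_eq_intros simp: field_simps)
    also have "\<zeta>\<^sup>2 * (\<omega> - \<omega> * cos (\<omega> * s)) / 2
      + \<zeta> * ((\<eta> * cos (\<phi> * s) + a * sin (\<phi> * s)) + (- a * sin (\<theta> * s) - \<eta> * cos (\<theta> * s)))
      = extremal_v \<xi> \<eta> \<tau> s * p s - r s * (a * cos (\<theta> * s) - \<eta> * sin (\<theta> * s))
      + (r' s * p s - r s * p' s) / 2"
      unfolding addth p_def r_def p'_def r'_def plane(2)
      by (simp add: algebra_simps power2_eq_square sc)
    finally show ?thesis .
  qed
  show thesis
  proof
    show "x 0 = 0" "y 0 = 0" "t 0 = 0"
      using extremal_init[of \<xi> \<eta> \<tau>] by (simp_all add: x_def y_def t_def p_def r_def R_def)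
    have pL: "p L = 0" "r L = 0" by (simp_all add: p_def r_def csL)
    show "x L = extremal_x \<xi> \<eta> \<tau> L" "y L = extremal_y \<xi> \<eta> \<tau> L" by (simp_all add: x_def y_def pL)
    have "R L = \<zeta>\<^sup>2 * pi + \<zeta> * (\<theta> * yL) * (1 / \<phi> - 1 / \<theta>)"
      unfolding R_def csL \<omega>(2) yLe by (simp add: diff_divide_distrib add_divide_distrib algebra_simps)
    also have "\<dots> = \<zeta> * (\<zeta> * pi + yL * \<omega> / \<phi>)"
      using \<theta> \<phi> by (simp add: field_simps power2_eq_square) (simp add: \<phi>_def algebra_simps)
    also have "\<dots> = 0" using \<phi> by (simp add: \<zeta>_def)
    finally show "t L = extremal_t \<xi> \<eta> \<tau> L" by (simp add: t_def pL)
    show "(x has_vector_derivative u s) (at s within A)" for s A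
      unfolding x_def u_def
      by (intro has_vector_derivative_add extremal_x_deriv[OF \<tau>] has_vector_derivative_scaleR_const dp)
    show "(y has_vector_derivative v s) (at s within A)" for s A
      unfolding y_def v_def by (intro has_vector_derivative_add dy' dr')
    show "(t has_vector_derivative (1/2) *\<^sub>R (v s *\<^sub>R x s - y s *\<^sub>R u s)) (at s within A)" for s A
    proof -
      let ?x = "extremal_x \<xi> \<eta> \<tau> s" and ?y = "extremal_y \<xi> \<eta> \<tau> s" and ?u = "extremal_u \<xi> \<eta> \<tau> s" and ?v = "extremal_v \<xi> \<eta> \<tau> s"
      let ?U = "a * cos (\<theta> * s) - \<eta> * sin (\<theta> * s)"
      have d1: "((\<lambda>s. r s *\<^sub>R extremal_x \<xi> \<eta> \<tau> s) has_vector_derivative r s *\<^sub>R ?u + r' s *\<^sub>R ?x) (at s within A)"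
        by (rule has_vector_derivative_scaleR[OF dr extremal_x_deriv[OF \<tau>]])
      have d2: "((\<lambda>s. extremal_y \<xi> \<eta> \<tau> s * p s) has_real_derivative ?v * p s + p' s * ?y) (at s within A)"
        by (rule DERIV_mult[OF extremal_y_deriv[OF \<tau>] dp])
      have d3: "((\<lambda>s. p s / \<omega>) has_real_derivative p' s / \<omega>) (at s within A)"
        by (rule DERIV_cdivide[OF dp])
      have "(t has_vector_derivative (1/2) *\<^sub>R (?v *\<^sub>R ?x - ?y *\<^sub>R ?u)
         + (1/2) *\<^sub>R ((r s *\<^sub>R ?u + r' s *\<^sub>R ?x) - (?v * p s + p' s * ?y) *\<^sub>R e)
         + (?v * p s - r s * ?U + (r' s * p s - r s * p' s) / 2) *\<^sub>R e + (p' s / \<omega>) *\<^sub>R xp) (at s within A)"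
        unfolding t_def
        by (intro has_vector_derivative_add has_vector_derivative_diff extremal_t_deriv[OF \<tau>] has_vector_derivative_scaleR_const
           dR d2 d3 d1 bounded_linear.has_vector_derivative[OF bounded_linear_scaleR_right])
      also have "(p' s / \<omega>) *\<^sub>R xp = - (r s) *\<^sub>R xp"
        using \<omega> by (simp add: p'_def r_def)
      also have "\<dots> = - (r s) *\<^sub>R ?u + (r s * ?U) *\<^sub>R e"
        unfolding plane(1) xp_def by (simp add: algebra_simps)
      also have "(1/2) *\<^sub>R (?v *\<^sub>R ?x - ?y *\<^sub>R ?u)
         + (1/2) *\<^sub>R ((r s *\<^sub>R ?u + r' s *\<^sub>R ?x) - (?v * p s + p' s * ?y) *\<^sub>R e)
         + (?v * p s - r s * ?U + (r' s * p s - r s * p' s) / 2) *\<^sub>R e + (- (r s) *\<^sub>R ?u + (r s * ?U) *\<^sub>R e)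
         = (1/2) *\<^sub>R ((?v + r' s) *\<^sub>R (?x + p s *\<^sub>R e) - (?y + r s) *\<^sub>R (?u + p' s *\<^sub>R e))"
        (is "?l = ?r")
      proof -
        have "2 *\<^sub>R ?l = (?v *\<^sub>R ?x - ?y *\<^sub>R ?u) + ((r s *\<^sub>R ?u + r' s *\<^sub>R ?x) - (?v * p s + p' s * ?y) *\<^sub>R e)
            + (2 * (?v * p s - r s * ?U) + (r' s * p s - r s * p' s)) *\<^sub>R e + (2 * (r s * ?U)) *\<^sub>R e - (2 * r s) *\<^sub>R ?u"
          unfolding scaleR_add_right scaleR_scaleR by simp
        also have "\<dots> = (?v + r' s) *\<^sub>R (?x + p s *\<^sub>R e) - (?y + r s) *\<^sub>R (?u + p' s *\<^sub>R e)"
        proof -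
          have two: "(k * 2) *\<^sub>R z = k *\<^sub>R z + k *\<^sub>R z" "(k * (2 * l)) *\<^sub>R z = (k * l) *\<^sub>R z + (k * l) *\<^sub>R z"
            for k l and z :: 'a by (simp_all flip: scaleR_add_left)
          show ?thesis by (simp add: algebra_simps two)
        qed
        also have "\<dots> = 2 *\<^sub>R ?r" by simp
        finally show ?thesis by (rule scaleR_left_imp_eq[rotated]) simp
      qed
      finally show ?thesis by (simp add: x_def y_def u_def v_def)
    qed
    show cu: "continuous_on UNIV u" and cv: "continuous_on UNIV v"
      unfolding u_def v_def p'_def r'_def by (intro continuous_intros continuous_extremal)+
    define E where "E = (\<lambda>s. \<Lambda>\<^sup>2 + 2 * \<zeta> * \<omega> * (a * sin (\<phi> * s) + \<eta> * cos (\<phi> * s)) + \<omega>\<^sup>2 * \<zeta>\<^sup>2)"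
    have \<Lambda>sq: "\<Lambda>\<^sup>2 = (norm \<xi>)\<^sup>2 + \<eta>\<^sup>2" by (simp add: \<Lambda>_def)
    have E: "(norm (u s))\<^sup>2 + (v s)\<^sup>2 = E s" for s
    proof -
      have eu: "e \<bullet> extremal_u \<xi> \<eta> \<tau> s = a * cos (\<theta> * s) - \<eta> * sin (\<theta> * s)"
        unfolding plane(1) by (simp add: inner_add_right inner_diff_right ee flip: a_def)
      have "(norm (u s))\<^sup>2 = (norm (extremal_u \<xi> \<eta> \<tau> s))\<^sup>2 + 2 * p' s * (e \<bullet> extremal_u \<xi> \<eta> \<tau> s) + (p' s)\<^sup>2"
        unfolding u_def power2_norm_eq_inner
        by (simp add: inner_add_left inner_add_right inner_commute ee power2_eq_square algebra_simps)
      then have "(norm (u s))\<^sup>2 + (v s)\<^sup>2 = ((norm (extremal_u \<xi> \<eta> \<tau> s))\<^sup>2 + (extremal_v \<xi> \<eta> \<tau> s)\<^sup>2)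
         + 2 * (p' s * (a * cos (\<theta> * s) - \<eta> * sin (\<theta> * s)) + r' s * extremal_v \<xi> \<eta> \<tau> s) + ((p' s)\<^sup>2 + (r' s)\<^sup>2)"
        unfolding eu v_def by (simp add: power2_eq_square algebra_simps)
      also have "(p' s)\<^sup>2 + (r' s)\<^sup>2 = \<omega>\<^sup>2 * \<zeta>\<^sup>2 * ((sin (\<omega> * s))\<^sup>2 + (cos (\<omega> * s))\<^sup>2)"
        unfolding p'_def r'_def by (simp only: power2_minus power_mult_distrib) algebra
      also have "\<dots> = \<omega>\<^sup>2 * \<zeta>\<^sup>2" by simp
      also have "2 * (p' s * (a * cos (\<theta> * s) - \<eta> * sin (\<theta> * s)) + r' s * extremal_v \<xi> \<eta> \<tau> s)
         = 2 * \<zeta> * \<omega> * (a * sin (\<phi> * s) + \<eta> * cos (\<phi> * s))"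
        unfolding addth p'_def r'_def plane(2) by (simp add: algebra_simps)
      finally show ?thesis unfolding E_def \<Lambda>sq extremal_speed[OF \<tau>] .
    qed
    have "\<xi> \<noteq> 0 \<or> \<eta> \<noteq> 0" using yL by (auto simp: extremal_y_def)
    then have \<Lambda>: "\<Lambda> > 0" unfolding \<Lambda>_def
      by (auto intro: add_pos_nonneg add_nonneg_pos)
    \<comment> \<open>A primitive of \<open>(E + \<Lambda>\<^sup>2) / (2 \<Lambda>)\<close>, which dominates the speed \<open>sqrt E\<close> by the inequality of
      arithmetic and geometric means.\<close>
    define F where "F = (\<lambda>s. ((\<Lambda>\<^sup>2 + \<omega>\<^sup>2 * \<zeta>\<^sup>2 + \<Lambda>\<^sup>2) * s + 2 * \<zeta> * \<omega> * (\<eta> * sin (\<phi> * s) - a * cos (\<phi> * s)) / \<phi>) / (2 * \<Lambda>))"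
    have dF: "(F has_real_derivative (E s + \<Lambda>\<^sup>2) / (2 * \<Lambda>)) (at s within A)" for s A
      unfolding F_def E_def using \<phi> \<Lambda> by (auto intro!: derivative_eq_intros simp: field_simps)
    have "((\<lambda>s. (E s + \<Lambda>\<^sup>2) / (2 * \<Lambda>)) has_integral (F L - F 0)) {0..L}"
      using Lpos by (intro fundamental_theorem_of_calculus dF[unfolded has_real_derivative_iff_has_vector_derivative]) auto
    moreover have "((\<lambda>s. sqrt ((norm (u s))\<^sup>2 + (v s)\<^sup>2)) has_integral integral {0..L} (\<lambda>s. sqrt ((norm (u s))\<^sup>2 + (v s)\<^sup>2))) {0..L}"
      by (intro integrable_integral integrable_continuous_real continuous_intros continuous_on_subset[OF cu] continuous_on_subset[OF cv]) auto
    moreover have "sqrt ((norm (u s))\<^sup>2 + (v s)\<^sup>2) \<le> (E s + \<Lambda>\<^sup>2) / (2 * \<Lambda>)" for s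
    proof -
      have E0: "E s \<ge> 0" unfolding E[symmetric] by simp
      have "0 \<le> (sqrt (E s) - \<Lambda>)\<^sup>2" by simp
      then have "2 * \<Lambda> * sqrt (E s) \<le> E s + \<Lambda>\<^sup>2" using E0 by (simp add: power2_diff mult.commute mult.left_commute)
      then show ?thesis unfolding E using \<Lambda> by (simp add: field_simps)
    qed
    ultimately have "integral {0..L} (\<lambda>s. sqrt ((norm (u s))\<^sup>2 + (v s)\<^sup>2)) \<le> F L - F 0"
      by (meson has_integral_le)
    also have "F L - F 0 = ((2 * \<Lambda>\<^sup>2 + \<omega>\<^sup>2 * \<zeta>\<^sup>2) * L + 2 * \<zeta> * \<omega> * (\<theta> * yL) / \<phi>) / (2 * \<Lambda>)"
      unfolding F_def csL yLe using \<phi> \<Lambda> by (simp add: field_simps)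
    also have "\<zeta> * \<omega> * (\<theta> * yL) / \<phi> = - (pi * \<theta> * \<zeta>\<^sup>2)"
      using \<phi> by (simp add: \<zeta>_def field_simps power2_eq_square)
    then have "2 * \<zeta> * \<omega> * (\<theta> * yL) / \<phi> = - (2 * pi * \<theta> * \<zeta>\<^sup>2)" by simp
    also have "(2 * \<Lambda>\<^sup>2 + \<omega>\<^sup>2 * \<zeta>\<^sup>2) * L + - (2 * pi * \<theta> * \<zeta>\<^sup>2) = 2 * \<Lambda>\<^sup>2 * L - 2 * pi * \<zeta>\<^sup>2 * \<phi>"
    proof -
      have "\<omega>\<^sup>2 * \<zeta>\<^sup>2 * L = \<omega> * \<zeta>\<^sup>2 * (\<omega> * L)" by (simp add: power2_eq_square)
      then show ?thesis unfolding \<omega>(2) \<phi>_def by (simp add: algebra_simps)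
    qed
    also have "(2 * \<Lambda>\<^sup>2 * L - 2 * pi * \<zeta>\<^sup>2 * \<phi>) / (2 * \<Lambda>) < L * \<Lambda>"
    proof -
      have "0 < pi * \<zeta>\<^sup>2 * \<phi>" using \<zeta> \<phi> by simp
      then show ?thesis using \<Lambda> by (simp add: field_simps power2_eq_square)
    qed
    finally show "integral {0..L} (\<lambda>s. sqrt ((norm (u s))\<^sup>2 + (v s)\<^sup>2)) < L * sqrt ((norm \<xi>)\<^sup>2 + \<eta>\<^sup>2)"
      by (simp add: \<Lambda>_def)
  qed
qed

text \<open>
If \<open>y\<close> vanished on an interval, so would its first two derivatives. Up to a factor \<open>\<theta>\<close> in the second
one, these are the components of the rotated vector \<open>(a, \<eta>)\<close>, which is not zero.
\<close>

lemma extremal_y_nonzero_soon: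
  fixes \<xi> \<tau> :: "'a::real_inner"
  assumes \<tau>: "\<tau> \<noteq> 0" and ab: "\<xi> \<bullet> \<tau> \<noteq> 0 \<or> \<eta> \<noteq> 0" and "p < q"
  obtains L where "p < L" "L < q" "extremal_y \<xi> \<eta> \<tau> L \<noteq> 0"
proof (rule ccontr)
  note found = that
  assume "\<not> thesis"
  then have z: "extremal_y \<xi> \<eta> \<tau> L = 0" if "L \<in> {p<..<q}" for L using that found by auto
  have v0: "extremal_v \<xi> \<eta> \<tau> L = 0" if L: "L \<in> {p<..<q}" for L
  proof -
    have "((\<lambda>s. 0) has_real_derivative extremal_v \<xi> \<eta> \<tau> L) (at L)"
      by (rule has_field_derivative_transform_within_open[OF extremal_y_deriv[OF \<tau>] _ L]) (auto intro: z)
    then show ?thesis using DERIV_unique DERIV_const by blast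
  qed
  define \<theta> e a where "\<theta> = norm \<tau>" and "e = (1 / norm \<tau>) *\<^sub>R \<tau>" and "a = e \<bullet> \<xi>"
  have \<theta>: "\<theta> > 0" using \<tau> by (simp add: \<theta>_def)
  note plane = extremal_plane[OF \<tau>, where \<xi> = \<xi> and \<eta> = \<eta>, folded e_def, folded \<theta>_def a_def]
  define m where "m = (p + q) / 2"
  have m: "m \<in> {p<..<q}" using assms by (simp add: m_def)
  have 1: "a * sin (\<theta> * m) + \<eta> * cos (\<theta> * m) = 0" using v0[OF m] unfolding plane(2) by simp
  have "((\<lambda>s. a * sin (\<theta> * s) + \<eta> * cos (\<theta> * s)) has_real_derivative
      \<theta> * (a * cos (\<theta> * m) - \<eta> * sin (\<theta> * m))) (at m)"
    by (auto intro!: derivative_eq_intros simp: algebra_simps)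
  then have "((\<lambda>s. 0) has_real_derivative \<theta> * (a * cos (\<theta> * m) - \<eta> * sin (\<theta> * m))) (at m)"
    by (rule has_field_derivative_transform_within_open[OF _ _ m]) (use v0 plane(2) in auto)
  then have "\<theta> * (a * cos (\<theta> * m) - \<eta> * sin (\<theta> * m)) = 0" using DERIV_unique DERIV_const by blast
  then have 2: "a * cos (\<theta> * m) - \<eta> * sin (\<theta> * m) = 0" using \<theta> by simp
  have "a\<^sup>2 + \<eta>\<^sup>2 = (a * sin (\<theta> * m) + \<eta> * cos (\<theta> * m))\<^sup>2 + (a * cos (\<theta> * m) - \<eta> * sin (\<theta> * m))\<^sup>2"
    using sin_cos_squared_add[of "\<theta> * m"] by algebra
  also have "\<dots> = 0" unfolding 1 2 by simp
  finally have "a = 0" "\<eta> = 0" by (auto simp: sum_power2_eq_zero_iff)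
  then show False using ab \<tau> by (auto simp: a_def e_def inner_commute)
qed

section \<open>One-column matrices and the extremals of the group\<close>

text \<open>
A matrix with one column is not literally a vector. The maps below, with the library map \<open>vec\<close> from
scalars to one-dimensional vectors, identify the group with the model of the preceding sections.
\<close>

definition col :: "real ^ 'q \<Rightarrow> real ^ 1 ^ 'q" where "col u = (\<chi> i j. u $ i)"
definition uncol :: "real ^ 1 ^ 'q \<Rightarrow> real ^ 'q" where "uncol m = (\<chi> i. m $ i $ 1)"

lemma uncol_col [simp]: "uncol (col u) = u"
  by (simp add: uncol_def col_def vec_eq_iff)

lemma col_uncol [simp]: "col (uncol m) = m"
  by (simp add: uncol_def col_def vec_eq_iff)

lemma vec_nth_1 [simp]: "vec (v $ 1) = (v :: real ^ 1)"
  by (simp add: vec_eq_iff)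

lemma bounded_linear_col: "bounded_linear (col :: real ^ 'q::finite \<Rightarrow> _)"
  by (intro linear_conv_bounded_linear[THEN iffD1] linearI) (simp_all add: col_def vec_eq_iff)

lemma bounded_linear_uncol: "bounded_linear (uncol :: real ^ 1 ^ 'q::finite \<Rightarrow> _)"
  by (intro linear_conv_bounded_linear[THEN iffD1] linearI) (simp_all add: uncol_def vec_eq_iff)

lemma bounded_linear_vec1: "bounded_linear (vec :: real \<Rightarrow> real ^ 1)"
  by (intro linear_conv_bounded_linear[THEN iffD1] linearI) (simp_all add: vec_eq_iff)

lemma inner_col [simp]: "col u \<bullet> col w = u \<bullet> w"
  by (simp add: col_def inner_vec_def sum_1)

lemma norm_col_vec: "norm (col u, vec v :: real ^ 1) = sqrt ((norm u)\<^sup>2 + v\<^sup>2)"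
proof -
  have "norm (col u) = norm u" by (simp add: norm_eq_sqrt_inner)
  then show ?thesis by (simp add: norm_Pair norm_real)
qed

lemma Qform_col: "Qform (col x, vec y) (col u, vec v) = (1 / 2) *\<^sub>R (v *\<^sub>R x - y *\<^sub>R u)"
  by (simp add: Qform_def col_def matrix_vector_mult_def vec_eq_iff sum_1 mult.commute)

lemma Aop_col: "Aop \<tau> (col u, vec v) = (col (v *\<^sub>R \<tau>), vec (- (u \<bullet> \<tau>)))"
  by (simp add: Aop_def col_def matrix_vector_mult_def transpose_def vec_eq_iff inner_vec_def mult.commute)

lemma has_vector_derivative_col_vec:
  assumes "(x has_vector_derivative u) (at r within A)" "(y has_vector_derivative v) (at r within A)"
  shows "((\<lambda>s. (col (x s), vec (y s) :: real ^ 1)) has_vector_derivative (col u, vec v)) (at r within A)"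
  using assms
  by (intro has_vector_derivative_Pair bounded_linear.has_vector_derivative[OF bounded_linear_col]
      bounded_linear.has_vector_derivative[OF bounded_linear_vec1])

lemma horizontal_curve_col:
  fixes x u t :: "real \<Rightarrow> real ^ 'q::finite" and y v :: "real \<Rightarrow> real"
  assumes "a \<le> b" and cu: "continuous_on UNIV u" and cv: "continuous_on UNIV v"
    and dx: "\<And>s A. (x has_vector_derivative u s) (at s within A)"
    and dy: "\<And>s A. (y has_vector_derivative v s) (at s within A)"
    and dt: "\<And>s A. (t has_vector_derivative (1/2) *\<^sub>R (v s *\<^sub>R x s - y s *\<^sub>R u s)) (at s within A)"
  shows "horizontal_curve a b (\<lambda>s. ((col (x s), vec (y s) :: real ^ 1), t s)) (\<lambda>s. (col (u s), vec (v s)))"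
proof (rule horizontal_curve_C1)
  show "continuous_on UNIV (\<lambda>s. (col (u s), vec (v s) :: real ^ 1))"
    by (intro continuous_intros bounded_linear.continuous_on[OF bounded_linear_col] bounded_linear.continuous_on[OF bounded_linear_vec1] cu cv)
  show "((\<lambda>r. fst ((col (x r), vec (y r) :: real ^ 1), t r)) has_vector_derivative (col (u s), vec (v s))) (at s within {a..b})" for s
    using has_vector_derivative_col_vec[OF dx dy] by simp
  show "((\<lambda>r. snd ((col (x r), vec (y r) :: real ^ 1), t r)) has_vector_derivative
      Qform (fst ((col (x s), vec (y s)), t s)) (col (u s), vec (v s))) (at s within {a..b})" for s
    using dt by (simp add: Qform_col)
  have "continuous_on A x" "continuous_on A y" for A
    using dx dy by (auto intro!: has_vector_derivative_continuous simp: continuous_on_eq_continuous_within)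
  then show "continuous_on {a..b} (\<lambda>s. Qform (fst ((col (x s), vec (y s) :: real ^ 1), t s)) (col (u s), vec (v s)))"
    unfolding fst_conv Qform_col
    by (intro continuous_intros continuous_on_subset[OF cu] continuous_on_subset[OF cv]) auto
qed (fact assms)

text \<open>
In the plane of \<open>e\<close> and the \<open>y\<close>-axis, viewed as the complex plane, the operator is multiplication by
\<open>\<i> \<theta> s\<close>; it annihilates the orthogonal component of \<open>\<xi>\<close>, which survives only in the zeroth power.
Consequently the exponential series is that of \<open>exp (\<i> \<theta> s)\<close>.
\<close>

lemma power_Aop_col:
  fixes \<xi> \<tau> :: "real ^ 'q::finite" and \<eta> s :: real
  assumes "\<tau> \<noteq> 0"
  defines "e \<equiv> (1 / norm \<tau>) *\<^sub>R \<tau>"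
  defines "Z \<equiv> \<lambda>n. (\<i> * complex_of_real (norm \<tau> * s)) ^ n * Complex (e \<bullet> \<xi>) \<eta>"
  shows "((\<lambda>z. (- s) *\<^sub>R Aop \<tau> z) ^^ n) (col \<xi>, vec \<eta> :: real ^ 1)
     = (col ((if n = 0 then \<xi> - (e \<bullet> \<xi>) *\<^sub>R e else 0) + Re (Z n) *\<^sub>R e), vec (Im (Z n)))"
proof (induction n)
  case 0
  then show ?case by (simp add: Z_def)
next
  case (Suc n)
  define \<theta> where "\<theta> = norm \<tau>"
  have \<theta>: "\<theta> > 0" using assms(1) by (simp add: \<theta>_def)
  have te: "\<tau> = \<theta> *\<^sub>R e" using \<theta> by (simp add: e_def \<theta>_def)
  have "norm e = 1" using assms(1) by (simp add: e_def)
  then have ee: "e \<bullet> e = 1" by (simp add: norm_eq_1)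
  have ZS: "Re (Z (Suc n)) = - (\<theta> * s * Im (Z n))" "Im (Z (Suc n)) = \<theta> * s * Re (Z n)"
    by (simp_all add: Z_def \<theta>_def mult.assoc)
  have o: "(\<xi> - (e \<bullet> \<xi>) *\<^sub>R e) \<bullet> e = 0" by (simp add: inner_diff_left ee inner_commute[of e \<xi>])
  have "((if n = 0 then \<xi> - (e \<bullet> \<xi>) *\<^sub>R e else 0) + Re (Z n) *\<^sub>R e) \<bullet> \<tau> = \<theta> * Re (Z n)"
    unfolding te using o by (simp add: inner_add_left ee)
  then have "((\<lambda>z. (- s) *\<^sub>R Aop \<tau> z) ^^ Suc n) (col \<xi>, vec \<eta> :: real ^ 1)
      = (- s) *\<^sub>R (col (Im (Z n) *\<^sub>R \<tau>), vec (- (\<theta> * Re (Z n))))"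
    using Suc by (simp add: Aop_col)
  also have "\<dots> = (col (Re (Z (Suc n)) *\<^sub>R e), vec (Im (Z (Suc n))))"
    unfolding ZS te by (simp add: col_def vec_eq_iff)
  finally show ?case by simp
qed

lemma extremal_control_col:
  fixes \<xi> \<tau> :: "real ^ 'q::finite"
  assumes "\<tau> \<noteq> 0"
  shows "extremal_control ((col \<xi>, vec \<eta> :: real ^ 1), \<tau>) s = (col (extremal_u \<xi> \<eta> \<tau> s), vec (extremal_v \<xi> \<eta> \<tau> s))"
proof -
  define e where "e = (1 / norm \<tau>) *\<^sub>R \<tau>"
  define c where "c = \<i> * complex_of_real (norm \<tau> * s)"
  define T where "T = (\<lambda>z. (col (Re z *\<^sub>R e), vec (Im z) :: real ^ 1))"
  define w where "w = (\<xi> - (e \<bullet> \<xi>) *\<^sub>R e)"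
  have T: "bounded_linear T" unfolding T_def
    by (intro bounded_linear_Pair bounded_linear_compose[OF bounded_linear_col]
       bounded_linear_compose[OF bounded_linear_vec1] bounded_linear_scaleR_const bounded_linear_Re bounded_linear_Im)
  have "(\<lambda>n. c ^ n /\<^sub>R fact n) sums exp c" by (rule exp_converges)
  then have "(\<lambda>n. (c ^ n /\<^sub>R fact n) * Complex (e \<bullet> \<xi>) \<eta>) sums (exp c * Complex (e \<bullet> \<xi>) \<eta>)"
    by (rule sums_mult2)
  then have s1: "(\<lambda>n. T ((c ^ n /\<^sub>R fact n) * Complex (e \<bullet> \<xi>) \<eta>)) sums T (exp c * Complex (e \<bullet> \<xi>) \<eta>)"
    by (rule bounded_linear.sums[OF T])
  have s2: "(\<lambda>n. if n = 0 then (col w, 0 :: real ^ 1) else 0) sums (col w, 0)"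
    using sums_single[of 0 "\<lambda>_. (col w, 0 :: real ^ 1)"] by simp
  have nth_term: "(1 / fact n) *\<^sub>R ((\<lambda>z. (- s) *\<^sub>R Aop \<tau> z) ^^ n) (col \<xi>, vec \<eta> :: real ^ 1)
     = T ((c ^ n /\<^sub>R fact n) * Complex (e \<bullet> \<xi>) \<eta>) + (if n = 0 then (col w, 0) else 0)" for n
    unfolding power_Aop_col[OF assms] e_def[symmetric] c_def[symmetric] w_def[symmetric] T_def
    by (cases "n = 0") (simp_all add: col_def vec_eq_iff divide_inverse mult.commute)
  have "op_exp (\<lambda>z. (- s) *\<^sub>R Aop \<tau> z) (col \<xi>, vec \<eta> :: real ^ 1) = T (exp c * Complex (e \<bullet> \<xi>) \<eta>) + (col w, 0)"
    unfolding op_exp_def nth_term using sums_add[OF s1 s2] by (rule sums_unique[symmetric])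
  also have "exp c = Complex (cos (norm \<tau> * s)) (sin (norm \<tau> * s))"
    unfolding c_def by (simp add: complex_eq_iff Re_exp Im_exp)
  also have "T (Complex (cos (norm \<tau> * s)) (sin (norm \<tau> * s)) * Complex (e \<bullet> \<xi>) \<eta>) + (col w, 0)
     = (col (extremal_u \<xi> \<eta> \<tau> s), vec (extremal_v \<xi> \<eta> \<tau> s))"
    unfolding extremal_plane(1,2)[OF assms, folded e_def] T_def w_def
    by (simp add: col_def vec_eq_iff algebra_simps)
  finally show ?thesis by (simp add: extremal_control_def)
qed

lemma extremal_col:
  fixes \<xi> \<tau> :: "real ^ 'q::finite"
  assumes "\<tau> \<noteq> 0"
  shows "extremal ((col \<xi>, vec \<eta> :: real ^ 1), \<tau>)
     = (\<lambda>s. ((col (extremal_x \<xi> \<eta> \<tau> s), vec (extremal_y \<xi> \<eta> \<tau> s)), extremal_t \<xi> \<eta> \<tau> s))"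
proof (rule extremal_eqI)
  show "((col (extremal_x \<xi> \<eta> \<tau> 0), vec (extremal_y \<xi> \<eta> \<tau> 0) :: real ^ 1), extremal_t \<xi> \<eta> \<tau> 0) = 0"
    by (simp add: extremal_init zero_prod_def col_def vec_eq_iff)
  have "extremal_control ((col \<xi>, vec \<eta> :: real ^ 1), \<tau>) = (\<lambda>s. (col (extremal_u \<xi> \<eta> \<tau> s), vec (extremal_v \<xi> \<eta> \<tau> s)))"
    using extremal_control_col[OF assms] by auto
  then show "horizontal_curve a b (\<lambda>s. ((col (extremal_x \<xi> \<eta> \<tau> s), vec (extremal_y \<xi> \<eta> \<tau> s)), extremal_t \<xi> \<eta> \<tau> s))
      (extremal_control ((col \<xi>, vec \<eta> :: real ^ 1), \<tau>))" if "a \<le> b" for a b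
    using horizontal_curve_col[OF that continuous_extremal(2,3) extremal_x_deriv[OF assms]
        extremal_y_deriv[OF assms, unfolded has_real_derivative_iff_has_vector_derivative] extremal_t_deriv[OF assms]] by simp
qed

lemma extremal_control_straight:
  fixes z :: "('q::finite, 'p::finite) V1"
  assumes "Aop \<tau> z = 0"
  shows "extremal_control (z, \<tau>) s = z"
proof -
  have "((\<lambda>z. (- s) *\<^sub>R Aop \<tau> z) ^^ n) z = (if n = 0 then z else 0)" for n
  proof (induction n)
    case (Suc n)
    have "Aop \<tau> (0 :: ('q, 'p) V1) = 0" by (simp add: Aop_def vec_eq_iff prod_eq_iff transpose_def matrix_vector_mult_def)
    then show ?case using Suc assms by simp
  qed simp
  then have "(\<lambda>n. (1 / fact n) *\<^sub>R ((\<lambda>z. (- s) *\<^sub>R Aop \<tau> z) ^^ n) z) = (\<lambda>n. if n = 0 then z else 0)"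
    by auto
  then show ?thesis
    unfolding extremal_control_def op_exp_def
    using sums_unique[OF sums_single[of 0 "\<lambda>_. z"]] by simp
qed

lemma straight_horizontal:
  fixes \<xi> :: "real ^ 'q::finite"
  assumes "a \<le> b"
  shows "horizontal_curve a b (\<lambda>s. ((col (s *\<^sub>R \<xi>), vec (s * \<eta>) :: real ^ 1), 0)) (\<lambda>s. (col \<xi>, vec \<eta>))"
proof (rule horizontal_curve_col[OF assms])
  show "((\<lambda>s. s *\<^sub>R \<xi>) has_vector_derivative \<xi>) (at s within A)" for s A
    using has_vector_derivative_scaleR_const[OF DERIV_ident, of \<xi>] by simp
  show "((\<lambda>s. s * \<eta>) has_vector_derivative \<eta>) (at s within A)" for s A
    using has_vector_derivative_scaleR_const[OF DERIV_ident, of \<eta>] by simp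
  show "((\<lambda>s. 0) has_vector_derivative (1 / 2) *\<^sub>R (\<eta> *\<^sub>R s *\<^sub>R \<xi> - (s * \<eta>) *\<^sub>R \<xi>)) (at s within A)" for s A
    by (simp add: mult.commute)
qed auto

text \<open>
If the initial control is in the kernel of the operator, it is constant. This covers \<open>\<tau> = 0\<close> and the
degenerate case of \<open>\<tau> \<noteq> 0\<close> with vanishing rotating component.
\<close>

lemma extremal_straight:
  fixes \<xi> \<tau> :: "real ^ 'q::finite"
  assumes "Aop \<tau> (col \<xi>, vec \<eta> :: real ^ 1) = 0"
  shows "extremal ((col \<xi>, vec \<eta> :: real ^ 1), \<tau>) = (\<lambda>s. ((col (s *\<^sub>R \<xi>), vec (s * \<eta>)), 0))"
proof (rule extremal_eqI)
  show "((col (0 *\<^sub>R \<xi>), vec (0 * \<eta>) :: real ^ 1), 0) = 0"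
    by (simp add: zero_prod_def col_def vec_eq_iff)
  have "extremal_control ((col \<xi>, vec \<eta> :: real ^ 1), \<tau>) = (\<lambda>s. (col \<xi>, vec \<eta>))"
    using extremal_control_straight[OF assms] by auto
  then show "horizontal_curve a b (\<lambda>s. ((col (s *\<^sub>R \<xi>), vec (s * \<eta>) :: real ^ 1), 0)) (extremal_control ((col \<xi>, vec \<eta> :: real ^ 1), \<tau>))"
    if "a \<le> b" for a b using straight_horizontal[OF that] by simp
qed

section \<open>The cut time\<close>

lemma competitor_length_bound:
  fixes \<gamma> :: "real \<Rightarrow> ('q::finite, 1) RH" and X Z e :: "real ^ 'q" and Y \<theta> s S :: real
  assumes h: "horizontal_curve 0 T \<gamma> w" and "\<gamma> 0 = 0" and fin: "\<gamma> T = ((col X, vec Y), Z)"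
    and e: "norm e = 1" and s: "0 < s" "s < S"
    and dk: "\<And>r. 0 < r \<Longrightarrow> r < S \<Longrightarrow> (k has_real_derivative - ((k r)\<^sup>2 + \<theta>\<^sup>2 / 4)) (at r)"
  shows "2 * (\<theta> * (e \<bullet> Z) + (X \<bullet> X - (e \<bullet> X)\<^sup>2) / (2 * s) + k s / 2 * ((e \<bullet> X)\<^sup>2 + Y\<^sup>2)) * s
      \<le> (control_length 0 T w)\<^sup>2"
proof -
  define x where "x = (\<lambda>r. uncol (fst (fst (\<gamma> r))))"
  define y where "y = (\<lambda>r. snd (fst (\<gamma> r)) $ 1)"
  define t where "t = (\<lambda>r. snd (\<gamma> r))"
  define u where "u = (\<lambda>r. uncol (fst (w r)))"
  define v where "v = (\<lambda>r. snd (w r) $ 1)"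
  have T: "0 \<le> T" using h by (simp add: horizontal_curve_def)
  have \<gamma>: "\<gamma> r = ((col (x r), vec (y r)), t r)" for r by (simp add: x_def y_def t_def)
  have w: "w r = (col (u r), vec (v r))" for r by (simp add: u_def v_def)
  have bx: "bounded_linear (\<lambda>z :: ('q, 1) V1. uncol (fst z))"
    and by': "bounded_linear (\<lambda>z :: ('q, 1) V1. snd z $ 1)"
    by (intro bounded_linear_compose[OF bounded_linear_uncol] bounded_linear_compose[OF bounded_linear_vec_nth]
        bounded_linear_fst bounded_linear_snd)+
  obtain L where L: "L-lipschitz_on {0..T} \<gamma>" using h unfolding horizontal_curve_def by blast
  have lip: "\<exists>L. L-lipschitz_on {0..T} (\<lambda>r. f (\<gamma> r))" if f: "bounded_linear f" for f :: "_ \<Rightarrow> 'z::real_normed_vector"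
  proof -
    obtain M where M: "M-lipschitz_on (\<gamma> ` {0..T}) f" using bounded_linear.lipschitz_boundE[OF f] by blast
    show ?thesis using lipschitz_on_compose2[OF L M] by blast
  qed
  obtain N C where N: "negligible N" "\<And>s. s \<in> {0..T} - N \<Longrightarrow> norm (w s) \<le> C"
    "\<And>s. s \<in> {0..T} - N \<Longrightarrow> ((\<lambda>r. fst (\<gamma> r)) has_vector_derivative w s) (at s within {0..T})"
    "\<And>s. s \<in> {0..T} - N \<Longrightarrow> ((\<lambda>r. snd (\<gamma> r)) has_vector_derivative Qform (fst (\<gamma> s)) (w s)) (at s within {0..T})"
    using horizontal_curve_ae[OF h] by metis
  have e0: "x T = X" "y T = Y" "t T = Z" using fin by (simp_all add: x_def y_def t_def)
  have "2 * (\<theta> * (e \<bullet> t T) + (x T \<bullet> x T - (e \<bullet> x T)\<^sup>2) / (2 * s) + k s / 2 * ((e \<bullet> x T)\<^sup>2 + (y T)\<^sup>2)) * s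
      \<le> (integral {0..T} (\<lambda>r. norm (w r)))\<^sup>2"
  proof (rule length_lower_bound[OF T e _ _ _ _ _ _ N(1) _ _ _ _ _ _ s dk])
    show "\<exists>L. L-lipschitz_on {0..T} x" unfolding x_def
      by (rule lip[of "\<lambda>z. uncol (fst (fst z))"]) (rule bounded_linear_compose[OF bx bounded_linear_fst])
    show "\<exists>L. L-lipschitz_on {0..T} y" unfolding y_def
      by (rule lip[of "\<lambda>z. snd (fst z) $ 1"]) (rule bounded_linear_compose[OF by' bounded_linear_fst])
    show "\<exists>L. L-lipschitz_on {0..T} t" unfolding t_def
      by (rule lip[of snd]) (rule bounded_linear_snd)
    show "x 0 = 0" "y 0 = 0" "t 0 = 0" using \<open>\<gamma> 0 = 0\<close> by (simp_all add: x_def y_def t_def uncol_def vec_eq_iff)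
    show "(x has_vector_derivative u r) (at r within {0..T})" if "r \<in> {0..T} - N" for r
      using bounded_linear.has_vector_derivative[OF bx N(3)[OF that]] unfolding x_def u_def .
    show "(y has_vector_derivative v r) (at r within {0..T})" if "r \<in> {0..T} - N" for r
      using bounded_linear.has_vector_derivative[OF by' N(3)[OF that]] unfolding y_def v_def .
    show "(t has_vector_derivative (1/2) *\<^sub>R (v r *\<^sub>R x r - y r *\<^sub>R u r)) (at r within {0..T})" if "r \<in> {0..T} - N" for r
      using N(4)[OF that] unfolding \<gamma> w fst_conv snd_conv Qform_col .
    have "w \<in> borel_measurable (lebesgue_on {0..T})" using h by (simp add: horizontal_curve_def)
    then show "(\<lambda>r. norm (w r)) \<in> borel_measurable (lebesgue_on {0..T})" by measurable
    show "0 \<le> norm (w r) \<and> norm (w r) \<le> C" if "r \<in> {0..T} - N" for r using N(2)[OF that] by simp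
    show "(norm (w r))\<^sup>2 = (norm (u r))\<^sup>2 + (v r)\<^sup>2" for r by (simp add: w norm_col_vec)
  qed
  then show ?thesis unfolding e0 control_length_def .
qed

lemma minimizes_lengthI:
  assumes h: "horizontal_curve 0 s \<gamma> w"
    and le: "\<And>T \<gamma>' w'. horizontal_curve 0 T \<gamma>' w' \<Longrightarrow> \<gamma>' 0 = \<gamma> 0 \<Longrightarrow> \<gamma>' T = \<gamma> s \<Longrightarrow>
        control_length 0 s w \<le> control_length 0 T w'"
  shows "minimizes_length \<gamma> s"
  unfolding minimizes_length_def sr_dist_def
  by (intro exI[of _ w] conjI h cInf_eq_minimum[symmetric]) (use h le in blast)+

lemma extremal_horizontal:
  fixes \<xi> \<tau> :: "real ^ 'q::finite"
  assumes "\<tau> \<noteq> 0" "a \<le> b"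
  shows "horizontal_curve a b (extremal ((col \<xi>, vec \<eta> :: real ^ 1), \<tau>)) (\<lambda>s. (col (extremal_u \<xi> \<eta> \<tau> s), vec (extremal_v \<xi> \<eta> \<tau> s)))"
  unfolding extremal_col[OF assms(1)]
  by (rule horizontal_curve_col[OF assms(2) continuous_extremal(2,3) extremal_x_deriv[OF assms(1)]
     extremal_y_deriv[OF assms(1), unfolded has_real_derivative_iff_has_vector_derivative] extremal_t_deriv[OF assms(1)]])

lemma extremal_length:
  fixes \<xi> \<tau> :: "real ^ 'q::finite"
  assumes "\<tau> \<noteq> 0" "a \<le> b"
  shows "control_length a b (\<lambda>s. (col (extremal_u \<xi> \<eta> \<tau> s), vec (extremal_v \<xi> \<eta> \<tau> s) :: real ^ 1)) = (b - a) * sqrt ((norm \<xi>)\<^sup>2 + \<eta>\<^sup>2)"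
  unfolding control_length_def norm_col_vec extremal_speed[OF assms(1)] using assms(2) by simp

lemma minimizes_before_full_turn:
  fixes \<xi> \<tau> :: "real ^ 'q::finite"
  assumes \<tau>: "\<tau> \<noteq> 0" and s: "0 < s" "norm \<tau> * s < 2 * pi"
  shows "minimizes_length (extremal ((col \<xi>, vec \<eta> :: real ^ 1), \<tau>)) s"
proof (rule minimizes_lengthI[OF extremal_horizontal[OF \<tau>]])
  fix T w' and \<gamma>' :: "real \<Rightarrow> ('q, 1) RH"
  assume h: "horizontal_curve 0 T \<gamma>' w'" and i: "\<gamma>' 0 = extremal ((col \<xi>, vec \<eta>), \<tau>) 0"
    and f: "\<gamma>' T = extremal ((col \<xi>, vec \<eta>), \<tau>) s"
  define e where "e = (1 / norm \<tau>) *\<^sub>R \<tau>"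
  have e: "norm e = 1" using \<tau> by (simp add: e_def)
  have n: "norm \<tau> > 0" using \<tau> by simp
  have "\<gamma>' 0 = 0" unfolding i extremal_col[OF \<tau>] by (simp add: extremal_init zero_prod_def col_def vec_eq_iff)
  moreover have "s < 2 * pi / norm \<tau>" using s n by (simp add: field_simps)
  ultimately have "s * ((norm \<xi>)\<^sup>2 + \<eta>\<^sup>2) * s \<le> (control_length 0 T w')\<^sup>2"
    unfolding extremal_calibration[OF \<tau> s, symmetric]
    using n by (intro competitor_length_bound[OF h _ f[unfolded extremal_col[OF \<tau>]] e[unfolded e_def] s(1), of "2 * pi / norm \<tau>"] cot_riccati)
       (auto simp: field_simps)
  then have "(s * sqrt ((norm \<xi>)\<^sup>2 + \<eta>\<^sup>2))\<^sup>2 \<le> (control_length 0 T w')\<^sup>2"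
    by (simp add: power_mult_distrib power2_eq_square mult.assoc mult.left_commute mult.commute)
  then have "s * sqrt ((norm \<xi>)\<^sup>2 + \<eta>\<^sup>2) \<le> control_length 0 T w'"
    by (rule power2_le_imp_le[OF _ control_length_nonneg[OF h]])
  then show "control_length 0 s (\<lambda>s. (col (extremal_u \<xi> \<eta> \<tau> s), vec (extremal_v \<xi> \<eta> \<tau> s))) \<le> control_length 0 T w'"
    using s by (simp add: extremal_length[OF \<tau>])
qed (use s in simp)

text \<open>
Here the calibration with \<open>\<theta> = 0\<close> and \<open>k(r) = 1 / r\<close> applies for all times, with an arbitrary unit
vector \<open>e\<close>; it only expresses that the length is at least the Euclidean distance of the projections.
\<close>

lemma minimizes_straight:
  fixes \<xi> \<tau> :: "real ^ 'q::finite"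
  assumes A: "Aop \<tau> (col \<xi>, vec \<eta> :: real ^ 1) = 0" and s: "0 < s"
  shows "minimizes_length (extremal ((col \<xi>, vec \<eta> :: real ^ 1), \<tau>)) s"
proof (rule minimizes_lengthI)
  show "horizontal_curve 0 s (extremal ((col \<xi>, vec \<eta> :: real ^ 1), \<tau>)) (\<lambda>_. (col \<xi>, vec \<eta>))"
    unfolding extremal_straight[OF A] by (rule straight_horizontal) (use s in simp)
  fix T w' and \<gamma>' :: "real \<Rightarrow> ('q, 1) RH"
  assume h: "horizontal_curve 0 T \<gamma>' w'" and i: "\<gamma>' 0 = extremal ((col \<xi>, vec \<eta>), \<tau>) 0"
    and f: "\<gamma>' T = extremal ((col \<xi>, vec \<eta>), \<tau>) s"
  obtain e :: "real ^ 'q" where e: "norm e = 1" using norm_Basis[OF SOME_Basis] by blast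
  have "\<gamma>' 0 = 0" unfolding i extremal_straight[OF A] by (simp add: zero_prod_def col_def vec_eq_iff)
  then have "2 * (0 * (e \<bullet> 0) + ((s *\<^sub>R \<xi>) \<bullet> (s *\<^sub>R \<xi>) - (e \<bullet> (s *\<^sub>R \<xi>))\<^sup>2) / (2 * s) + (1 / s) / 2 * ((e \<bullet> (s *\<^sub>R \<xi>))\<^sup>2 + (s * \<eta>)\<^sup>2)) * s
     \<le> (control_length 0 T w')\<^sup>2"
    using s by (intro competitor_length_bound[OF h _ f[unfolded extremal_straight[OF A]] e s, of "s + 1"])
      (auto intro!: derivative_eq_intros simp: power2_eq_square)
  moreover have "2 * (0 * z + (A - E) / (2 * s) + (1 / s) / 2 * (E + B)) * s = A + B" for z A E B :: real
    using s by (simp add: field_simps)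
  ultimately have "(s *\<^sub>R \<xi>) \<bullet> (s *\<^sub>R \<xi>) + (s * \<eta>)\<^sup>2 \<le> (control_length 0 T w')\<^sup>2" by simp
  then have "(s * sqrt ((norm \<xi>)\<^sup>2 + \<eta>\<^sup>2))\<^sup>2 \<le> (control_length 0 T w')\<^sup>2"
    by (simp add: power_mult_distrib power2_norm_eq_inner) (simp add: power2_eq_square algebra_simps)
  then have "s * sqrt ((norm \<xi>)\<^sup>2 + \<eta>\<^sup>2) \<le> control_length 0 T w'"
    by (rule power2_le_imp_le[OF _ control_length_nonneg[OF h]])
  then show "control_length 0 s (\<lambda>_. (col \<xi>, vec \<eta>)) \<le> control_length 0 T w'"
    using s by (simp add: control_length_def norm_col_vec)
qed

text \<open>
The shorter competitor up to a time \<open>L\<close> between the full turn and \<open>s\<close>, followed by the extremal from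
\<open>L\<close> on, has the same end points as the extremal on \<open>[0, s]\<close> and is strictly shorter.
\<close>

lemma not_minimizes_after_full_turn:
  fixes \<xi> \<tau> :: "real ^ 'q::finite"
  assumes \<tau>: "\<tau> \<noteq> 0" and ab: "\<xi> \<bullet> \<tau> \<noteq> 0 \<or> \<eta> \<noteq> 0" and s: "2 * pi < norm \<tau> * s"
  shows "\<not> minimizes_length (extremal ((col \<xi>, vec \<eta> :: real ^ 1), \<tau>)) s"
proof
  let ?\<gamma> = "extremal ((col \<xi>, vec \<eta> :: real ^ 1), \<tau>)"
  let ?w = "\<lambda>s. (col (extremal_u \<xi> \<eta> \<tau> s), vec (extremal_v \<xi> \<eta> \<tau> s) :: real ^ 1)"
  assume "minimizes_length ?\<gamma> s"
  then obtain w where w: "horizontal_curve 0 s ?\<gamma> w" "control_length 0 s w = sr_dist (?\<gamma> 0) (?\<gamma> s)"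
    unfolding minimizes_length_def by blast
  have n: "norm \<tau> > 0" using \<tau> by simp
  then have "2 * pi / norm \<tau> < s" using s by (simp add: field_simps)
  then obtain L where L: "2 * pi / norm \<tau> < L" "L < s" "extremal_y \<xi> \<eta> \<tau> L \<noteq> 0"
    using extremal_y_nonzero_soon[OF \<tau> ab] by blast
  have L0: "0 < L" using L(1) n pi_gt_zero by (smt (verit) divide_pos_pos)
  have L': "2 * pi < norm \<tau> * L" using L(1) n by (simp add: field_simps)
  obtain x u t :: "real \<Rightarrow> real ^ 'q" and y v :: "real \<Rightarrow> real"
    where c: "x 0 = 0" "y 0 = 0" "t 0 = 0"
    "x L = extremal_x \<xi> \<eta> \<tau> L" "y L = extremal_y \<xi> \<eta> \<tau> L" "t L = extremal_t \<xi> \<eta> \<tau> L"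
    "\<And>s A. (x has_vector_derivative u s) (at s within A)"
    "\<And>s A. (y has_vector_derivative v s) (at s within A)"
    "\<And>s A. (t has_vector_derivative (1/2) *\<^sub>R (v s *\<^sub>R x s - y s *\<^sub>R u s)) (at s within A)"
    "continuous_on UNIV u" "continuous_on UNIV v"
    "integral {0..L} (\<lambda>s. sqrt ((norm (u s))\<^sup>2 + (v s)\<^sup>2)) < L * sqrt ((norm \<xi>)\<^sup>2 + \<eta>\<^sup>2)"
    by (rule shorter_competitor[OF \<tau> L' L(3)]) (rule that)
  define \<gamma>1 where "\<gamma>1 = (\<lambda>s. ((col (x s), vec (y s) :: real ^ 1), t s))"
  define w1 where "w1 = (\<lambda>s. (col (u s), vec (v s) :: real ^ 1))"
  have h1: "horizontal_curve 0 L \<gamma>1 w1"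
    unfolding \<gamma>1_def w1_def using L0 c by (intro horizontal_curve_col) auto
  have h2: "horizontal_curve L s ?\<gamma> ?w" using extremal_horizontal[OF \<tau>] L by simp
  have cw: "continuous_on UNIV (\<lambda>s. (col (u s), vec (v s) :: real ^ 1))" if "continuous_on UNIV u" "continuous_on UNIV v"
    for u :: "real \<Rightarrow> real ^ 'q" and v
    by (intro continuous_intros bounded_linear.continuous_on[OF bounded_linear_col] bounded_linear.continuous_on[OF bounded_linear_vec1] that)
  have m: "w1 \<in> borel_measurable borel" "?w \<in> borel_measurable borel"
    unfolding w1_def by (intro borel_measurable_continuous_onI cw c continuous_extremal)+
  define \<gamma>2 where "\<gamma>2 = (\<lambda>r. if r \<le> L then \<gamma>1 r else ?\<gamma> r)"
  define w2 where "w2 = (\<lambda>r. if r \<le> L then w1 r else ?w r)"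
  have h: "horizontal_curve 0 s \<gamma>2 w2"
    unfolding \<gamma>2_def w2_def
    by (rule horizontal_curve_join[OF h1 h2 _ m]) (simp add: \<gamma>1_def extremal_col[OF \<tau>] c)
  have ends: "\<gamma>2 0 = ?\<gamma> 0" "\<gamma>2 s = ?\<gamma> s"
    using L L0 c by (auto simp: \<gamma>2_def \<gamma>1_def extremal_col[OF \<tau>] extremal_init)
  have "control_length 0 s w2 = control_length 0 L w2 + control_length L s w2"
    unfolding control_length_def
    using integrable_control_norm[OF h] L L0 by (intro Henstock_Kurzweil_Integration.integral_combine[symmetric]) auto
  also have "control_length 0 L w2 = control_length 0 L w1"
    unfolding control_length_def by (rule integral_cong) (simp add: w2_def)
  also have "control_length L s w2 = control_length L s ?w"
    unfolding control_length_def by (rule integral_spike[of "{L}"]) (auto simp: w2_def)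
  also have "\<dots> = (s - L) * sqrt ((norm \<xi>)\<^sup>2 + \<eta>\<^sup>2)" using extremal_length[OF \<tau>] L by simp
  also have "control_length 0 L w1 + (s - L) * sqrt ((norm \<xi>)\<^sup>2 + \<eta>\<^sup>2) < s * sqrt ((norm \<xi>)\<^sup>2 + \<eta>\<^sup>2)"
    using c(12) by (simp add: control_length_def w1_def norm_col_vec algebra_simps)
  also have "\<dots> = control_length 0 s ?w" using extremal_length[OF \<tau>, of 0 s] L L0 by simp
  also have "\<dots> = control_length 0 s w"
    by (rule control_length_unique[OF extremal_horizontal[OF \<tau>] w(1)]) (use L L0 in auto)
  also have "\<dots> \<le> control_length 0 s w2"
    unfolding w(2) using sr_dist_le[OF h] by (simp add: ends)
  finally show False by simp
qed

lemma cut_time_straight: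
  fixes \<xi> \<tau> :: "real ^ 'q::finite"
  assumes "Aop \<tau> (col \<xi>, vec \<eta> :: real ^ 1) = 0"
  shows "cut_time ((col \<xi>, vec \<eta> :: real ^ 1), \<tau>) = \<infinity>"
proof -
  have "ereal B \<le> cut_time ((col \<xi>, vec \<eta> :: real ^ 1), \<tau>)" for B
  proof -
    have "ereal B \<le> ereal (max B 1)" by simp
    also have "\<dots> \<le> cut_time ((col \<xi>, vec \<eta> :: real ^ 1), \<tau>)"
      unfolding cut_time_def using minimizes_straight[OF assms, of "max B 1"] by (intro Sup_upper imageI CollectI) auto
    finally show ?thesis .
  qed
  then show ?thesis by (rule ereal_top)
qed

lemma cut_time_full_turn:
  fixes \<xi> \<tau> :: "real ^ 'q::finite"
  assumes \<tau>: "\<tau> \<noteq> 0" and ab: "\<xi> \<bullet> \<tau> \<noteq> 0 \<or> \<eta> \<noteq> 0"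
  shows "cut_time ((col \<xi>, vec \<eta> :: real ^ 1), \<tau>) = ereal (2 * pi / norm \<tau>)"
  unfolding cut_time_def
proof (rule antisym)
  have n: "norm \<tau> > 0" using \<tau> by simp
  let ?S = "{s. 0 < s \<and> minimizes_length (extremal ((col \<xi>, vec \<eta> :: real ^ 1), \<tau>)) s}"
  show "Sup (ereal ` ?S) \<le> ereal (2 * pi / norm \<tau>)"
  proof (rule Sup_least, clarify)
    fix s assume "minimizes_length (extremal ((col \<xi>, vec \<eta> :: real ^ 1), \<tau>)) s"
    then have "\<not> 2 * pi < norm \<tau> * s" using not_minimizes_after_full_turn[OF \<tau> ab] by blast
    then show "ereal s \<le> ereal (2 * pi / norm \<tau>)" using n by (simp add: field_simps)
  qed
  show "ereal (2 * pi / norm \<tau>) \<le> Sup (ereal ` ?S)"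
  proof (rule ereal_le_epsilon2)
    fix \<epsilon> :: real assume \<epsilon>: "0 < \<epsilon>"
    define r where "r = max (2 * pi / norm \<tau> - \<epsilon>) (pi / norm \<tau>)"
    have r: "0 < r" "r < 2 * pi / norm \<tau>" "2 * pi / norm \<tau> \<le> r + \<epsilon>"
    proof -
      have "0 < pi / norm \<tau>" using n by simp
      moreover have "2 * pi / norm \<tau> = 2 * (pi / norm \<tau>)" by simp
      ultimately show "0 < r" "r < 2 * pi / norm \<tau>" "2 * pi / norm \<tau> \<le> r + \<epsilon>"
        using \<epsilon> unfolding r_def by linarith+
    qed
    have "norm \<tau> * r < 2 * pi" using n r(2) by (simp add: field_simps)
    then have "ereal r \<le> Sup (ereal ` ?S)"
      using minimizes_before_full_turn[OF \<tau> r(1)] r(1) by (intro Sup_upper) auto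
    then have "ereal r + ereal \<epsilon> \<le> Sup (ereal ` ?S) + ereal \<epsilon>" by (rule add_right_mono)
    then show "ereal (2 * pi / norm \<tau>) \<le> Sup (ereal ` ?S) + ereal \<epsilon>"
      by (rule order_trans[rotated]) (use r(3) in simp)
  qed
qed

section \<open>The differential of the end-point map after one full turn\<close>

definition end_map :: "real \<Rightarrow> ('a::real_inner \<times> real) \<times> 'a \<Rightarrow> ('a \<times> real) \<times> 'a" where
  "end_map s c = ((extremal_x (fst (fst c)) (snd (fst c)) (snd c) s, extremal_y (fst (fst c)) (snd (fst c)) (snd c) s),
      extremal_t (fst (fst c)) (snd (fst c)) (snd c) s)"

text \<open>
The value of the differential of the end-point map at the covector \<open>((\<xi>, \<eta>), \<tau>)\<close> and the time of the
full turn, applied to \<open>d\<close>. Primed names are directional derivatives of the unprimed ones: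
\<open>\<theta>\<close> is the norm of \<open>\<tau>\<close>, \<open>Y\<close> the integral of \<open>y\<close>, \<open>R\<close> the squared speed of the rotating part,
\<open>q\<close> the coefficient of \<open>\<tau>\<close> in the orthogonal decomposition of \<open>\<xi>\<close>, and \<open>n\<close> the value of
\<open>(\<theta> s - sin (\<theta> s)) / \<theta>\<^sup>3\<close>, whose derivative in \<open>\<theta>\<close> is \<open>- 3 n / \<theta>\<close>.
\<close>

definition end_map_deriv :: "'a::real_inner \<Rightarrow> real \<Rightarrow> 'a \<Rightarrow> ('a \<times> real) \<times> 'a \<Rightarrow> ('a \<times> real) \<times> 'a" where
  "end_map_deriv \<xi> \<eta> \<tau> d = (
     let \<theta> = norm \<tau>; s = 2 * pi / \<theta>; P = \<xi> \<bullet> \<tau>; n = 2 * pi / \<theta> ^ 3;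
         \<xi>' = fst (fst d); \<eta>' = snd (fst d); \<tau>' = snd d;
         \<theta>' = (\<tau> \<bullet> \<tau>') / \<theta>; P' = \<xi> \<bullet> \<tau>' + \<xi>' \<bullet> \<tau>;
         y' = \<eta> * (s / \<theta> * \<theta>'); Y' = P' * n - 3 * P * n * \<theta>' / \<theta>;
         R = \<eta>\<^sup>2 + P\<^sup>2 / \<theta>\<^sup>2; R' = 2 * \<eta> * \<eta>' + 2 * P * P' / \<theta>\<^sup>2 - 2 * P\<^sup>2 * \<theta>' / \<theta> ^ 3;
         q = P / \<theta>\<^sup>2; q' = P' / \<theta>\<^sup>2 - 2 * P * \<theta>' / \<theta> ^ 3
     in ((s *\<^sub>R \<xi>' - Y' *\<^sub>R \<tau> - (P * n) *\<^sub>R \<tau>', y'),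
         ((R' * n - 3 * R * n * \<theta>' / \<theta>) / 2) *\<^sub>R \<tau> + (R * n / 2) *\<^sub>R \<tau>'
         + (s * y' / 2 - Y') *\<^sub>R (\<xi> - q *\<^sub>R \<tau>) - (P * n) *\<^sub>R (\<xi>' - q' *\<^sub>R \<tau> - q *\<^sub>R \<tau>')))"

lemma end_map_has_derivative:
  fixes \<xi> \<tau> :: "'a::real_inner"
  assumes "\<tau> \<noteq> 0"
  shows "(end_map (2 * pi / norm \<tau>) has_derivative end_map_deriv \<xi> \<eta> \<tau>) (at ((\<xi>, \<eta>), \<tau>))"
proof -
  define \<theta> where "\<theta> = norm \<tau>"
  define s where "s = 2 * pi / \<theta>"
  define P where "P = \<xi> \<bullet> \<tau>"
  define n where "n = 2 * pi / \<theta> ^ 3"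
  have \<theta>: "\<theta> > 0" using assms by (simp add: \<theta>_def)
  have \<theta>s: "\<theta> * s = 2 * pi" using \<theta> by (simp add: s_def)
  let ?c = "((\<xi>, \<eta>), \<tau>)"
  define \<Theta> where "\<Theta> = (\<lambda>c :: ('a \<times> real) \<times> 'a. norm (snd c))"
  define \<Theta>' where "\<Theta>' = (\<lambda>d :: ('a \<times> real) \<times> 'a. (\<tau> \<bullet> snd d) / \<theta>)"
  define p where "p = (\<lambda>c :: ('a \<times> real) \<times> 'a. fst (fst c) \<bullet> snd c)"
  define p' where "p' = (\<lambda>d :: ('a \<times> real) \<times> 'a. \<xi> \<bullet> snd d + fst (fst d) \<bullet> \<tau>)"
  have d\<Theta>: "(\<Theta> has_derivative \<Theta>') (at ?c)"
  proof -
    have "(norm has_derivative (\<lambda>h. h \<bullet> sgn \<tau>)) (at (snd ?c))"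
      using has_derivative_norm[OF assms] by simp
    from has_derivative_compose[OF has_derivative_snd[OF has_derivative_ident] this]
    show ?thesis unfolding \<Theta>_def \<Theta>'_def by (simp add: sgn_div_norm \<theta>_def inner_commute divide_inverse mult.commute)
  qed
  have dp: "(p has_derivative p') (at ?c)"
    unfolding p_def p'_def by (rule has_derivative_eq_rhs, (rule derivative_intros)+) auto
  have d\<xi>: "((\<lambda>c :: ('a \<times> real) \<times> 'a. fst (fst c)) has_derivative (\<lambda>d. fst (fst d))) (at ?c)"
    and d\<eta>: "((\<lambda>c :: ('a \<times> real) \<times> 'a. snd (fst c)) has_derivative (\<lambda>d. snd (fst d))) (at ?c)"
    and d\<tau>: "((\<lambda>c :: ('a \<times> real) \<times> 'a. snd c) has_derivative (\<lambda>d. snd d)) (at ?c)"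
    by (rule derivative_intros)+
  have at: "\<Theta> ?c = \<theta>" "p ?c = P" by (simp_all add: \<Theta>_def \<theta>_def p_def P_def)
  have "((\<lambda>r. sin (r * s) / r) has_real_derivative s / \<theta>) (at (\<Theta> ?c))"
    unfolding at using \<theta> by (auto intro!: derivative_eq_intros simp: \<theta>s power2_eq_square)
  note dk = DERIV_compose_FDERIV[OF this d\<Theta>]
  have "((\<lambda>r. (1 - cos (r * s)) / r ^ 2) has_real_derivative 0) (at (\<Theta> ?c))"
    unfolding at using \<theta> by (auto intro!: derivative_eq_intros simp: \<theta>s)
  note dm = DERIV_compose_FDERIV[OF this d\<Theta>]
  have "((\<lambda>r. (r * s - sin (r * s)) / r ^ 3) has_real_derivative - 3 * n / \<theta>) (at (\<Theta> ?c))"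
    unfolding at using \<theta> by (auto intro!: derivative_eq_intros simp: \<theta>s n_def power2_eq_square power3_eq_cube)
  note dn = DERIV_compose_FDERIV[OF this d\<Theta>]
  have "((\<lambda>r. 1 / r ^ 2) has_real_derivative - 2 / \<theta> ^ 3) (at (\<Theta> ?c))"
    unfolding at using \<theta> by (auto intro!: derivative_eq_intros simp: power2_eq_square power3_eq_cube)
  note di = DERIV_compose_FDERIV[OF this d\<Theta>]
  define y where "y = (\<lambda>c. snd (fst c) * (sin (\<Theta> c * s) / \<Theta> c) + p c * ((1 - cos (\<Theta> c * s)) / \<Theta> c ^ 2))"
  define Y where "Y = (\<lambda>c. snd (fst c) * ((1 - cos (\<Theta> c * s)) / \<Theta> c ^ 2) + p c * ((\<Theta> c * s - sin (\<Theta> c * s)) / \<Theta> c ^ 3))"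
  define y' where "y' = (\<lambda>d. \<eta> * (s / \<theta> * \<Theta>' d))"
  define Y' where "Y' = (\<lambda>d. p' d * n - 3 * P * n * \<Theta>' d / \<theta>)"
  have dy: "(y has_derivative y') (at ?c)"
    unfolding y_def y'_def
    by (rule has_derivative_eq_rhs, (rule has_derivative_add has_derivative_mult d\<eta> dp dk dm)+)
       (simp add: at \<theta>s fun_eq_iff mult.commute)
  have dY: "(Y has_derivative Y') (at ?c)"
    unfolding Y_def Y'_def
    by (rule has_derivative_eq_rhs, (rule has_derivative_add has_derivative_mult d\<eta> dp dn dm)+)
       (simp add: at \<theta>s n_def fun_eq_iff)
  have atY: "y ?c = 0" "Y ?c = P * n" by (simp_all add: y_def Y_def at \<theta>s n_def)
  define R where "R = (\<lambda>c. (snd (fst c))\<^sup>2 + (p c)\<^sup>2 * (1 / (\<Theta> c)\<^sup>2))"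
  define R' where "R' = (\<lambda>d. 2 * \<eta> * snd (fst d) + 2 * P * p' d / \<theta>\<^sup>2 - 2 * P\<^sup>2 * \<Theta>' d / \<theta> ^ 3)"
  have dR: "(R has_derivative R') (at ?c)"
    unfolding R_def R'_def power2_eq_square[of "snd (fst _)"] power2_eq_square[of "p _"]
    by (rule has_derivative_eq_rhs, (rule has_derivative_add has_derivative_mult d\<eta> dp di)+)
       (simp add: at fun_eq_iff power2_eq_square algebra_simps)
  define Rc where "Rc = \<eta>\<^sup>2 + P\<^sup>2 / \<theta>\<^sup>2"
  have atR: "R ?c = Rc" by (simp add: R_def Rc_def at)
  define w where "w = (\<lambda>c. fst (fst c) - (p c * (1 / (\<Theta> c)\<^sup>2)) *\<^sub>R snd c)"
  define w' where "w' = (\<lambda>d. fst (fst d) - (p' d / \<theta>\<^sup>2 - 2 * P * \<Theta>' d / \<theta> ^ 3) *\<^sub>R \<tau> - (P / \<theta>\<^sup>2) *\<^sub>R snd d)"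
  have dw: "(w has_derivative w') (at ?c)"
    unfolding w_def w'_def
    by (rule has_derivative_eq_rhs, (rule has_derivative_diff has_derivative_scaleR has_derivative_mult d\<xi> d\<tau> dp di)+)
       (simp add: at fun_eq_iff algebra_simps)
  have atw: "w ?c = \<xi> - (P / \<theta>\<^sup>2) *\<^sub>R \<tau>" by (simp add: w_def at)
  define Nf where "Nf = (\<lambda>c. (\<Theta> c * s - sin (\<Theta> c * s)) / \<Theta> c ^ 3)"
  have dN: "(Nf has_derivative (\<lambda>d. \<Theta>' d * (- 3 * n / \<theta>))) (at ?c)" unfolding Nf_def by (rule dn)
  have atN: "Nf ?c = n" by (simp add: Nf_def at \<theta>s n_def)
  have E: "end_map s = (\<lambda>c. ((s *\<^sub>R fst (fst c) - Y c *\<^sub>R snd c, y c),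
      (R c * Nf c * (1 / 2)) *\<^sub>R snd c + (s * y c * (1 / 2) - Y c) *\<^sub>R w c))"
    by (simp add: end_map_def extremal_x_def extremal_y_def extremal_t_def extremal_y_integral_def y_def Y_def R_def w_def Nf_def \<Theta>_def p_def fun_eq_iff)
  have "(end_map s has_derivative (\<lambda>d. ((s *\<^sub>R fst (fst d) - Y' d *\<^sub>R \<tau> - (P * n) *\<^sub>R snd d, y' d),
      ((R' d * n - 3 * Rc * n * \<Theta>' d / \<theta>) / 2) *\<^sub>R \<tau> + (Rc * n / 2) *\<^sub>R snd d
       + (s * y' d / 2 - Y' d) *\<^sub>R (\<xi> - (P / \<theta>\<^sup>2) *\<^sub>R \<tau>) - (P * n) *\<^sub>R w' d))) (at ?c)"
    unfolding E
    by (rule has_derivative_eq_rhs, (rule has_derivative_Pair has_derivative_add has_derivative_diff has_derivative_scaleR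
          has_derivative_mult has_derivative_const d\<xi> d\<tau> dR dN dy dY dw)+)
       (simp add: atN atY atR atw fun_eq_iff diff_divide_distrib algebra_simps)
  then show ?thesis
    unfolding s_def[symmetric] \<theta>_def[symmetric]
    by (rule has_derivative_eq_rhs)
       (simp add: end_map_deriv_def Let_def fun_eq_iff Y'_def y'_def R'_def w'_def p'_def \<Theta>'_def \<theta>_def[symmetric] s_def P_def n_def Rc_def mult.assoc)
qed

text \<open>
If \<open>\<eta> = 0\<close>, the direction \<open>((0, 1), 0)\<close> is in the kernel, because \<open>\<eta>\<close> enters the end point at this time
only through \<open>\<eta>\<^sup>2\<close> and through terms that vanish to second order. If the orthogonal component \<open>w\<close> of
\<open>\<xi>\<close> vanishes, rotating the initial velocity \<open>(\<xi>, \<eta>)\<close> does not move the end point of the closed loop.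
Otherwise the \<open>y\<close>-component of the kernel equation shows that \<open>norm \<tau>\<close> is stationary, and the remaining
components, tested against \<open>w\<close> and \<open>\<tau>\<close>, force the direction to vanish.
\<close>

lemma end_map_deriv_bij_iff:
  fixes \<xi> \<tau> :: "'a::euclidean_space"
  assumes "\<tau> \<noteq> 0" and ab: "\<xi> \<bullet> \<tau> \<noteq> 0 \<or> \<eta> \<noteq> 0"
  shows "bij (end_map_deriv \<xi> \<eta> \<tau>) \<longleftrightarrow> \<eta> \<noteq> 0 \<and> \<xi> - ((\<xi> \<bullet> \<tau>) / (norm \<tau>)\<^sup>2) *\<^sub>R \<tau> \<noteq> 0"
proof -
  define \<theta> where "\<theta> = norm \<tau>"
  define s where "s = 2 * pi / \<theta>"
  define P where "P = \<xi> \<bullet> \<tau>"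
  define n where "n = 2 * pi / \<theta> ^ 3"
  define q where "q = P / \<theta>\<^sup>2"
  define w where "w = \<xi> - q *\<^sub>R \<tau>"
  define D where "D = end_map_deriv \<xi> \<eta> \<tau>"
  have \<theta>: "\<theta> > 0" using assms by (simp add: \<theta>_def)
  have s: "s > 0" using \<theta> by (simp add: s_def)
  have n: "n > 0" using \<theta> by (simp add: n_def)
  have ns: "n * \<theta>\<^sup>2 = s" using \<theta> by (simp add: n_def s_def power2_eq_square power3_eq_cube)
  have tt: "\<tau> \<bullet> \<tau> = \<theta>\<^sup>2" by (simp add: \<theta>_def power2_norm_eq_inner)
  have wt: "w \<bullet> \<tau> = 0" using \<theta> by (simp add: w_def inner_diff_left tt q_def P_def)
  have lin: "linear D"
    using end_map_has_derivative[OF assms(1)] has_derivative_linear D_def by blast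
  have D0: "D ((\<xi>', \<eta>'), \<tau>') = ((s *\<^sub>R \<xi>' - (P' * n) *\<^sub>R \<tau> - (P * n) *\<^sub>R \<tau>', 0),
      ((2 * \<eta> * \<eta>' + 2 * P * P' / \<theta>\<^sup>2) * n / 2) *\<^sub>R \<tau> + ((\<eta>\<^sup>2 + P\<^sup>2 / \<theta>\<^sup>2) * n / 2) *\<^sub>R \<tau>'
      - (P' * n) *\<^sub>R w - (P * n) *\<^sub>R (\<xi>' - (P' / \<theta>\<^sup>2) *\<^sub>R \<tau> - q *\<^sub>R \<tau>'))"
    if "\<tau> \<bullet> \<tau>' = 0" "P' = \<xi> \<bullet> \<tau>' + \<xi>' \<bullet> \<tau>" for \<xi>' \<eta>' \<tau>' P'
    using that by (simp add: D_def end_map_deriv_def Let_def \<theta>_def[symmetric] s_def n_def P_def[symmetric] q_def[symmetric] w_def[symmetric])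
  have "\<not> inj D" if "\<eta> = 0"
  proof -
    have "D ((0, 1), 0) = 0" by (subst D0[of _ 0]) (simp_all add: that zero_prod_def)
    moreover have "D 0 = 0" using lin linear_0 by blast
    ultimately show ?thesis by (metis (no_types) injD snd_conv fst_conv zero_prod_def zero_neq_one)
  qed
  moreover have "\<not> inj D" if "w = 0"
  proof -
    have "D ((- \<eta> *\<^sub>R \<tau>, P), 0) = 0"
      using \<theta> by (subst D0[of _ "- \<eta> * \<theta>\<^sup>2"])
       (simp_all add: that zero_prod_def tt ns[symmetric] mult.commute mult.left_commute)
    moreover have "D 0 = 0" using lin linear_0 by blast
    moreover have "((- \<eta> *\<^sub>R \<tau>, P), 0 :: 'a) \<noteq> 0" using ab assms(1) by (auto simp: zero_prod_def P_def)
    ultimately show ?thesis by (metis injD)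
  qed
  moreover have "inj D" if \<eta>: "\<eta> \<noteq> 0" and w: "w \<noteq> 0"
  proof (rule linear_injective_0[OF lin, THEN iffD2], intro allI impI)
    fix d assume Dd: "D d = 0"
    obtain \<xi>' \<eta>' \<tau>' where d: "d = ((\<xi>', \<eta>'), \<tau>')" by (metis prod.collapse)
    have "snd (fst (D d)) = 0" using Dd by simp
    then have t0: "\<tau> \<bullet> \<tau>' = 0"
      using \<eta> \<theta> s by (simp add: d D_def end_map_deriv_def Let_def \<theta>_def[symmetric] s_def[symmetric])
    define P' where "P' = \<xi> \<bullet> \<tau>' + \<xi>' \<bullet> \<tau>"
    note D = D0[OF t0 P'_def, of \<eta>', folded d, unfolded Dd]
    have x: "s *\<^sub>R \<xi>' = (P' * n) *\<^sub>R \<tau> + (P * n) *\<^sub>R \<tau>'"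
      using arg_cong[OF D, of "\<lambda>z. fst (fst z)"] by (simp add: algebra_simps)
    have "s *\<^sub>R \<xi>' = s *\<^sub>R ((P' / \<theta>\<^sup>2) *\<^sub>R \<tau> + q *\<^sub>R \<tau>')"
      unfolding x using \<theta> by (simp add: ns[symmetric] q_def algebra_simps)
    then have \<xi>': "\<xi>' = (P' / \<theta>\<^sup>2) *\<^sub>R \<tau> + q *\<^sub>R \<tau>'" using s by simp
    have "\<xi>' \<bullet> \<tau> = P'"
      using \<theta> t0 inner_commute[of \<tau> \<tau>'] by (subst \<xi>') (simp add: inner_add_left tt)
    then have "\<xi> \<bullet> \<tau>' = 0" using P'_def by simp
    then have wt': "w \<bullet> \<tau>' = 0" by (simp add: w_def inner_diff_left t0)
    have wtc: "\<tau> \<bullet> w = 0" "\<tau>' \<bullet> w = 0" "\<tau>' \<bullet> \<tau> = 0"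
      using wt wt' t0 by (simp_all add: inner_commute)
    let ?r = "(2 * \<eta> * \<eta>' + 2 * P * P' / \<theta>\<^sup>2) * n / 2"
    have t: "?r *\<^sub>R \<tau> + ((\<eta>\<^sup>2 + P\<^sup>2 / \<theta>\<^sup>2) * n / 2) *\<^sub>R \<tau>' - (P' * n) *\<^sub>R w = 0"
      using arg_cong[OF D, of snd] by (simp add: \<xi>')
    from arg_cong[OF t, of "\<lambda>z. z \<bullet> w"] have "P' * n * (w \<bullet> w) = 0"
      using wtc by (simp add: inner_add_left inner_diff_left)
    then have P': "P' = 0" using n w by simp
    from arg_cong[OF t, of "\<lambda>z. z \<bullet> \<tau>"] have "?r * \<theta>\<^sup>2 = 0"
      using wtc wt by (simp add: inner_add_left inner_diff_left tt)
    then have \<eta>': "\<eta>' = 0" using \<theta> n P' \<eta> by simp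
    have "\<eta>\<^sup>2 + P\<^sup>2 / \<theta>\<^sup>2 > 0" using \<eta> by (intro add_pos_nonneg) auto
    then have \<tau>': "\<tau>' = 0" using t n P' \<eta>' by simp
    then show "d = 0" using \<xi>' P' \<eta>' by (simp add: d zero_prod_def)
  qed
  moreover have "bij D \<longleftrightarrow> inj D"
    using lin linear_injective_imp_surjective[of D] by (auto simp: bij_def)
  ultimately show ?thesis
    by (auto simp: D_def w_def q_def P_def \<theta>_def)
qed

section \<open>Projections, pseudo-inverse and the criterion\<close>

lemma orth_proj_eqI:
  assumes "subspace S" "v \<in> S" "t - v \<in> S\<^sup>\<bottom>"
  shows "orth_proj S t = v"
  unfolding orth_proj_def
proof (rule the_equality)
  fix v' assume v': "v' \<in> S \<and> t - v' \<in> S\<^sup>\<bottom>"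
  have "v' - v \<in> S" using assms v' subspace_diff by blast
  then have "orthogonal (v' - v) (t - v)" "orthogonal (v' - v) (t - v')"
    using assms v' by (auto simp: orthogonal_comp_def)
  then have "(v' - v) \<bullet> (v' - v) = 0"
    by (simp add: orthogonal_def inner_diff_right)
  then show "v' = v" by simp
qed (use assms in auto)

lemma col_mult: "col X *v y = y $ 1 *\<^sub>R X"
  by (simp add: col_def matrix_vector_mult_def vec_eq_iff sum_1)

lemma mat_image_col: "mat_image (col X) = range (\<lambda>c. c *\<^sub>R X)"
proof -
  have "c *\<^sub>R X \<in> range (\<lambda>y :: real ^ 1. y $ 1 *\<^sub>R X)" for c :: real
    by (rule range_eqI[of _ _ "vec c :: real ^ 1"]) simp
  then show ?thesis unfolding mat_image_def by (auto simp: col_mult)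
qed

lemma subspace_mat_image_col: "subspace (mat_image (col X))"
  unfolding mat_image_col span_singleton[symmetric] by (rule subspace_span)

text \<open>
The image of a nonzero one-column matrix is the line spanned by the column.
\<close>

lemma orth_proj_image:
  fixes X t :: "real ^ 'q::finite"
  assumes "X \<noteq> 0"
  shows "orth_proj (mat_image (col X)) t = ((X \<bullet> t) / (X \<bullet> X)) *\<^sub>R X"
    and "orth_proj ((mat_image (col X))\<^sup>\<bottom>) t = t - ((X \<bullet> t) / (X \<bullet> X)) *\<^sub>R X"
proof -
  let ?k = "(X \<bullet> t) / (X \<bullet> X)"
  have i: "?k *\<^sub>R X \<in> mat_image (col X)" by (auto simp: mat_image_col)
  have o: "t - ?k *\<^sub>R X \<in> (mat_image (col X))\<^sup>\<bottom>"
    using assms by (auto simp: mat_image_col orthogonal_comp_def orthogonal_def inner_diff_right)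
  show "orth_proj (mat_image (col X)) t = ?k *\<^sub>R X"
    by (rule orth_proj_eqI[OF subspace_mat_image_col i o])
  have "t - (t - ?k *\<^sub>R X) \<in> ((mat_image (col X))\<^sup>\<bottom>)\<^sup>\<bottom>"
    using i by (simp add: orthogonal_comp_def[of "(mat_image (col X))\<^sup>\<bottom>"]) (auto simp: orthogonal_comp_def orthogonal_commute)
  then show "orth_proj ((mat_image (col X))\<^sup>\<bottom>) t = t - ?k *\<^sub>R X"
    by (rule orth_proj_eqI[OF subspace_orthogonal_comp o])
qed

lemma pinv_col:
  fixes X t :: "real ^ 'q::finite"
  assumes "X \<noteq> 0"
  shows "pinv (col X) *v t = vec ((X \<bullet> t) / (X \<bullet> X))"
proof -
  define z :: "real ^ 'q ^ 1" where "z = (\<chi> i j. X $ j / (X \<bullet> X))"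
  have z: "z *v t = vec ((X \<bullet> t) / (X \<bullet> X))" for t
    by (simp add: z_def matrix_vector_mult_def vec_eq_iff inner_vec_def sum_divide_distrib)
  have "pinv (col X) = z"
    unfolding pinv_def
  proof (rule the_equality)
    have "{y :: real ^ 1. col X *v y = 0} = {0}"
      using assms by (auto simp: col_mult vec_eq_iff)
    then show "\<forall>t. col X *v (z *v t) = orth_proj (mat_image (col X)) t \<and> z *v t \<in> {y. col X *v y = 0}\<^sup>\<bottom>"
      by (simp add: z col_mult orth_proj_image(1)[OF assms] orthogonal_comp_def orthogonal_def)
    fix z' :: "real ^ 'q ^ 1"
    assume z': "\<forall>t. col X *v (z' *v t) = orth_proj (mat_image (col X)) t \<and> z' *v t \<in> {y. col X *v y = 0}\<^sup>\<bottom>"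
    have "z' *v t = z *v t" for t
    proof -
      have "(z' *v t) $ 1 *\<^sub>R X = ((X \<bullet> t) / (X \<bullet> X)) *\<^sub>R X"
        using z' by (simp add: col_mult orth_proj_image(1)[OF assms])
      then have "(z' *v t) $ 1 = (z *v t) $ 1" using assms by (simp add: z)
      then show ?thesis by (simp add: vec_eq_iff)
    qed
    then show "z' = z" by (simp add: matrix_eq)
  qed
  then show ?thesis by (simp add: z)
qed

text \<open>
Near \<open>\<tau> \<noteq> 0\<close> the end-point map of the group is the one of the model, conjugated with the linear
identification, so that its differential is bijective if and only if that of the model is.
\<close>

lemma conjugate_time_full_turn:
  fixes \<xi> \<tau> :: "real ^ 'q::finite"
  assumes \<tau>: "\<tau> \<noteq> 0" and ab: "\<xi> \<bullet> \<tau> \<noteq> 0 \<or> \<eta> \<noteq> 0"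
  shows "conjugate_time ((col \<xi>, vec \<eta> :: real ^ 1), \<tau>) (2 * pi / norm \<tau>)
     \<longleftrightarrow> \<eta> = 0 \<or> \<xi> - ((\<xi> \<bullet> \<tau>) / (norm \<tau>)\<^sup>2) *\<^sub>R \<tau> = 0"
proof -
  define s where "s = 2 * pi / norm \<tau>"
  let ?c = "((col \<xi>, vec \<eta> :: real ^ 1), \<tau>)"
  define \<Phi> :: "('q, 1) RH \<Rightarrow> ((real ^ 'q) \<times> real) \<times> (real ^ 'q)"
    where "\<Phi> = (\<lambda>c. ((uncol (fst (fst c)), snd (fst c) $ 1), snd c))"
  define \<Psi> :: "((real ^ 'q) \<times> real) \<times> (real ^ 'q) \<Rightarrow> ('q, 1) RH"
    where "\<Psi> = (\<lambda>d. ((col (fst (fst d)), vec (snd (fst d))), snd d))"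
  define D where "D = end_map_deriv \<xi> \<eta> \<tau>"
  have inv: "\<Psi> (\<Phi> c) = c" "\<Phi> (\<Psi> d) = d" for c d by (simp_all add: \<Phi>_def \<Psi>_def)
  have bij: "bij \<Phi>" "bij \<Psi>" by (rule bijI'; metis inv)+
  have \<Phi>: "bounded_linear \<Phi>" unfolding \<Phi>_def
    by (intro bounded_linear_Pair bounded_linear_compose[OF bounded_linear_uncol] bounded_linear_compose[OF bounded_linear_vec_nth]
        bounded_linear_fst_comp bounded_linear_snd_comp bounded_linear_ident)
  have \<Psi>: "bounded_linear \<Psi>" unfolding \<Psi>_def
    by (intro bounded_linear_Pair bounded_linear_compose[OF bounded_linear_col] bounded_linear_compose[OF bounded_linear_vec1]
        bounded_linear_fst_comp bounded_linear_snd_comp bounded_linear_ident)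
  have \<Phi>c: "\<Phi> ?c = ((\<xi>, \<eta>), \<tau>)" by (simp add: \<Phi>_def)
  have "(end_map s has_derivative D) (at (\<Phi> ?c))"
    unfolding \<Phi>c s_def D_def by (rule end_map_has_derivative[OF \<tau>])
  from has_derivative_compose[OF bounded_linear_imp_has_derivative[OF \<Phi>] this]
  have "((\<lambda>c. end_map s (\<Phi> c)) has_derivative (\<lambda>d. D (\<Phi> d))) (at ?c)" .
  from bounded_linear.has_derivative[OF \<Psi> this]
  have 1: "((\<lambda>c. \<Psi> (end_map s (\<Phi> c))) has_derivative (\<lambda>d. \<Psi> (D (\<Phi> d)))) (at ?c)" .
  have eq: "\<Psi> (end_map s (\<Phi> c)) = extremal c s" if "c \<in> {c. snd c \<noteq> 0}" for c
  proof -
    have c: "c = ((col (uncol (fst (fst c))), vec (snd (fst c) $ 1)), snd c)" by simp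
    show ?thesis
      by (subst (2) c, subst extremal_col) (use that in \<open>simp_all add: \<Psi>_def \<Phi>_def end_map_def\<close>)
  qed
  have "open {c :: ('q, 1) RH. snd c \<noteq> 0}" by (intro open_Collect_neq continuous_intros)
  from has_derivative_transform_within_open[OF 1 this _ eq] \<tau>
  have der: "((\<lambda>c. extremal c s) has_derivative (\<lambda>d. \<Psi> (D (\<Phi> d)))) (at ?c)" by simp
  have "bij (\<lambda>d. \<Psi> (D (\<Phi> d))) \<longleftrightarrow> bij D"
  proof
    assume b: "bij (\<lambda>d. \<Psi> (D (\<Phi> d)))"
    have "\<Phi> \<circ> ((\<lambda>d. \<Psi> (D (\<Phi> d))) \<circ> \<Psi>) = D" by (simp add: fun_eq_iff inv)
    then show "bij D" using bij_comp[OF bij_comp[OF bij(2) b] bij(1)] by simp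
  next
    assume b: "bij D"
    show "bij (\<lambda>d. \<Psi> (D (\<Phi> d)))"
      using bij_comp[OF bij_comp[OF bij(1) b] bij(2)] by (simp add: comp_def)
  qed
  moreover have "s > 0" using \<tau> by (simp add: s_def)
  moreover have "(\<exists>D'. ((\<lambda>c. extremal c s) has_derivative D') (at ?c) \<and> \<not> bij D') \<longleftrightarrow> \<not> bij (\<lambda>d. \<Psi> (D (\<Phi> d)))"
    using der has_derivative_unique[OF der] by metis
  ultimately show ?thesis
    unfolding conjugate_time_def s_def[symmetric]
    using end_map_deriv_bij_iff[OF \<tau> ab] by (auto simp: D_def)
qed

text \<open>
After a full turn the rotating part of the motion has closed up.
\<close>

lemma extremal_full_turn:
  fixes \<xi> \<tau> :: "'a::real_inner" and \<eta> :: real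
  assumes "\<tau> \<noteq> 0"
  defines "q \<equiv> (\<xi> \<bullet> \<tau>) / (norm \<tau>)\<^sup>2" and "s \<equiv> 2 * pi / norm \<tau>"
  shows "extremal_x \<xi> \<eta> \<tau> s = s *\<^sub>R (\<xi> - q *\<^sub>R \<tau>)"
    and "extremal_t \<xi> \<eta> \<tau> s = (pi * (\<eta>\<^sup>2 + q\<^sup>2 * (norm \<tau>)\<^sup>2) / norm \<tau> ^ 3) *\<^sub>R \<tau> - (s * q) *\<^sub>R (\<xi> - q *\<^sub>R \<tau>)"
proof -
  define \<theta> where "\<theta> = norm \<tau>"
  have \<theta>: "\<theta> > 0" using assms(1) by (simp add: \<theta>_def)
  have \<theta>s: "\<theta> * s = 2 * pi" using \<theta> by (simp add: s_def \<theta>_def)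
  have P: "\<xi> \<bullet> \<tau> = q * \<theta>\<^sup>2" using \<theta> by (simp add: q_def \<theta>_def)
  have Y: "extremal_y_integral \<xi> \<eta> \<tau> s = s * q"
    unfolding extremal_y_integral_def \<theta>_def[symmetric] \<theta>s P using \<theta> by (simp add: s_def \<theta>_def[symmetric] power2_eq_square power3_eq_cube)
  have y: "extremal_y \<xi> \<eta> \<tau> s = 0"
    unfolding extremal_y_def \<theta>_def[symmetric] \<theta>s by simp
  show "extremal_x \<xi> \<eta> \<tau> s = s *\<^sub>R (\<xi> - q *\<^sub>R \<tau>)"
    unfolding extremal_x_def Y by (simp add: scaleR_diff_right)
  show "extremal_t \<xi> \<eta> \<tau> s = (pi * (\<eta>\<^sup>2 + q\<^sup>2 * (norm \<tau>)\<^sup>2) / norm \<tau> ^ 3) *\<^sub>R \<tau> - (s * q) *\<^sub>R (\<xi> - q *\<^sub>R \<tau>)"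
    unfolding extremal_t_def Y y \<theta>_def[symmetric] \<theta>s P
    using \<theta> by (simp add: power2_eq_square mult.commute)
qed

theorem theorem1p3:
  fixes x :: "real ^ 1 ^ 'q::finite" and t :: "real ^ 'q"
  assumes "CARD('q) \<ge> 2"
    and "((x, 0), t) \<in> cut_locus"
  shows "\<forall>c. cut_point_along c ((x, 0), t) \<longrightarrow>
           (conjugate_time c (real_of_ereal (cut_time c)) \<longleftrightarrow>
            norm x * (norm (orth_proj ((mat_image x)\<^sup>\<bottom>) t) - pi * (norm (pinv x *v t))\<^sup>2) = 0)"
proof (intro allI impI)
  fix c :: "('q, 1) RH" assume c: "cut_point_along c ((x, 0), t)"
  define \<xi> \<eta> \<tau> where "\<xi> = uncol (fst (fst c))" and "\<eta> = snd (fst c) $ 1" and "\<tau> = snd c"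
  have ceq: "c = ((col \<xi>, vec \<eta>), \<tau>)" by (simp add: \<xi>_def \<eta>_def \<tau>_def)
  have "Aop \<tau> (col \<xi>, vec \<eta> :: real ^ 1) \<noteq> 0"
    using c cut_time_straight unfolding cut_point_along_def ceq by fastforce
  moreover have "col (0 :: real ^ 'q) = 0" "vec 0 = (0 :: real ^ 1)" by (simp_all add: col_def vec_eq_iff)
  ultimately have \<tau>: "\<tau> \<noteq> 0" and ab: "\<xi> \<bullet> \<tau> \<noteq> 0 \<or> \<eta> \<noteq> 0"
    by (auto simp: Aop_col zero_prod_def)
  define \<theta> where "\<theta> = norm \<tau>"
  define s where "s = 2 * pi / norm \<tau>"
  define q where "q = (\<xi> \<bullet> \<tau>) / (norm \<tau>)\<^sup>2"
  define w where "w = \<xi> - q *\<^sub>R \<tau>"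
  have \<theta>: "\<theta> > 0" using \<tau> by (simp add: \<theta>_def)
  have s: "s > 0" using \<tau> by (simp add: s_def)
  have ct: "real_of_ereal (cut_time c) = s" unfolding ceq cut_time_full_turn[OF \<tau> ab] s_def by simp
  have "((x, 0), t) = extremal c s" using c ct by (simp add: cut_point_along_def)
  then have x: "x = col (s *\<^sub>R w)"
    and t: "t = (pi * (\<eta>\<^sup>2 + q\<^sup>2 * \<theta>\<^sup>2) / \<theta> ^ 3) *\<^sub>R \<tau> - (s * q) *\<^sub>R w"
    unfolding ceq extremal_col[OF \<tau>] s_def w_def q_def \<theta>_def by (simp_all add: extremal_full_turn[OF \<tau>])
  have conj: "conjugate_time c (real_of_ereal (cut_time c)) \<longleftrightarrow> \<eta> = 0 \<or> w = 0"
    unfolding ct unfolding s_def ceq w_def q_def by (rule conjugate_time_full_turn[OF \<tau> ab])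
  show "conjugate_time c (real_of_ereal (cut_time c)) \<longleftrightarrow>
            norm x * (norm (orth_proj ((mat_image x)\<^sup>\<bottom>) t) - pi * (norm (pinv x *v t))\<^sup>2) = 0"
  proof (cases "w = 0")
    case True
    then have "norm x = 0" by (simp add: x col_def vec_eq_iff)
    then show ?thesis unfolding conj using True by simp
  next
    case False
    let ?X = "s *\<^sub>R w"
    have X: "?X \<noteq> 0" using False s by simp
    have "norm x \<noteq> 0" using X by (simp add: x norm_eq_sqrt_inner)
    have wt: "w \<bullet> \<tau> = 0" using \<theta>
      by (simp add: w_def inner_diff_left q_def \<theta>_def power2_norm_eq_inner)
    have k: "(?X \<bullet> t) / (?X \<bullet> ?X) = - q"
      unfolding t using s False by (simp add: inner_diff_right wt)
    have "orth_proj ((mat_image x)\<^sup>\<bottom>) t = (pi * (\<eta>\<^sup>2 + q\<^sup>2 * \<theta>\<^sup>2) / \<theta> ^ 3) *\<^sub>R \<tau>"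
      unfolding x orth_proj_image(2)[OF X] k by (simp add: t mult.commute)
    then have "norm (orth_proj ((mat_image x)\<^sup>\<bottom>) t) = pi * (\<eta>\<^sup>2 + q\<^sup>2 * \<theta>\<^sup>2) / \<theta>\<^sup>2"
      using \<theta> by (simp add: \<theta>_def[symmetric] abs_mult power2_eq_square power3_eq_cube)
    moreover have "norm (pinv x *v t) = \<bar>q\<bar>"
      unfolding x pinv_col[OF X] k by (simp add: norm_real)
    ultimately have "norm (orth_proj ((mat_image x)\<^sup>\<bottom>) t) - pi * (norm (pinv x *v t))\<^sup>2 = pi * \<eta>\<^sup>2 / \<theta>\<^sup>2"
      using \<theta> by (simp add: field_simps)
    then show ?thesis unfolding conj using False \<open>norm x \<noteq> 0\<close> \<theta> by simp
  qed
qed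

end
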